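(* Let $M$ be a left proper simplicial model category and $n\ge 0$. For all $X\in D^0/M$, there is a weak equivalence $$\Omega^n\,\mathrm{Map}_M\big(D^0,g_0^*(X)\big)\;\sim\;\mathrm{Map}_{S^{n-1}/M}\big(D^n,g_n^*(X)\big).$$
   Context: Left proper: weak equivalences are preserved by pushouts along cofibrations. **Spheres and disks in a model category $M$.** $S^{-1}$ is the initial object and $D^{-1}$ the terminal object of $M$, with the unique map $S^{-1}\to D^{-1}$. Inductively, for $n\ge0$, given $S^{n-1}\to D^{n-1}$, factor it as a cofibration followed by a weak equivalence $S^{n-1}\rightarrowtail D^n\xrightarrow{\sim}D^{n-1}$ (this defines $D^n$), and let $S^n=D^n\sqcup_{S^{n-1}}D^n$ be the pushout of $S^{n-1}\rightarrowtail D^n$ along itself, with the map $S^n\to D^n$ induced by the identity on both copies of $D^n$. For $n\ge0$, $g_n:S^{n-1}\to D^0$ is the composite $S^{n-1}\rightarrowtail D^n\xrightarrow{\sim}D^{n-1}\xrightarrow{\sim}\cdots\xrightarrow{\sim}D^0$. It induces $g_n^*:D^0/M\to S^{n-1}/M$ by precomposition. $D^n$ is regarded as an object of $S^{n-1}/M$ via $S^{n-1}\rightarrowtail D^n$. For $n=0$, $S^{-1}/M=M$. For an object $e\in M$, the comma category $e/M$ carries the usual simplicial model structure induced from $M$. For a simplicial model category $N$, $\mathrm{Map}_N(X,Y)$ is the homotopy mapping space, computed as the simplicial hom $\mathrm{SSet}_N(X^c,Y^f)$ with $X^c$ a cofibrant replacement of $X$ and $Y^f$ a fibrant replacement of $Y$.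 $\Omega$ is the (homotopy) loop space functor; the base point of $\mathrm{Map}_M(D^0,g_0^*(X))$ is the one given by the structure map $D^0\to X$. $\sim$ means weakly equivalent as simplicial sets. *)

theory Defs
  imports Main
begin

section \<open>Simplicial sets\<close>

text \<open>A weakly increasing map from \<open>[m] = {0,\<dots>,m}\<close> to \<open>[n] = {0,\<dots>,n}\<close> is coded by the list of
  its \<open>m + 1\<close> values.\<close>

definition Ops :: "nat \<Rightarrow> nat \<Rightarrow> nat list set" where
  "Ops m n = {\<theta>. length \<theta> = Suc m \<and> sorted \<theta> \<and> set \<theta> \<subseteq> {..n}}"

definition op_id :: "nat \<Rightarrow> nat list" where
  "op_id n = [0..<Suc n]"

definition op_comp :: "nat list \<Rightarrow> nat list \<Rightarrow> nat list" where
  "op_comp \<theta> \<phi> = map (\<lambda>i. \<theta> ! i) \<phi>"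

text \<open>\<open>Act X n \<theta>\<close> is the map \<open>X\<^sub>n \<rightarrow> X\<^sub>m\<close> induced by \<open>\<theta> : [m] \<rightarrow> [n]\<close>.\<close>

record 'a sset =
  Simp :: "nat \<Rightarrow> 'a set"
  Act :: "nat \<Rightarrow> nat list \<Rightarrow> 'a \<Rightarrow> 'a"

definition simplicial_set :: "'a sset \<Rightarrow> bool" where
  "simplicial_set X \<longleftrightarrow>
     (\<forall>m n. \<forall>\<theta>\<in>Ops m n. \<forall>x\<in>Simp X n. Act X n \<theta> x \<in> Simp X m) \<and>
     (\<forall>n. \<forall>x\<in>Simp X n. Act X n (op_id n) x = x) \<and>
     (\<forall>l m n. \<forall>\<phi>\<in>Ops l m. \<forall>\<theta>\<in>Ops m n. \<forall>x\<in>Simp X n.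
        Act X n (op_comp \<theta> \<phi>) x = Act X m \<phi> (Act X n \<theta> x))"

definition simplicial_map :: "'a sset \<Rightarrow> 'b sset \<Rightarrow> (nat \<Rightarrow> 'a \<Rightarrow> 'b) \<Rightarrow> bool" where
  "simplicial_map X Y f \<longleftrightarrow>
     (\<forall>n. \<forall>x\<in>Simp X n. f n x \<in> Simp Y n) \<and>
     (\<forall>m n. \<forall>\<theta>\<in>Ops m n. \<forall>x\<in>Simp X n. f m (Act X n \<theta> x) = Act Y n \<theta> (f n x))"

definition sset_iso :: "'a sset \<Rightarrow> 'b sset \<Rightarrow> (nat \<Rightarrow> 'a \<Rightarrow> 'b) \<Rightarrow> bool" where
  "sset_iso X Y f \<longleftrightarrow> simplicial_map X Y f \<and> (\<forall>n. bij_betw (f n) (Simp X n) (Simp Y n))"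

text \<open>The totally degenerate \<open>n\<close>-simplex on a vertex.\<close>

definition degen :: "'a sset \<Rightarrow> nat \<Rightarrow> 'a \<Rightarrow> 'a" where
  "degen X n x = Act X 0 (replicate (Suc n) 0) x"

definition std_simplex :: "nat \<Rightarrow> nat list sset" where
  "std_simplex n = \<lparr>Simp = (\<lambda>m. Ops m n), Act = (\<lambda>m \<theta> \<alpha>. op_comp \<alpha> \<theta>)\<rparr>"

text \<open>The union of all faces of the standard simplex except the \<open>k\<close>-th one.\<close>

definition horn :: "nat \<Rightarrow> nat \<Rightarrow> nat list sset" where
  "horn n k = \<lparr>Simp = (\<lambda>m. {\<alpha> \<in> Ops m n. \<exists>j\<le>n. j \<noteq> k \<and> j \<notin> set \<alpha>}),
               Act = (\<lambda>m \<theta> \<alpha>. op_comp \<alpha> \<theta>)\<rparr>"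

definition sset_prod :: "'a sset \<Rightarrow> 'b sset \<Rightarrow> ('a \<times> 'b) sset" where
  "sset_prod X Y = \<lparr>Simp = (\<lambda>n. Simp X n \<times> Simp Y n),
                    Act = (\<lambda>n \<theta> z. (Act X n \<theta> (fst z), Act Y n \<theta> (snd z)))\<rparr>"

definition sset_pullback ::
    "'a sset \<Rightarrow> 'b sset \<Rightarrow> (nat \<Rightarrow> 'a \<Rightarrow> 'c) \<Rightarrow> (nat \<Rightarrow> 'b \<Rightarrow> 'c) \<Rightarrow> ('a \<times> 'b) sset" where
  "sset_pullback X Y f g =
     \<lparr>Simp = (\<lambda>n. {z \<in> Simp X n \<times> Simp Y n. f n (fst z) = g n (snd z)}),
      Act = (\<lambda>n \<theta> z. (Act X n \<theta> (fst z), Act Y n \<theta> (snd z)))\<rparr>"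

text \<open>The function complex: its \<open>n\<close>-simplices are the simplicial maps \<open>K \<times> \<Delta>\<^sup>n \<rightarrow> L\<close>, made canonical
  as HOL functions by the value \<open>undefined\<close> outside \<open>K \<times> \<Delta>\<^sup>n\<close>.\<close>

definition cut :: "'a sset \<Rightarrow> (nat \<Rightarrow> 'a \<Rightarrow> 'b) \<Rightarrow> nat \<Rightarrow> 'a \<Rightarrow> 'b" where
  "cut X h = (\<lambda>m z. if z \<in> Simp X m then h m z else undefined)"

definition fun_complex :: "'a sset \<Rightarrow> 'b sset \<Rightarrow> (nat \<Rightarrow> 'a \<times> nat list \<Rightarrow> 'b) sset" where
  "fun_complex K L =
     \<lparr>Simp = (\<lambda>n. {h. simplicial_map (sset_prod K (std_simplex n)) L h \<and>
                       h = cut (sset_prod K (std_simplex n)) h}),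
      Act = (\<lambda>n \<theta> h. cut (sset_prod K (std_simplex (length \<theta> - 1)))
                         (\<lambda>m z. h m (fst z, op_comp \<theta> (snd z))))\<rparr>"

definition kan_complex :: "'a sset \<Rightarrow> bool" where
  "kan_complex X \<longleftrightarrow> simplicial_set X \<and>
     (\<forall>n\<ge>1. \<forall>k\<le>n. \<forall>u. simplicial_map (horn n k) X u \<longrightarrow>
        (\<exists>h. simplicial_map (std_simplex n) X h \<and>
             (\<forall>m. \<forall>\<alpha>\<in>Simp (horn n k) m. h m \<alpha> = u m \<alpha>)))"

definition kan_fibration :: "'a sset \<Rightarrow> 'b sset \<Rightarrow> (nat \<Rightarrow> 'a \<Rightarrow> 'b) \<Rightarrow> bool" where
  "kan_fibration X Y p \<longleftrightarrow> simplicial_set X \<and> simplicial_set Y \<and> simplicial_map X Y p \<and>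
     (\<forall>n\<ge>1. \<forall>k\<le>n. \<forall>u v.
        simplicial_map (horn n k) X u \<longrightarrow> simplicial_map (std_simplex n) Y v \<longrightarrow>
        (\<forall>m. \<forall>\<alpha>\<in>Simp (horn n k) m. p m (u m \<alpha>) = v m \<alpha>) \<longrightarrow>
        (\<exists>h. simplicial_map (std_simplex n) X h \<and>
             (\<forall>m. \<forall>\<alpha>\<in>Simp (horn n k) m. h m \<alpha> = u m \<alpha>) \<and>
             (\<forall>m. \<forall>\<alpha>\<in>Simp (std_simplex n) m. p m (h m \<alpha>) = v m \<alpha>)))"

text \<open>On maps into a Kan complex this is an equivalence relation, whose classes are the connected
  components of the function complex.\<close>

definition sset_homotopic ::
    "'a sset \<Rightarrow> 'b sset \<Rightarrow> (nat \<Rightarrow> 'a \<Rightarrow> 'b) \<Rightarrow> (nat \<Rightarrow> 'a \<Rightarrow> 'b) \<Rightarrow> bool" where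
  "sset_homotopic K L f g \<longleftrightarrow>
     (\<exists>H. simplicial_map (sset_prod K (std_simplex 1)) L H \<and>
          (\<forall>n. \<forall>x\<in>Simp K n. H n (x, replicate (Suc n) 0) = f n x \<and>
                            H n (x, replicate (Suc n) 1) = g n x))"

text \<open>Weak homotopy equivalences: precomposition induces a bijection on homotopy classes of maps into
  every Kan complex \<open>Z\<close> (the definition used by Joyal--Tierney and in Kerodon).  Since HOL does not
  quantify over types inside a formula, \<open>Z\<close> ranges over Kan complexes with simplices in
  \<open>('a + 'b) list\<close>.  That type contains copies of the Kan replacements \<open>Ex\<^sup>\<infinity>\<close> of \<open>K\<close> and \<open>L\<close>, whose
  simplices are given by finite data, and testing against those two already suffices.\<close>

definition weak_equivalence :: "'a sset \<Rightarrow> 'b sset \<Rightarrow> (nat \<Rightarrow> 'a \<Rightarrow> 'b) \<Rightarrow> bool" where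
  "weak_equivalence K L f \<longleftrightarrow> simplicial_set K \<and> simplicial_set L \<and> simplicial_map K L f \<and>
     (\<forall>Z :: ('a + 'b) list sset. kan_complex Z \<longrightarrow>
        (\<forall>g. simplicial_map K Z g \<longrightarrow>
           (\<exists>h. simplicial_map L Z h \<and> sset_homotopic K Z (\<lambda>n x. h n (f n x)) g)) \<and>
        (\<forall>h h'. simplicial_map L Z h \<longrightarrow> simplicial_map L Z h' \<longrightarrow>
           sset_homotopic K Z (\<lambda>n x. h n (f n x)) (\<lambda>n x. h' n (f n x)) \<longrightarrow>
           sset_homotopic L Z h h'))"

definition relabel :: "('a \<Rightarrow> 'b) \<Rightarrow> 'a sset \<Rightarrow> 'b sset" where
  "relabel e X = \<lparr>Simp = (\<lambda>n. e ` Simp X n), Act = (\<lambda>n \<theta> y. e (Act X n \<theta> (inv e y)))\<rparr>"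

text \<open>Two simplicial sets are weakly equivalent if they are joined by a finite zigzag of weak
  equivalences.  The zigzag is formed in a type large enough to hold copies of both of them and of
  their Kan replacements.\<close>

definition weakly_equivalent :: "'a sset \<Rightarrow> 'b sset \<Rightarrow> bool" where
  "weakly_equivalent X Y \<longleftrightarrow>
     equivclp (\<lambda>K L :: ('a + 'b) list sset. \<exists>f. weak_equivalence K L f)
       (relabel (\<lambda>x. [Inl x]) X) (relabel (\<lambda>y. [Inr y]) Y)"

subsection \<open>Loop spaces\<close>

text \<open>The path space of a pointed simplicial set and its loop space (as in May, Simplicial Objects in
  Algebraic Topology, up to the orientation of simplices): an \<open>n\<close>-simplex of the path
  space is an \<open>(n+1)\<close>-simplex \<open>y\<close> whose initial vertex is the base point, its end is the \<open>0\<close>-th face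
  of \<open>y\<close>, and the loop space is the fibre of the end map.  For a Kan complex the path space is
  contractible and the end map is a Kan fibration, so that the fibre is the homotopy loop space.
  This model does not change the type of simplices and hence can be iterated.\<close>

definition path_space :: "'a sset \<times> 'a \<Rightarrow> 'a sset" where
  "path_space P = \<lparr>Simp = (\<lambda>n. {y \<in> Simp (fst P) (Suc n). Act (fst P) (Suc n) [0] y = snd P}),
                   Act = (\<lambda>n \<theta>. Act (fst P) (Suc n) (0 # map Suc \<theta>))\<rparr>"

definition path_end :: "'a sset \<times> 'a \<Rightarrow> nat \<Rightarrow> 'a \<Rightarrow> 'a" where
  "path_end P n y = Act (fst P) (Suc n) [1..<Suc (Suc n)] y"

definition loop_space :: "'a sset \<times> 'a \<Rightarrow> 'a sset \<times> 'a" where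
  "loop_space P =
     (\<lparr>Simp = (\<lambda>n. {y \<in> Simp (path_space P) n. path_end P n y = degen (fst P) n (snd P)}),
       Act = Act (path_space P)\<rparr>,
      degen (fst P) 1 (snd P))"

section \<open>Categories, limits and colimits\<close>

text \<open>Categories are given by hom-sets; \<open>Cmp C X Y Z g f\<close> is the composite of \<open>f : X \<rightarrow> Y\<close> with
  \<open>g : Y \<rightarrow> Z\<close>.\<close>

record ('o, 'm) cat =
  Obj :: "'o set"
  Hom :: "'o \<Rightarrow> 'o \<Rightarrow> 'm set"
  Cmp :: "'o \<Rightarrow> 'o \<Rightarrow> 'o \<Rightarrow> 'm \<Rightarrow> 'm \<Rightarrow> 'm"
  Ide :: "'o \<Rightarrow> 'm"

definition is_category :: "('o, 'm) cat \<Rightarrow> bool" where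
  "is_category C \<longleftrightarrow>
     (\<forall>X\<in>Obj C. Ide C X \<in> Hom C X X) \<and>
     (\<forall>X\<in>Obj C. \<forall>Y\<in>Obj C. \<forall>Z\<in>Obj C. \<forall>f\<in>Hom C X Y. \<forall>g\<in>Hom C Y Z.
        Cmp C X Y Z g f \<in> Hom C X Z) \<and>
     (\<forall>X\<in>Obj C. \<forall>Y\<in>Obj C. \<forall>f\<in>Hom C X Y.
        Cmp C X X Y f (Ide C X) = f \<and> Cmp C X Y Y (Ide C Y) f = f) \<and>
     (\<forall>W\<in>Obj C. \<forall>X\<in>Obj C. \<forall>Y\<in>Obj C. \<forall>Z\<in>Obj C.
        \<forall>f\<in>Hom C W X. \<forall>g\<in>Hom C X Y. \<forall>h\<in>Hom C Y Z.
          Cmp C W X Z (Cmp C X Y Z h g) f = Cmp C W Y Z h (Cmp C W X Y g f))"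

definition is_functor ::
    "('i, 'j) cat \<Rightarrow> ('o, 'm) cat \<Rightarrow> ('i \<Rightarrow> 'o) \<Rightarrow> ('i \<Rightarrow> 'i \<Rightarrow> 'j \<Rightarrow> 'm) \<Rightarrow> bool" where
  "is_functor J C F0 F1 \<longleftrightarrow>
     (\<forall>i\<in>Obj J. F0 i \<in> Obj C \<and> F1 i i (Ide J i) = Ide C (F0 i)) \<and>
     (\<forall>i\<in>Obj J. \<forall>j\<in>Obj J. \<forall>a\<in>Hom J i j. F1 i j a \<in> Hom C (F0 i) (F0 j)) \<and>
     (\<forall>i\<in>Obj J. \<forall>j\<in>Obj J. \<forall>k\<in>Obj J. \<forall>a\<in>Hom J i j. \<forall>b\<in>Hom J j k.
        F1 i k (Cmp J i j k b a) = Cmp C (F0 i) (F0 j) (F0 k) (F1 j k b) (F1 i j a))"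

definition is_cone :: "('i, 'j) cat \<Rightarrow> ('o, 'm) cat \<Rightarrow> ('i \<Rightarrow> 'o) \<Rightarrow> ('i \<Rightarrow> 'i \<Rightarrow> 'j \<Rightarrow> 'm) \<Rightarrow>
    'o \<Rightarrow> ('i \<Rightarrow> 'm) \<Rightarrow> bool" where
  "is_cone J C F0 F1 L p \<longleftrightarrow> L \<in> Obj C \<and> (\<forall>i\<in>Obj J. p i \<in> Hom C L (F0 i)) \<and>
     (\<forall>i\<in>Obj J. \<forall>j\<in>Obj J. \<forall>a\<in>Hom J i j. Cmp C L (F0 i) (F0 j) (F1 i j a) (p i) = p j)"

definition is_limit :: "('i, 'j) cat \<Rightarrow> ('o, 'm) cat \<Rightarrow> ('i \<Rightarrow> 'o) \<Rightarrow> ('i \<Rightarrow> 'i \<Rightarrow> 'j \<Rightarrow> 'm) \<Rightarrow>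
    'o \<Rightarrow> ('i \<Rightarrow> 'm) \<Rightarrow> bool" where
  "is_limit J C F0 F1 L p \<longleftrightarrow> is_cone J C F0 F1 L p \<and>
     (\<forall>X q. is_cone J C F0 F1 X q \<longrightarrow>
        (\<exists>!u. u \<in> Hom C X L \<and> (\<forall>i\<in>Obj J. Cmp C X L (F0 i) (p i) u = q i)))"

definition is_cocone :: "('i, 'j) cat \<Rightarrow> ('o, 'm) cat \<Rightarrow> ('i \<Rightarrow> 'o) \<Rightarrow> ('i \<Rightarrow> 'i \<Rightarrow> 'j \<Rightarrow> 'm) \<Rightarrow>
    'o \<Rightarrow> ('i \<Rightarrow> 'm) \<Rightarrow> bool" where
  "is_cocone J C F0 F1 L p \<longleftrightarrow> L \<in> Obj C \<and> (\<forall>i\<in>Obj J. p i \<in> Hom C (F0 i) L) \<and>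
     (\<forall>i\<in>Obj J. \<forall>j\<in>Obj J. \<forall>a\<in>Hom J i j. Cmp C (F0 i) (F0 j) L (p j) (F1 i j a) = p i)"

definition is_colimit :: "('i, 'j) cat \<Rightarrow> ('o, 'm) cat \<Rightarrow> ('i \<Rightarrow> 'o) \<Rightarrow> ('i \<Rightarrow> 'i \<Rightarrow> 'j \<Rightarrow> 'm) \<Rightarrow>
    'o \<Rightarrow> ('i \<Rightarrow> 'm) \<Rightarrow> bool" where
  "is_colimit J C F0 F1 L p \<longleftrightarrow> is_cocone J C F0 F1 L p \<and>
     (\<forall>X q. is_cocone J C F0 F1 X q \<longrightarrow>
        (\<exists>!u. u \<in> Hom C L X \<and> (\<forall>i\<in>Obj J. Cmp C (F0 i) L X u (p i) = q i)))"

text \<open>``Small'' means: with objects and morphisms in the parameter type \<open>'k\<close>, which is unrelated to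
  the types of the objects and morphisms of \<open>C\<close>.  (A category that has all limits indexed by its own
  set of morphisms is a preorder, so the type of \<open>C\<close> itself must not be used here.)\<close>

definition bicomplete :: "'k itself \<Rightarrow> ('o, 'm) cat \<Rightarrow> bool" where
  "bicomplete (_ :: 'k itself) C \<longleftrightarrow>
     (\<forall>(J :: ('k, 'k) cat) F0 F1. is_category J \<longrightarrow> is_functor J C F0 F1 \<longrightarrow>
        (\<exists>L p. is_limit J C F0 F1 L p) \<and> (\<exists>L p. is_colimit J C F0 F1 L p))"

definition is_initial :: "('o, 'm) cat \<Rightarrow> 'o \<Rightarrow> bool" where
  "is_initial C I \<longleftrightarrow> I \<in> Obj C \<and> (\<forall>X\<in>Obj C. \<exists>!f. f \<in> Hom C I X)"

definition is_terminal :: "('o, 'm) cat \<Rightarrow> 'o \<Rightarrow> bool" where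
  "is_terminal C T \<longleftrightarrow> T \<in> Obj C \<and> (\<forall>X\<in>Obj C. \<exists>!f. f \<in> Hom C X T)"

text \<open>\<open>P\<close> with \<open>j : B \<rightarrow> P\<close> and \<open>k : C \<rightarrow> P\<close> is a pushout of \<open>f : A \<rightarrow> B\<close> and \<open>g : A \<rightarrow> C\<close>.\<close>

definition is_pushout :: "('o, 'm) cat \<Rightarrow> 'o \<Rightarrow> 'o \<Rightarrow> 'o \<Rightarrow> 'o \<Rightarrow> 'm \<Rightarrow> 'm \<Rightarrow> 'm \<Rightarrow> 'm \<Rightarrow> bool" where
  "is_pushout M A B C P f g j k \<longleftrightarrow>
     A \<in> Obj M \<and> B \<in> Obj M \<and> C \<in> Obj M \<and> P \<in> Obj M \<and>
     f \<in> Hom M A B \<and> g \<in> Hom M A C \<and> j \<in> Hom M B P \<and> k \<in> Hom M C P \<and>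
     Cmp M A B P j f = Cmp M A C P k g \<and>
     (\<forall>X\<in>Obj M. \<forall>x\<in>Hom M B X. \<forall>y\<in>Hom M C X. Cmp M A B X x f = Cmp M A C X y g \<longrightarrow>
        (\<exists>!u. u \<in> Hom M P X \<and> Cmp M B P X u j = x \<and> Cmp M C P X u k = y))"

section \<open>Model categories\<close>

definition is_retract :: "('o, 'm) cat \<Rightarrow> 'o \<Rightarrow> 'o \<Rightarrow> 'm \<Rightarrow> 'o \<Rightarrow> 'o \<Rightarrow> 'm \<Rightarrow> bool" where
  "is_retract C X Y f A B g \<longleftrightarrow>
     (\<exists>s\<in>Hom C X A. \<exists>r\<in>Hom C A X. \<exists>s'\<in>Hom C Y B. \<exists>r'\<in>Hom C B Y.
        Cmp C X A X r s = Ide C X \<and> Cmp C Y B Y r' s' = Ide C Y \<and>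
        Cmp C X A B g s = Cmp C X Y B s' f \<and> Cmp C A X Y f r = Cmp C A B Y r' g)"

definition lifts :: "('o, 'm) cat \<Rightarrow> 'o \<Rightarrow> 'o \<Rightarrow> 'm \<Rightarrow> 'o \<Rightarrow> 'o \<Rightarrow> 'm \<Rightarrow> bool" where
  "lifts C A B i X Y p \<longleftrightarrow>
     (\<forall>u\<in>Hom C A X. \<forall>v\<in>Hom C B Y. Cmp C A X Y p u = Cmp C A B Y v i \<longrightarrow>
        (\<exists>h\<in>Hom C B X. Cmp C A B X h i = u \<and> Cmp C B X Y p h = v))"

type_synonym ('o, 'm) mor_class = "'o \<Rightarrow> 'o \<Rightarrow> 'm set"

definition two_of_three :: "('o, 'm) cat \<Rightarrow> ('o, 'm) mor_class \<Rightarrow> bool" where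
  "two_of_three C W \<longleftrightarrow>
     (\<forall>X\<in>Obj C. \<forall>Y\<in>Obj C. \<forall>Z\<in>Obj C. \<forall>f\<in>Hom C X Y. \<forall>g\<in>Hom C Y Z.
        (f \<in> W X Y \<and> g \<in> W Y Z \<longrightarrow> Cmp C X Y Z g f \<in> W X Z) \<and>
        (f \<in> W X Y \<and> Cmp C X Y Z g f \<in> W X Z \<longrightarrow> g \<in> W Y Z) \<and>
        (g \<in> W Y Z \<and> Cmp C X Y Z g f \<in> W X Z \<longrightarrow> f \<in> W X Y))"

definition retract_closed :: "('o, 'm) cat \<Rightarrow> ('o, 'm) mor_class \<Rightarrow> bool" where
  "retract_closed C W \<longleftrightarrow>
     (\<forall>X\<in>Obj C. \<forall>Y\<in>Obj C. \<forall>A\<in>Obj C. \<forall>B\<in>Obj C. \<forall>f\<in>Hom C X Y. \<forall>g\<in>W A B.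
        is_retract C X Y f A B g \<longrightarrow> f \<in> W X Y)"

definition all_lift :: "('o, 'm) cat \<Rightarrow> ('o, 'm) mor_class \<Rightarrow> ('o, 'm) mor_class \<Rightarrow> bool" where
  "all_lift C L R \<longleftrightarrow>
     (\<forall>A\<in>Obj C. \<forall>B\<in>Obj C. \<forall>X\<in>Obj C. \<forall>Y\<in>Obj C. \<forall>i\<in>L A B. \<forall>p\<in>R X Y. lifts C A B i X Y p)"

definition all_factor :: "('o, 'm) cat \<Rightarrow> ('o, 'm) mor_class \<Rightarrow> ('o, 'm) mor_class \<Rightarrow> bool" where
  "all_factor C L R \<longleftrightarrow>
     (\<forall>X\<in>Obj C. \<forall>Y\<in>Obj C. \<forall>f\<in>Hom C X Y. \<exists>Z\<in>Obj C. \<exists>i\<in>L X Z. \<exists>p\<in>R Z Y. f = Cmp C X Z Y p i)"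

definition model_category :: "'k itself \<Rightarrow> ('o, 'm) cat \<Rightarrow>
    ('o, 'm) mor_class \<Rightarrow> ('o, 'm) mor_class \<Rightarrow> ('o, 'm) mor_class \<Rightarrow> bool" where
  "model_category k C cof fib weq \<longleftrightarrow>
     is_category C \<and> bicomplete k C \<and>
     (\<forall>X\<in>Obj C. \<forall>Y\<in>Obj C. cof X Y \<subseteq> Hom C X Y \<and> fib X Y \<subseteq> Hom C X Y \<and> weq X Y \<subseteq> Hom C X Y) \<and>
     two_of_three C weq \<and>
     retract_closed C cof \<and> retract_closed C fib \<and> retract_closed C weq \<and>
     all_lift C cof (\<lambda>X Y. fib X Y \<inter> weq X Y) \<and>
     all_lift C (\<lambda>X Y. cof X Y \<inter> weq X Y) fib \<and>
     all_factor C cof (\<lambda>X Y. fib X Y \<inter> weq X Y) \<and>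
     all_factor C (\<lambda>X Y. cof X Y \<inter> weq X Y) fib"

definition left_proper ::
    "('o, 'm) cat \<Rightarrow> ('o, 'm) mor_class \<Rightarrow> ('o, 'm) mor_class \<Rightarrow> bool" where
  "left_proper M cof weq \<longleftrightarrow>
     (\<forall>A B C P i f j k. is_pushout M A B C P i f j k \<longrightarrow> i \<in> cof A B \<longrightarrow> f \<in> weq A C \<longrightarrow>
        j \<in> weq B P)"

section \<open>Simplicial model categories\<close>

text \<open>A simplicially enriched category with three classes of morphisms.  The morphisms \<open>X \<rightarrow> Y\<close> of the
  underlying category are the vertices of the simplicial hom \<open>SMap M X Y\<close>, and
  \<open>SCmp M X Y Z n g f\<close> is the composite of the \<open>n\<close>-simplices \<open>f\<close> of \<open>SMap M X Y\<close> and \<open>g\<close> of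
  \<open>SMap M Y Z\<close>.\<close>

record ('o, 's) smcat =
  SObj :: "'o set"
  SMap :: "'o \<Rightarrow> 'o \<Rightarrow> 's sset"
  SCmp :: "'o \<Rightarrow> 'o \<Rightarrow> 'o \<Rightarrow> nat \<Rightarrow> 's \<Rightarrow> 's \<Rightarrow> 's"
  SIde :: "'o \<Rightarrow> 's"
  Cof :: "('o, 's) mor_class"
  Fib :: "('o, 's) mor_class"
  Weq :: "('o, 's) mor_class"

definition ucat :: "('o, 's) smcat \<Rightarrow> ('o, 's) cat" where
  "ucat M = \<lparr>Obj = SObj M, Hom = (\<lambda>X Y. Simp (SMap M X Y) 0),
             Cmp = (\<lambda>X Y Z. SCmp M X Y Z 0), Ide = SIde M\<rparr>"

definition simplicial_category :: "('o, 's) smcat \<Rightarrow> bool" where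
  "simplicial_category M \<longleftrightarrow>
     (\<forall>X\<in>SObj M. \<forall>Y\<in>SObj M. simplicial_set (SMap M X Y)) \<and>
     (\<forall>X\<in>SObj M. SIde M X \<in> Simp (SMap M X X) 0) \<and>
     (\<forall>X\<in>SObj M. \<forall>Y\<in>SObj M. \<forall>Z\<in>SObj M.
        simplicial_map (sset_prod (SMap M Y Z) (SMap M X Y)) (SMap M X Z)
          (\<lambda>n z. SCmp M X Y Z n (fst z) (snd z))) \<and>
     (\<forall>X\<in>SObj M. \<forall>Y\<in>SObj M. \<forall>n. \<forall>f\<in>Simp (SMap M X Y) n.
        SCmp M X X Y n f (degen (SMap M X X) n (SIde M X)) = f \<and>
        SCmp M X Y Y n (degen (SMap M Y Y) n (SIde M Y)) f = f) \<and>
     (\<forall>W\<in>SObj M. \<forall>X\<in>SObj M. \<forall>Y\<in>SObj M. \<forall>Z\<in>SObj M. \<forall>n.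
        \<forall>f\<in>Simp (SMap M W X) n. \<forall>g\<in>Simp (SMap M X Y) n. \<forall>h\<in>Simp (SMap M Y Z) n.
          SCmp M W X Z n (SCmp M X Y Z n h g) f = SCmp M W Y Z n h (SCmp M W X Y n g f))"

text \<open>\<open>T\<close> is the tensor \<open>X \<otimes> K\<close>, with unit \<open>\<eta> : K \<rightarrow> Map(X, T)\<close>: the map
  \<open>Map(T, Y) \<rightarrow> Map(K, Map(X, Y))\<close> obtained from \<open>\<eta>\<close> by composition is an isomorphism for all \<open>Y\<close>.
  Dually, \<open>P\<close> is the cotensor of \<open>Y\<close> by \<open>K\<close>, with counit \<open>\<epsilon> : K \<rightarrow> Map(P, Y)\<close>.  By the (enriched) Yoneda
  lemma this is the same as an isomorphism natural in the remaining variable.\<close>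

definition is_tensor :: "('o, 's) smcat \<Rightarrow> 'o \<Rightarrow> 'k sset \<Rightarrow> 'o \<Rightarrow> (nat \<Rightarrow> 'k \<Rightarrow> 's) \<Rightarrow> bool" where
  "is_tensor M X K T \<eta> \<longleftrightarrow> T \<in> SObj M \<and> simplicial_map K (SMap M X T) \<eta> \<and>
     (\<forall>Y\<in>SObj M. sset_iso (SMap M T Y) (fun_complex K (SMap M X Y))
        (\<lambda>n f. cut (sset_prod K (std_simplex n))
           (\<lambda>m z. SCmp M X T Y m (Act (SMap M T Y) n (snd z) f) (\<eta> m (fst z)))))"

definition is_cotensor :: "('o, 's) smcat \<Rightarrow> 'o \<Rightarrow> 'k sset \<Rightarrow> 'o \<Rightarrow> (nat \<Rightarrow> 'k \<Rightarrow> 's) \<Rightarrow> bool" where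
  "is_cotensor M Y K P \<epsilon> \<longleftrightarrow> P \<in> SObj M \<and> simplicial_map K (SMap M P Y) \<epsilon> \<and>
     (\<forall>X\<in>SObj M. sset_iso (SMap M X P) (fun_complex K (SMap M X Y))
        (\<lambda>n f. cut (sset_prod K (std_simplex n))
           (\<lambda>m z. SCmp M X P Y m (\<epsilon> m (fst z)) (Act (SMap M X P) n (snd z) f))))"

definition precomp :: "('o, 's) smcat \<Rightarrow> 'o \<Rightarrow> 'o \<Rightarrow> 'o \<Rightarrow> 's \<Rightarrow> nat \<Rightarrow> 's \<Rightarrow> 's" where
  "precomp M A B X i n f = SCmp M A B X n f (degen (SMap M A B) n i)"

definition postcomp :: "('o, 's) smcat \<Rightarrow> 'o \<Rightarrow> 'o \<Rightarrow> 'o \<Rightarrow> 's \<Rightarrow> nat \<Rightarrow> 's \<Rightarrow> 's" where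
  "postcomp M A X Y p n f = SCmp M A X Y n (degen (SMap M X Y) n p) f"

text \<open>The map \<open>Map(B, X) \<rightarrow> Map(A, X) \<times>\<^bsub>Map(A, Y)\<^esub> Map(B, Y)\<close>.\<close>

definition corner_target ::
    "('o, 's) smcat \<Rightarrow> 'o \<Rightarrow> 'o \<Rightarrow> 's \<Rightarrow> 'o \<Rightarrow> 'o \<Rightarrow> 's \<Rightarrow> ('s \<times> 's) sset" where
  "corner_target M A B i X Y p =
     sset_pullback (SMap M A X) (SMap M B Y) (postcomp M A X Y p) (precomp M A B Y i)"

definition corner_map ::
    "('o, 's) smcat \<Rightarrow> 'o \<Rightarrow> 'o \<Rightarrow> 's \<Rightarrow> 'o \<Rightarrow> 'o \<Rightarrow> 's \<Rightarrow> nat \<Rightarrow> 's \<Rightarrow> 's \<times> 's" where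
  "corner_map M A B i X Y p n f = (precomp M A B X i n f, postcomp M B X Y p n f)"

definition simplicial_model_category :: "'k itself \<Rightarrow> ('o, 's) smcat \<Rightarrow> bool" where
  "simplicial_model_category (k :: 'k itself) M \<longleftrightarrow>
     simplicial_category M \<and>
     model_category k (ucat M) (Cof M) (Fib M) (Weq M) \<and>
     (\<forall>X\<in>SObj M. \<forall>K :: 'k sset. simplicial_set K \<longrightarrow>
        (\<exists>T \<eta>. is_tensor M X K T \<eta>) \<and> (\<exists>P \<epsilon>. is_cotensor M X K P \<epsilon>)) \<and>
     (\<forall>A\<in>SObj M. \<forall>B\<in>SObj M. \<forall>X\<in>SObj M. \<forall>Y\<in>SObj M. \<forall>i\<in>Cof M A B. \<forall>p\<in>Fib M X Y.
        kan_fibration (SMap M B X) (corner_target M A B i X Y p) (corner_map M A B i X Y p) \<and>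
        (i \<in> Weq M A B \<or> p \<in> Weq M X Y \<longrightarrow>
           weak_equivalence (SMap M B X) (corner_target M A B i X Y p) (corner_map M A B i X Y p)))"

definition left_proper_simplicial_model_category :: "'k itself \<Rightarrow> ('o, 's) smcat \<Rightarrow> bool" where
  "left_proper_simplicial_model_category k M \<longleftrightarrow>
     simplicial_model_category k M \<and> left_proper (ucat M) (Cof M) (Weq M)"

text \<open>The comma category \<open>e/M\<close>: an object is a pair of an object \<open>A\<close> of \<open>M\<close> and a morphism \<open>a : e \<rightarrow> A\<close>;
  the simplicial hom from \<open>(A, a)\<close> to \<open>(B, b)\<close> is the fibre over \<open>b\<close> of
  \<open>a\<^sup>* : Map(A, B) \<rightarrow> Map(e, B)\<close>.\<close>

definition under :: "('o, 's) smcat \<Rightarrow> 'o \<Rightarrow> ('o \<times> 's, 's) smcat" where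
  "under M e =
     (let H = (\<lambda>X Y. \<lparr>Simp = (\<lambda>n. {f \<in> Simp (SMap M (fst X) (fst Y)) n.
                               precomp M e (fst X) (fst Y) (snd X) n f
                                 = degen (SMap M e (fst Y)) n (snd Y)}),
                      Act = Act (SMap M (fst X) (fst Y))\<rparr>)
      in \<lparr>SObj = {X. fst X \<in> SObj M \<and> snd X \<in> Simp (SMap M e (fst X)) 0},
          SMap = H,
          SCmp = (\<lambda>X Y Z. SCmp M (fst X) (fst Y) (fst Z)),
          SIde = (\<lambda>X. SIde M (fst X)),
          Cof = (\<lambda>X Y. Simp (H X Y) 0 \<inter> Cof M (fst X) (fst Y)),
          Fib = (\<lambda>X Y. Simp (H X Y) 0 \<inter> Fib M (fst X) (fst Y)),
          Weq = (\<lambda>X Y. Simp (H X Y) 0 \<inter> Weq M (fst X) (fst Y))\<rparr>)"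

text \<open>The functor \<open>g\<^sup>* : e'/M \<rightarrow> e/M\<close>, on objects, for \<open>g : e \<rightarrow> e'\<close>.\<close>

definition under_pull :: "('o, 's) smcat \<Rightarrow> 'o \<Rightarrow> 'o \<Rightarrow> 's \<Rightarrow> 'o \<times> 's \<Rightarrow> 'o \<times> 's" where
  "under_pull M e e' g X = (fst X, SCmp M e e' (fst X) 0 (snd X) g)"

definition cofibrant :: "('o, 's) smcat \<Rightarrow> 'o \<Rightarrow> bool" where
  "cofibrant N X \<longleftrightarrow> (\<exists>I. is_initial (ucat N) I \<and> (\<exists>f. f \<in> Cof N I X))"

definition fibrant :: "('o, 's) smcat \<Rightarrow> 'o \<Rightarrow> bool" where
  "fibrant N X \<longleftrightarrow> (\<exists>T. is_terminal (ucat N) T \<and> (\<exists>f. f \<in> Fib N X T))"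

definition cofibrant_replacement :: "('o, 's) smcat \<Rightarrow> 'o \<Rightarrow> 'o \<Rightarrow> 's \<Rightarrow> bool" where
  "cofibrant_replacement N X Q q \<longleftrightarrow> Q \<in> SObj N \<and> cofibrant N Q \<and> q \<in> Weq N Q X"

definition fibrant_replacement :: "('o, 's) smcat \<Rightarrow> 'o \<Rightarrow> 'o \<Rightarrow> 's \<Rightarrow> bool" where
  "fibrant_replacement N X R r \<longleftrightarrow> R \<in> SObj N \<and> fibrant N R \<and> r \<in> Weq N X R"

section \<open>Spheres and disks\<close>

text \<open>Indices are shifted by one, so that they are natural numbers: \<open>Sph D k\<close> is \<open>S\<^sup>k\<^sup>-\<^sup>1\<close>, \<open>Dsk D k\<close> is
  \<open>D\<^sup>k\<^sup>-\<^sup>1\<close>, \<open>bdry D k\<close> is the map \<open>S\<^sup>k\<^sup>-\<^sup>1 \<rightarrow> D\<^sup>k\<^sup>-\<^sup>1\<close>, \<open>incl D k\<close> the cofibration \<open>S\<^sup>k\<^sup>-\<^sup>1 \<rightarrow> D\<^sup>k\<close> and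
  \<open>coll D k\<close> the weak equivalence \<open>D\<^sup>k \<rightarrow> D\<^sup>k\<^sup>-\<^sup>1\<close>.\<close>

record ('o, 's) sphere_data =
  Sph :: "nat \<Rightarrow> 'o"
  Dsk :: "nat \<Rightarrow> 'o"
  bdry :: "nat \<Rightarrow> 's"
  incl :: "nat \<Rightarrow> 's"
  coll :: "nat \<Rightarrow> 's"

definition spheres_and_disks :: "('o, 's) smcat \<Rightarrow> ('o, 's) sphere_data \<Rightarrow> bool" where
  "spheres_and_disks M D \<longleftrightarrow>
     is_initial (ucat M) (Sph D 0) \<and> is_terminal (ucat M) (Dsk D 0) \<and>
     bdry D 0 \<in> Hom (ucat M) (Sph D 0) (Dsk D 0) \<and>
     (\<forall>k. Sph D k \<in> SObj M \<and> Dsk D k \<in> SObj M \<and>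
        incl D k \<in> Cof M (Sph D k) (Dsk D (Suc k)) \<and>
        coll D k \<in> Weq M (Dsk D (Suc k)) (Dsk D k) \<and>
        bdry D k = Cmp (ucat M) (Sph D k) (Dsk D (Suc k)) (Dsk D k) (coll D k) (incl D k) \<and>
        bdry D (Suc k) \<in> Hom (ucat M) (Sph D (Suc k)) (Dsk D (Suc k)) \<and>
        (\<exists>u v.
           is_pushout (ucat M) (Sph D k) (Dsk D (Suc k)) (Dsk D (Suc k)) (Sph D (Suc k))
             (incl D k) (incl D k) u v \<and>
           Cmp (ucat M) (Dsk D (Suc k)) (Sph D (Suc k)) (Dsk D (Suc k)) (bdry D (Suc k)) u
             = Ide (ucat M) (Dsk D (Suc k)) \<and>
           Cmp (ucat M) (Dsk D (Suc k)) (Sph D (Suc k)) (Dsk D (Suc k)) (bdry D (Suc k)) v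
             = Ide (ucat M) (Dsk D (Suc k))))"

text \<open>The composite \<open>D\<^sup>n \<rightarrow> D\<^sup>n\<^sup>-\<^sup>1 \<rightarrow> \<dots> \<rightarrow> D\<^sup>0\<close>.\<close>

primrec collapse :: "('o, 's) smcat \<Rightarrow> ('o, 's) sphere_data \<Rightarrow> nat \<Rightarrow> 's" where
  "collapse M D 0 = Ide (ucat M) (Dsk D 1)"
| "collapse M D (Suc n) =
     Cmp (ucat M) (Dsk D (Suc (Suc n))) (Dsk D (Suc n)) (Dsk D 1) (collapse M D n) (coll D (Suc n))"

text \<open>The map \<open>g\<^sub>n : S\<^sup>n\<^sup>-\<^sup>1 \<rightarrow> D\<^sup>0\<close>, and \<open>g\<^sub>n\<^sup>*\<close> on objects.\<close>

definition sphere_to_point :: "('o, 's) smcat \<Rightarrow> ('o, 's) sphere_data \<Rightarrow> nat \<Rightarrow> 's" where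
  "sphere_to_point M D n =
     Cmp (ucat M) (Sph D n) (Dsk D (Suc n)) (Dsk D 1) (collapse M D n) (incl D n)"

definition g_pull :: "('o, 's) smcat \<Rightarrow> ('o, 's) sphere_data \<Rightarrow> nat \<Rightarrow> 'o \<times> 's \<Rightarrow> 'o \<times> 's" where
  "g_pull M D n = under_pull M (Sph D n) (Dsk D 1) (sphere_to_point M D n)"

text \<open>For a cofibrant replacement \<open>q : Q \<rightarrow> D\<^sup>0\<close> and a fibrant replacement \<open>r : X \<rightarrow> R\<close> the base point of
  the mapping space is \<open>Q \<rightarrow> D\<^sup>0 \<rightarrow> X \<rightarrow> R\<close>.\<close>

definition map_base :: "('o, 's) smcat \<Rightarrow> 'o \<Rightarrow> 'o \<times> 's \<Rightarrow> 'o \<Rightarrow> 's \<Rightarrow> 'o \<Rightarrow> 's \<Rightarrow> 's" where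
  "map_base M e X Q q R r =
     Cmp (ucat M) Q e R (Cmp (ucat M) e (fst X) R r (snd X)) q"

end

theory Submission
  imports Defs "HOL-Library.Nat_Bijection"
begin

text \<open>Let \<open>R\<close> be a fibrant replacement of \<open>X\<close>.  Precomposition with one of the two inclusions
  \<open>D\<^sup>n \<rightarrow> S\<^sup>n \<rightarrow> D\<^sup>n\<^sup>+\<^sup>1\<close>, a trivial cofibration, shows that the maps \<open>D\<^sup>n\<^sup>+\<^sup>1 \<rightarrow> R\<close> with prescribed
  restriction to that copy of \<open>D\<^sup>n\<close> form a contractible space.  Restriction to the other copy is a Kan
  fibration onto the space of maps \<open>D\<^sup>n \<rightarrow> R\<close> under \<open>S\<^sup>n\<^sup>-\<^sup>1\<close>; its fibre is the space of maps
  \<open>D\<^sup>n\<^sup>+\<^sup>1 \<rightarrow> R\<close> under \<open>S\<^sup>n\<close>, which is therefore the loop space of the base, and the theorem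
  follows by induction on \<open>n\<close>.

  Equivalences of simplicial sets are handled as spans of pointed maps with the right lifting property
  against all \<open>\<partial>\<Delta>\<^sup>n \<subseteq> \<Delta>\<^sup>n\<close>: these are preserved by the loop space functor and by pullback, and
  they are homotopy equivalences.  The simplicial model structure only provides Kan fibrations that are
  weak equivalences; between Kan complexes these have the lifting property by Dold's argument.
  All spheres are cofibrant, since \<open>S\<^sup>-\<^sup>1\<close> is initial, so the independence of the replacements
  follows from the pushout-product axiom.\<close>

section \<open>Lifting against inclusions of subcomplexes\<close>

text \<open>The equivalences in use must survive the formation of loops. This is not visible in
  \<open>weak_equivalence\<close>, which speaks of homotopy classes, but it is for a lifting
  property, since a simplex of a loop space is a simplex of the space one dimension higher. Every
  space in the zigzag has simplices of type \<open>'s\<close>: loops do not change the type, and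
  pullbacks and fibres are cut out of an existing mapping space instead of being formed from pairs.
  So \<open>equivclp\<close> applies, and lists enter only at the end. A second obstacle is that
  universal properties in the underlying category concern only the vertices of mapping spaces.
  Tensors and cotensors with standard simplices extend them to all dimensions. These are available
  for simplicial sets with simplices in \<open>'k\<close>; an infinite \<open>'k\<close> holds a
  copy of the countable type \<open>nat list\<close>. In this way a simplex of maps out of a sphere
  is a pair of simplices of maps out of the disk, which exhibits the fibration in the inductive step
  as a pullback of restriction from a disk to its boundary sphere.\<close>

lemma Ops_iff:
  "\<theta> \<in> Ops m n \<longleftrightarrow> length \<theta> = Suc m \<and> (\<forall>i\<le>m. \<theta> ! i \<le> n) \<and> (\<forall>i j. i \<le> j \<longrightarrow> j \<le> m \<longrightarrow> \<theta> ! i \<le> \<theta> ! j)"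
proof -
  have "set \<theta> \<subseteq> {..n} \<longleftrightarrow> (\<forall>i\<le>m. \<theta> ! i \<le> n)" if "length \<theta> = Suc m"
    using that by (auto simp: set_conv_nth less_Suc_eq_le subset_iff)
  then show ?thesis
    unfolding Ops_def by (auto simp: sorted_iff_nth_mono less_Suc_eq_le)
qed

lemma Ops_length: "\<theta> \<in> Ops m n \<Longrightarrow> length \<theta> = Suc m"
  by (simp add: Ops_iff)

lemma Ops_le: "\<theta> \<in> Ops m n \<Longrightarrow> i \<le> m \<Longrightarrow> \<theta> ! i \<le> n"
  by (simp add: Ops_iff)

lemma Ops_mono: "\<theta> \<in> Ops m n \<Longrightarrow> i \<le> j \<Longrightarrow> j \<le> m \<Longrightarrow> \<theta> ! i \<le> \<theta> ! j"
  by (simp add: Ops_iff)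

lemma Ops_set: "\<theta> \<in> Ops m n \<Longrightarrow> j \<in> set \<theta> \<longleftrightarrow> (\<exists>i\<le>m. \<theta> ! i = j)"
  by (auto simp: Ops_iff in_set_conv_nth less_Suc_eq_le)

lemma length_op_comp [simp]: "length (op_comp \<theta> \<phi>) = length \<phi>"
  by (simp add: op_comp_def)

lemma nth_op_comp: "\<phi> \<in> Ops l m \<Longrightarrow> i \<le> l \<Longrightarrow> op_comp \<theta> \<phi> ! i = \<theta> ! (\<phi> ! i)"
  by (simp add: op_comp_def Ops_iff)

lemma nth_op_id: "i \<le> n \<Longrightarrow> op_id n ! i = i"
  by (simp add: op_id_def del: upt_Suc)

lemma op_id_Ops [simp, intro]: "op_id n \<in> Ops n n"
  by (simp add: Ops_iff nth_op_id) (simp add: op_id_def)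

lemma op_comp_Ops [intro]: "\<phi> \<in> Ops l m \<Longrightarrow> \<theta> \<in> Ops m n \<Longrightarrow> op_comp \<theta> \<phi> \<in> Ops l n"
  by (auto simp: Ops_iff op_comp_def)

lemma Ops_eqI: "\<theta> \<in> Ops m n \<Longrightarrow> \<phi> \<in> Ops m n' \<Longrightarrow> (\<And>i. i \<le> m \<Longrightarrow> \<theta> ! i = \<phi> ! i) \<Longrightarrow> \<theta> = \<phi>"
  by (auto simp: Ops_iff intro!: nth_equalityI)

lemma op_comp_id_left [simp]: "\<phi> \<in> Ops l m \<Longrightarrow> op_comp (op_id m) \<phi> = \<phi>"
  by (rule Ops_eqI[of _ l m _ m]) (auto simp: nth_op_comp nth_op_id Ops_le)

lemma op_comp_id_right [simp]: "\<theta> \<in> Ops m n \<Longrightarrow> op_comp \<theta> (op_id m) = \<theta>"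
  by (rule Ops_eqI[of _ m n _ n]) (auto simp: nth_op_comp[OF op_id_Ops] nth_op_id)

lemma op_comp_assoc: "\<phi> \<in> Ops l m \<Longrightarrow> \<psi> \<in> Ops k l \<Longrightarrow>
    op_comp (op_comp \<theta> \<phi>) \<psi> = op_comp \<theta> (op_comp \<phi> \<psi>)"
  by (auto simp: op_comp_def Ops_iff nth_append list_eq_iff_nth_eq less_Suc_eq_le)

lemma set_op_comp: "set (op_comp \<theta> \<phi>) \<subseteq> set \<theta>" if "\<phi> \<in> Ops l m" "\<theta> \<in> Ops m n"
  using that by (auto simp: op_comp_def Ops_iff set_conv_nth less_Suc_eq_le)

lemma replicate_Ops [simp]: "replicate (Suc n) i \<in> Ops n m \<longleftrightarrow> i \<le> m"
  by (auto simp: Ops_iff nth_replicate less_Suc_eq_le simp del: replicate_Suc)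

lemma op_comp_replicate: "\<phi> \<in> Ops l m \<Longrightarrow> op_comp (replicate (Suc m) i) \<phi> = replicate (Suc l) i"
  by (rule nth_equalityI) (auto simp: op_comp_def Ops_iff nth_replicate less_Suc_eq_le simp del: replicate_Suc)

lemma Ops_0_target: "\<theta> \<in> Ops m 0 \<Longrightarrow> \<theta> = replicate (Suc m) 0"
  by (rule Ops_eqI[of _ m 0 _ 0]) (auto simp: Ops_iff nth_replicate less_Suc_eq_le simp del: replicate_Suc)

definition mk_op :: "nat \<Rightarrow> (nat \<Rightarrow> nat) \<Rightarrow> nat list" where
  "mk_op m f = map f [0..<Suc m]"

lemma nth_mk_op [simp]: "i \<le> m \<Longrightarrow> mk_op m f ! i = f i"
  by (simp add: mk_op_def del: upt_Suc)

lemma length_mk_op [simp]: "length (mk_op m f) = Suc m"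
  by (simp add: mk_op_def)

lemma mk_op_Ops: "(\<And>i. i \<le> m \<Longrightarrow> f i \<le> n) \<Longrightarrow> (\<And>i j. i \<le> j \<Longrightarrow> j \<le> m \<Longrightarrow> f i \<le> f j) \<Longrightarrow> mk_op m f \<in> Ops m n"
  by (auto simp: Ops_iff)

section \<open>Simplicial sets and simplicial maps\<close>

lemma simplicial_set_Act: "simplicial_set X \<Longrightarrow> \<theta> \<in> Ops m n \<Longrightarrow> x \<in> Simp X n \<Longrightarrow> Act X n \<theta> x \<in> Simp X m"
  by (simp add: simplicial_set_def)

lemma simplicial_set_id: "simplicial_set X \<Longrightarrow> x \<in> Simp X n \<Longrightarrow> Act X n (op_id n) x = x"
  by (simp add: simplicial_set_def)

lemma simplicial_set_comp: "simplicial_set X \<Longrightarrow> \<phi> \<in> Ops l m \<Longrightarrow> \<theta> \<in> Ops m n \<Longrightarrow> x \<in> Simp X n \<Longrightarrow>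
    Act X m \<phi> (Act X n \<theta> x) = Act X n (op_comp \<theta> \<phi>) x"
  unfolding simplicial_set_def by metis

lemma simplicial_map_Simp: "simplicial_map X Y f \<Longrightarrow> x \<in> Simp X n \<Longrightarrow> f n x \<in> Simp Y n"
  by (simp add: simplicial_map_def)

lemma simplicial_map_Act: "simplicial_map X Y f \<Longrightarrow> \<theta> \<in> Ops m n \<Longrightarrow> x \<in> Simp X n \<Longrightarrow>
    f m (Act X n \<theta> x) = Act Y n \<theta> (f n x)"
  by (simp add: simplicial_map_def)

lemma simplicial_mapI:
  assumes "\<And>n x. x \<in> Simp X n \<Longrightarrow> f n x \<in> Simp Y n"
    and "\<And>m n \<theta> x. \<theta> \<in> Ops m n \<Longrightarrow> x \<in> Simp X n \<Longrightarrow> f m (Act X n \<theta> x) = Act Y n \<theta> (f n x)"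
  shows "simplicial_map X Y f"
  using assms by (simp add: simplicial_map_def)

lemma simplicial_map_comp: "simplicial_map X Y f \<Longrightarrow> simplicial_map Y Z g \<Longrightarrow>
    simplicial_map X Z (\<lambda>n x. g n (f n x))"
  by (simp add: simplicial_map_def)

lemma simplicial_map_ident: "simplicial_map X X (\<lambda>n x. x)"
  by (simp add: simplicial_map_def)

lemma std_simplex_simps [simp]:
  "Simp (std_simplex n) m = Ops m n" "Act (std_simplex n) m \<theta> \<alpha> = op_comp \<alpha> \<theta>"
  by (simp_all add: std_simplex_def)

lemma sset_prod_simps [simp]:
  "Simp (sset_prod X Y) n = Simp X n \<times> Simp Y n"
  "Act (sset_prod X Y) n \<theta> z = (Act X n \<theta> (fst z), Act Y n \<theta> (snd z))"
  by (simp_all add: sset_prod_def)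

lemma simplicial_set_std_simplex: "simplicial_set (std_simplex n)"
  by (auto simp: simplicial_set_def op_comp_assoc)

lemma simplicial_set_prod: "simplicial_set X \<Longrightarrow> simplicial_set Y \<Longrightarrow> simplicial_set (sset_prod X Y)"
  by (auto simp: simplicial_set_def)

lemma degen_Simp: "simplicial_set X \<Longrightarrow> x \<in> Simp X 0 \<Longrightarrow> degen X n x \<in> Simp X n"
  unfolding degen_def by (rule simplicial_set_Act) (simp_all del: replicate_Suc)

lemma degen_Act: "simplicial_set X \<Longrightarrow> x \<in> Simp X 0 \<Longrightarrow> \<theta> \<in> Ops m n \<Longrightarrow>
    Act X n \<theta> (degen X n x) = degen X m x"
  unfolding degen_def
  by (subst simplicial_set_comp[where l = m and m = n and n = 0]) (simp_all add: op_comp_replicate del: replicate_Suc)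

lemma degen_0: "simplicial_set X \<Longrightarrow> x \<in> Simp X 0 \<Longrightarrow> degen X 0 x = x"
  using simplicial_set_id[of X x 0] by (simp add: degen_def op_id_def)

lemma degen_map: "simplicial_map X Y f \<Longrightarrow> x \<in> Simp X 0 \<Longrightarrow> f n (degen X n x) = degen Y n (f 0 x)"
  unfolding degen_def by (rule simplicial_map_Act) (simp_all del: replicate_Suc)

lemma yoneda_map: "simplicial_set X \<Longrightarrow> x \<in> Simp X n \<Longrightarrow> simplicial_map (std_simplex n) X (\<lambda>m \<alpha>. Act X n \<alpha> x)"
  by (rule simplicial_mapI) (auto simp: simplicial_set_Act simplicial_set_comp)

lemma simplicial_map_yoneda:
  assumes "simplicial_map (std_simplex n) X h" "\<alpha> \<in> Ops m n"
  shows "h m \<alpha> = Act X n \<alpha> (h n (op_id n))"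
  using simplicial_map_Act[OF assms(1), of \<alpha> m n "op_id n"] assms(2) by simp

section \<open>Subcomplexes and lifting against their inclusions\<close>

definition subsset :: "'a sset \<Rightarrow> (nat \<Rightarrow> 'a set) \<Rightarrow> 'a sset" where
  "subsset B S = \<lparr>Simp = S, Act = Act B\<rparr>"

lemma subsset_simps [simp]: "Simp (subsset B S) = S" "Act (subsset B S) = Act B"
  by (simp_all add: subsset_def)

definition subcomplex :: "'a sset \<Rightarrow> (nat \<Rightarrow> 'a set) \<Rightarrow> bool" where
  "subcomplex B S \<longleftrightarrow> (\<forall>m. S m \<subseteq> Simp B m) \<and> (\<forall>m n. \<forall>\<theta>\<in>Ops m n. \<forall>x\<in>S n. Act B n \<theta> x \<in> S m)"

lemma simplicial_set_subsset: "simplicial_set B \<Longrightarrow> subcomplex B S \<Longrightarrow> simplicial_set (subsset B S)"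
  by (auto simp: simplicial_set_def subcomplex_def subset_iff)

text \<open>The right lifting property of \<open>p\<close> against the inclusion of \<open>S\<close>
  into \<open>B\<close>. Simplicial maps are total HOL functions with arbitrary values off the
  complex, so all equations are required at simplices only.\<close>

definition ext_lift :: "'a sset \<Rightarrow> (nat \<Rightarrow> 'a set) \<Rightarrow> 'b sset \<Rightarrow> 'c sset \<Rightarrow> (nat \<Rightarrow> 'b \<Rightarrow> 'c) \<Rightarrow> bool" where
  "ext_lift B S X Y p \<longleftrightarrow> (\<forall>u v.
     simplicial_map (subsset B S) X u \<longrightarrow> simplicial_map B Y v \<longrightarrow> (\<forall>m. \<forall>x\<in>S m. p m (u m x) = v m x) \<longrightarrow>
     (\<exists>h. simplicial_map B X h \<and> (\<forall>m. \<forall>x\<in>S m. h m x = u m x) \<and> (\<forall>m. \<forall>x\<in>Simp B m. p m (h m x) = v m x)))"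

lemma ext_liftI:
  assumes "\<And>u v. simplicial_map (subsset B S) X u \<Longrightarrow> simplicial_map B Y v \<Longrightarrow>
      (\<And>m x. x \<in> S m \<Longrightarrow> p m (u m x) = v m x) \<Longrightarrow>
      \<exists>h. simplicial_map B X h \<and> (\<forall>m. \<forall>x\<in>S m. h m x = u m x) \<and> (\<forall>m. \<forall>x\<in>Simp B m. p m (h m x) = v m x)"
  shows "ext_lift B S X Y p"
  using assms by (simp add: ext_lift_def)

lemma ext_liftE:
  assumes "ext_lift B S X Y p" "simplicial_map (subsset B S) X u" "simplicial_map B Y v"
    "\<And>m x. x \<in> S m \<Longrightarrow> p m (u m x) = v m x"
  obtains h where "simplicial_map B X h" "\<And>m x. x \<in> S m \<Longrightarrow> h m x = u m x"
    "\<And>m x. x \<in> Simp B m \<Longrightarrow> p m (h m x) = v m x"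
proof -
  have "\<exists>h. simplicial_map B X h \<and> (\<forall>m. \<forall>x\<in>S m. h m x = u m x) \<and> (\<forall>m. \<forall>x\<in>Simp B m. p m (h m x) = v m x)"
    using assms unfolding ext_lift_def by blast
  then show ?thesis using that by blast
qed

lemma simplicial_map_subsset_mono:
  "simplicial_map (subsset B S') X u \<Longrightarrow> (\<And>m. S m \<subseteq> S' m) \<Longrightarrow> simplicial_map (subsset B S) X u"
  by (auto simp: simplicial_map_def subset_iff)

lemma simplicial_map_restrict: "simplicial_map B X u \<Longrightarrow> (\<And>m. S m \<subseteq> Simp B m) \<Longrightarrow> simplicial_map (subsset B S) X u"
  by (auto simp: simplicial_map_def subset_iff)

text \<open>Lifting is stable under cobase change. Since \<open>U\<close> is the full preimage of
  \<open>C\<close> and \<open>\<chi>\<close> is injective where it leaves \<open>C\<close>, the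
  complex \<open>C'\<close> is the pushout of \<open>C\<close> and \<open>T\<close> along
  \<open>U\<close>.\<close>

lemma ext_lift_attach:
  assumes lift: "ext_lift T U X Y p"
    and T: "simplicial_set T" and C: "subcomplex B C"
    and \<chi>: "simplicial_map T B \<chi>"
    and U: "\<And>m t. t \<in> U m \<longleftrightarrow> t \<in> Simp T m \<and> \<chi> m t \<in> C m"
    and inj: "\<And>m t t'. t \<in> Simp T m \<Longrightarrow> t' \<in> Simp T m \<Longrightarrow> \<chi> m t = \<chi> m t' \<Longrightarrow> \<chi> m t \<notin> C m \<Longrightarrow> t = t'"
    and C': "\<And>m. C' m = C m \<union> \<chi> m ` Simp T m"
  shows "ext_lift (subsset B C') C X Y p"
proof (rule ext_liftI)
  fix u v
  assume u: "simplicial_map (subsset (subsset B C') C) X u" and v: "simplicial_map (subsset B C') Y v"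
    and uv: "\<And>m x. x \<in> C m \<Longrightarrow> p m (u m x) = v m x"
  have \<chi>C': "\<chi> m t \<in> C' m" if "t \<in> Simp T m" for m t
    using that by (simp add: C')
  have "simplicial_map (subsset T U) X (\<lambda>m t. u m (\<chi> m t))"
    using u \<chi> by (auto simp: simplicial_map_def U)
  moreover have "simplicial_map T Y (\<lambda>m t. v m (\<chi> m t))"
  proof (rule simplicial_mapI)
    fix m n \<theta> t assume "\<theta> \<in> Ops m n" "t \<in> Simp T n"
    then show "v m (\<chi> m (Act T n \<theta> t)) = Act Y n \<theta> (v n (\<chi> n t))"
      using simplicial_map_Act[OF v, of \<theta> m n "\<chi> n t"] \<chi>C' simplicial_map_Act[OF \<chi>] by simp
  qed (use simplicial_map_Simp[OF v] \<chi>C' in simp)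
  ultimately obtain k where k: "simplicial_map T X k" "\<And>m t. t \<in> U m \<Longrightarrow> k m t = u m (\<chi> m t)"
    "\<And>m t. t \<in> Simp T m \<Longrightarrow> p m (k m t) = v m (\<chi> m t)"
    by (rule ext_liftE[OF lift]) (auto simp: U uv)
  \<comment> \<open>Outside \<open>C\<close> the simplex chosen by \<open>SOME\<close> is the only
    preimage under \<open>\<chi>\<close>. Inside \<open>C\<close> there may be several, but there
    \<open>k\<close> already equals \<open>u\<close> composed with \<open>\<chi>\<close>.\<close>
  define h where "h m x = (if x \<in> C m then u m x else k m (SOME t. t \<in> Simp T m \<and> \<chi> m t = x))" for m x
  have hC: "h m x = u m x" if "x \<in> C m" for m x
    using that by (simp add: h_def)
  have h\<chi>: "h m (\<chi> m t) = k m t" if t: "t \<in> Simp T m" for m t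
  proof (cases "\<chi> m t \<in> C m")
    case True
    then show ?thesis using t k(2) U hC by simp
  next
    case False
    have "(SOME t'. t' \<in> Simp T m \<and> \<chi> m t' = \<chi> m t) = t"
      using t inj[OF _ t] False by (intro some_equality) auto
    then show ?thesis using False by (simp add: h_def)
  qed
  have "simplicial_map (subsset B C') X h"
  proof (rule simplicial_mapI)
    fix n x assume x: "x \<in> Simp (subsset B C') n"
    then show "h n x \<in> Simp X n"
      using hC h\<chi> simplicial_map_Simp[OF u, of x n] simplicial_map_Simp[OF k(1)] by (auto simp: C')
    fix m \<theta> assume \<theta>: "\<theta> \<in> Ops m n"
    consider "x \<in> C n" | t where "t \<in> Simp T n" "x = \<chi> n t"
      using x by (auto simp: C')
    then show "h m (Act (subsset B C') n \<theta> x) = Act X n \<theta> (h n x)"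
    proof cases
      case 1
      moreover have "Act B n \<theta> x \<in> C m" using C \<theta> 1 by (simp add: subcomplex_def)
      ultimately show ?thesis using hC simplicial_map_Act[OF u \<theta>, of x] by simp
    next
      case 2
      have "Act B n \<theta> x = \<chi> m (Act T n \<theta> t)" using simplicial_map_Act[OF \<chi> \<theta>] 2 by simp
      then show ?thesis using 2 h\<chi> simplicial_set_Act[OF T \<theta>] simplicial_map_Act[OF k(1) \<theta>] by simp
    qed
  qed
  moreover have "p m (h m x) = v m x" if "x \<in> C' m" for m x
    using that hC h\<chi> uv k(3) by (auto simp: C')
  ultimately show "\<exists>h. simplicial_map (subsset B C') X h \<and> (\<forall>m. \<forall>x\<in>C m. h m x = u m x) \<and>
      (\<forall>m. \<forall>x\<in>Simp (subsset B C') m. p m (h m x) = v m x)"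
    using hC by auto
qed

lemma subsset_subsset [simp]: "subsset (subsset B S) S' = subsset B S'"
  by (simp add: subsset_def)

lemma subsset_all [simp]: "subsset B (Simp B) = B"
  by (simp add: subsset_def)

lemma ext_lift_refl: "ext_lift (subsset B C) C X Y p"
  by (rule ext_liftI) (auto simp: simplicial_map_def)

lemma ext_lift_trans:
  assumes "ext_lift (subsset B C1) C0 X Y p" "ext_lift (subsset B C2) C1 X Y p"
    and "\<And>m. C0 m \<subseteq> C1 m" "\<And>m. C1 m \<subseteq> C2 m"
  shows "ext_lift (subsset B C2) C0 X Y p"
proof (rule ext_liftI)
  fix u v
  assume u: "simplicial_map (subsset (subsset B C2) C0) X u" and v: "simplicial_map (subsset B C2) Y v"
    and uv: "\<And>m x. x \<in> C0 m \<Longrightarrow> p m (u m x) = v m x"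
  have v': "simplicial_map (subsset B C1) Y v" using v assms(4) by (rule simplicial_map_subsset_mono)
  obtain h where h: "simplicial_map (subsset B C1) X h" "\<And>m x. x \<in> C0 m \<Longrightarrow> h m x = u m x"
    "\<And>m x. x \<in> C1 m \<Longrightarrow> p m (h m x) = v m x"
    using ext_liftE[OF assms(1) _ v', of u] u uv by simp metis
  obtain k where k: "simplicial_map (subsset B C2) X k" "\<And>m x. x \<in> C1 m \<Longrightarrow> k m x = h m x"
    "\<And>m x. x \<in> C2 m \<Longrightarrow> p m (k m x) = v m x"
    using ext_liftE[OF assms(2) _ v, of h] h by simp metis
  show "\<exists>h. simplicial_map (subsset B C2) X h \<and> (\<forall>m. \<forall>x\<in>C0 m. h m x = u m x) \<and>
      (\<forall>m. \<forall>x\<in>Simp (subsset B C2) m. p m (h m x) = v m x)"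
    using h k assms(3) by (intro exI[of _ k]) (auto simp: subset_iff)
qed

text \<open>Countable composition: a lift is extended stage by stage by dependent choice. By
  \<open>all\<close> every m-simplex is present at stage \<open>Suc m\<close>, so the union is
  reached after finitely many stages in each degree, and the value there can be read off at that
  stage.\<close>

lemma ext_lift_Union:
  assumes step: "\<And>n. ext_lift (subsset B (C (Suc n))) (C n) X Y p"
    and mono: "\<And>n m. C n m \<subseteq> C (Suc n) m"
    and all: "\<And>m. Simp B m = C (Suc m) m"
    and sub: "\<And>n. subcomplex B (C n)"
  shows "ext_lift B (C 0) X Y p"
proof (rule ext_liftI)
  fix u v
  assume u: "simplicial_map (subsset B (C 0)) X u" and v: "simplicial_map B Y v"
    and uv: "\<And>m x. x \<in> C 0 m \<Longrightarrow> p m (u m x) = v m x"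
  have mono': "C n m \<subseteq> C n' m" if "n \<le> n'" for n n' m
    using that by (induction rule: dec_induct) (use mono in auto)
  define good where "good n h \<longleftrightarrow> simplicial_map (subsset B (C n)) X h \<and> (\<forall>m. \<forall>x\<in>C n m. p m (h m x) = v m x)" for n h
  have "\<exists>f. \<forall>n. good n (f n) \<and> (n = 0 \<longrightarrow> f n = u) \<and> (\<forall>m. \<forall>x\<in>C n m. f (Suc n) m x = f n m x)"
  proof -
    have "\<exists>f. \<forall>n. (good n (f n) \<and> (n = 0 \<longrightarrow> f n = u)) \<and> (\<forall>m. \<forall>x\<in>C n m. f (Suc n) m x = f n m x)"
    proof (rule dependent_nat_choice)
      show "\<exists>x. good 0 x \<and> (0 = 0 \<longrightarrow> x = u)" using u uv by (auto simp: good_def)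
    next
      fix h n assume h: "good n h \<and> (n = 0 \<longrightarrow> h = u)"
      have v': "simplicial_map (subsset B (C (Suc n))) Y v"
        using v sub by (intro simplicial_map_restrict) (auto simp: subcomplex_def)
      obtain k where "simplicial_map (subsset B (C (Suc n))) X k" "\<And>m x. x \<in> C n m \<Longrightarrow> k m x = h m x"
        "\<And>m x. x \<in> C (Suc n) m \<Longrightarrow> p m (k m x) = v m x"
        using ext_liftE[OF step _ v', of h] h by (simp add: good_def) metis
      then show "\<exists>y. (good (Suc n) y \<and> (Suc n = 0 \<longrightarrow> y = u)) \<and> (\<forall>m. \<forall>x\<in>C n m. y m x = h m x)"
        by (auto simp: good_def)
    qed
    then show ?thesis by blast
  qed
  then obtain f where f: "\<And>n. good n (f n)" "f 0 = u" "\<And>n m x. x \<in> C n m \<Longrightarrow> f (Suc n) m x = f n m x"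
    by blast
  have stab: "f n' m x = f n m x" if "n \<le> n'" "x \<in> C n m" for n n' m x
    using that by (induction rule: dec_induct) (use f(3) mono' in \<open>auto simp: subset_iff\<close>)
  define h where "h m x = f (Suc m) m x" for m x
  have eq: "h m x = f n m x" if "x \<in> C n m" "x \<in> Simp B m" for n m x
    using stab[of "Suc m" n x m] stab[of n "Suc m" x m] that all by (cases "n \<le> Suc m") (auto simp: h_def)
  have "simplicial_map B X h"
  proof (rule simplicial_mapI)
    fix n x assume x: "x \<in> Simp B n"
    then show "h n x \<in> Simp X n"
      using simplicial_map_Simp[of "subsset B (C (Suc n))" X "f (Suc n)" x n] f(1)[of "Suc n"] all
      by (simp add: h_def good_def)
    fix m \<theta> assume \<theta>: "\<theta> \<in> Ops m n"
    have x': "x \<in> C (Suc n) n" using x all by simp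
    then have y: "Act B n \<theta> x \<in> C (Suc n) m" using sub[of "Suc n"] \<theta> by (simp add: subcomplex_def)
    then have "Act B n \<theta> x \<in> Simp B m" using sub[of "Suc n"] by (auto simp: subcomplex_def)
    then show "h m (Act B n \<theta> x) = Act X n \<theta> (h n x)"
      using eq[OF y] eq[OF x' x] simplicial_map_Act[of "subsset B (C (Suc n))" X "f (Suc n)" \<theta> m n x] f(1)[of "Suc n"] \<theta> x'
      by (simp add: good_def)
  qed
  moreover have "h m x = u m x" if "x \<in> C 0 m" for m x
    using eq[of x 0 m] that f(2) sub[of 0] by (auto simp: subcomplex_def)
  moreover have "p m (h m x) = v m x" if "x \<in> Simp B m" for m x
    using f(1)[of "Suc m"] that all by (simp add: good_def h_def)
  ultimately show "\<exists>h. simplicial_map B X h \<and> (\<forall>m. \<forall>x\<in>C 0 m. h m x = u m x) \<and>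
      (\<forall>m. \<forall>x\<in>Simp B m. p m (h m x) = v m x)"
    by blast
qed

section \<open>Surjective operators, skeleta and cells\<close>

definition bdry_ops :: "nat \<Rightarrow> nat \<Rightarrow> nat list set" where
  "bdry_ops n m = {\<alpha> \<in> Ops m n. \<exists>j\<le>n. j \<notin> set \<alpha>}"

text \<open>The missed vertex \<open>j\<close> gives the factorization: \<open>\<delta>\<close> is
  the coface that skips \<open>j\<close>, and \<open>\<alpha>'\<close> lowers the values above
  \<open>j\<close> by one.\<close>

lemma bdry_ops_factor:
  assumes "\<alpha> \<in> bdry_ops n m"
  obtains l \<delta> \<alpha>' where "n = Suc l" "\<delta> \<in> Ops l n" "\<alpha>' \<in> Ops m l" "\<alpha> = op_comp \<delta> \<alpha>'"
proof -
  obtain j where \<alpha>: "\<alpha> \<in> Ops m n" and j: "j \<le> n" "j \<notin> set \<alpha>"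
    using assms by (auto simp: bdry_ops_def)
  have j': "\<alpha> ! i \<noteq> j" if "i \<le> m" for i
    using Ops_set[OF \<alpha>] j that by blast
  have "n \<noteq> 0" using j'[of 0] j Ops_le[OF \<alpha>, of 0] by auto
  then obtain l where l: "n = Suc l" by (cases n) auto
  define \<delta> where "\<delta> = mk_op l (\<lambda>i. if i < j then i else Suc i)"
  define \<alpha>' where "\<alpha>' = mk_op m (\<lambda>i. if \<alpha> ! i < j then \<alpha> ! i else \<alpha> ! i - 1)"
  have \<delta>: "\<delta> \<in> Ops l n" unfolding \<delta>_def l by (rule mk_op_Ops) auto
  have \<alpha>': "\<alpha>' \<in> Ops m l" unfolding \<alpha>'_def
  proof (rule mk_op_Ops)
    fix i assume "i \<le> m"
    then show "(if \<alpha> ! i < j then \<alpha> ! i else \<alpha> ! i - 1) \<le> l"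
      using Ops_le[OF \<alpha>, of i] j l by auto
  next
    fix i i' assume "i \<le> i'" "i' \<le> m"
    then show "(if \<alpha> ! i < j then \<alpha> ! i else \<alpha> ! i - 1) \<le> (if \<alpha> ! i' < j then \<alpha> ! i' else \<alpha> ! i' - 1)"
      using Ops_mono[OF \<alpha>, of i i'] by auto
  qed
  have "\<alpha> = op_comp \<delta> \<alpha>'"
  proof (rule Ops_eqI[OF \<alpha> op_comp_Ops[OF \<alpha>' \<delta>]])
    fix i assume i: "i \<le> m"
    then have "\<alpha>' ! i \<le> l" using \<alpha>' Ops_le by blast
    then show "\<alpha> ! i = op_comp \<delta> \<alpha>' ! i"
      using i j'[OF i] by (subst nth_op_comp[OF \<alpha>' i]) (auto simp: \<delta>_def \<alpha>'_def)
  qed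
  then show ?thesis using that l \<delta> \<alpha>' by blast
qed

lemma bdry_ops_comp: "\<alpha> \<in> bdry_ops n m \<Longrightarrow> \<theta> \<in> Ops l m \<Longrightarrow> op_comp \<alpha> \<theta> \<in> bdry_ops n l"
  using set_op_comp by (fastforce simp: bdry_ops_def)

text \<open>Every choice of preimages under a monotone surjection is monotone, so one preimage may
  be prescribed. \<open>nondegenerate_unique\<close> uses this freedom to compare two operators
  vertex by vertex.\<close>

lemma surjective_section:
  assumes \<theta>: "\<theta> \<in> Ops m n" "\<theta> \<notin> bdry_ops n m" and i: "i \<le> m"
  obtains \<sigma> where "\<sigma> \<in> Ops n m" "op_comp \<theta> \<sigma> = op_id n" "\<sigma> ! (\<theta> ! i) = i"
proof -
  have ex: "\<exists>k\<le>m. \<theta> ! k = j" if "j \<le> n" for j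
    using that \<theta> Ops_set[OF \<theta>(1)] by (auto simp: bdry_ops_def)
  define s where "s j = (if j = \<theta> ! i then i else (SOME k. k \<le> m \<and> \<theta> ! k = j))" for j
  have s: "s j \<le> m \<and> \<theta> ! s j = j" if "j \<le> n" for j
    using someI_ex[OF ex[OF that]] i by (auto simp: s_def)
  have \<sigma>: "mk_op n s \<in> Ops n m"
  proof (rule mk_op_Ops)
    fix j j' assume j: "j \<le> j'" "j' \<le> n"
    show "s j \<le> s j'"
    proof (cases "j = j'")
      case False
      then show ?thesis
        using s[of j] s[of j'] j Ops_mono[OF \<theta>(1), of "s j'" "s j"] by (metis le_antisym le_trans linorder_le_cases)
    qed simp
  qed (use s in auto)
  moreover have "op_comp \<theta> (mk_op n s) = op_id n"
    by (rule Ops_eqI[OF op_comp_Ops[OF \<sigma> \<theta>(1)] op_id_Ops]) (use s in \<open>simp add: nth_op_comp[OF \<sigma>] nth_op_id\<close>)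
  moreover have "mk_op n s ! (\<theta> ! i) = i"
    using Ops_le[OF \<theta>(1) i] by (simp add: s_def)
  ultimately show ?thesis using that by blast
qed

text \<open>A monotone map that skips no value starts at 0 and rises by at most one per step, so it
  stays at or below the identity; the reverse bound is the same argument downwards from
  \<open>n\<close>.\<close>

lemma surjective_endo:
  assumes \<alpha>: "\<alpha> \<in> Ops n n" "\<alpha> \<notin> bdry_ops n n"
  shows "\<alpha> = op_id n"
proof -
  have ex: "\<exists>k\<le>n. \<alpha> ! k = j" if "j \<le> n" for j
    using that \<alpha> Ops_set[OF \<alpha>(1)] by (auto simp: bdry_ops_def)
  note mono = Ops_mono[OF \<alpha>(1)]
  have upper: "\<alpha> ! j \<le> j" if "j \<le> n" for j
    using that
  proof (induction j)
    case 0
    then show ?case using ex[of 0] mono[of 0] by (metis le0 le_0_eq)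
  next
    case (Suc j)
    obtain k where k: "k \<le> n" "\<alpha> ! k = Suc j" using ex Suc by blast
    show ?case
      using mono[of k j] mono[of "Suc j" k] Suc k by (cases "k \<le> j") auto
  qed
  have lower: "j \<le> \<alpha> ! j" if "j \<le> n" for j
    using that
  proof (induction rule: inc_induct)
    case base
    then show ?case using ex[of n] mono[of _ n] by auto
  next
    case (step j)
    obtain k where k: "k \<le> n" "\<alpha> ! k = j" using ex[of j] step by auto
    show ?case
      using mono[of k j] mono[of "Suc j" k] step k by (cases "k \<le> j") auto
  qed
  show ?thesis
    by (rule Ops_eqI[OF \<alpha>(1) op_id_Ops]) (use upper lower in \<open>simp add: nth_op_id le_antisym\<close>)
qed

text \<open>Precomposition with the retraction \<open>r\<close> moves the lifting problem to
  \<open>B\<close>, and the solution is restricted along \<open>i\<close>.\<close>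

lemma ext_lift_retract:
  assumes lift: "ext_lift B S X Y p"
    and i: "simplicial_map B' B i" and r: "simplicial_map B B' r"
    and ri: "\<And>m x. x \<in> Simp B' m \<Longrightarrow> r m (i m x) = x"
    and iS: "\<And>m x. x \<in> S' m \<Longrightarrow> i m x \<in> S m" and rS: "\<And>m x. x \<in> S m \<Longrightarrow> r m x \<in> S' m"
    and S: "\<And>m. S m \<subseteq> Simp B m" and S': "\<And>m. S' m \<subseteq> Simp B' m"
  shows "ext_lift B' S' X Y p"
proof (rule ext_liftI)
  fix u v
  assume u: "simplicial_map (subsset B' S') X u" and v: "simplicial_map B' Y v"
    and uv: "\<And>m x. x \<in> S' m \<Longrightarrow> p m (u m x) = v m x"
  have "simplicial_map (subsset B S) X (\<lambda>m x. u m (r m x))"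
    using u r rS S unfolding simplicial_map_def subsset_simps by (metis subsetD)
  moreover have "simplicial_map B Y (\<lambda>m x. v m (r m x))"
    using r v by (rule simplicial_map_comp)
  ultimately obtain h where h: "simplicial_map B X h" "\<And>m x. x \<in> S m \<Longrightarrow> h m x = u m (r m x)"
    "\<And>m x. x \<in> Simp B m \<Longrightarrow> p m (h m x) = v m (r m x)"
    by (rule ext_liftE[OF lift]) (use rS uv in auto)
  show "\<exists>h. simplicial_map B' X h \<and> (\<forall>m. \<forall>x\<in>S' m. h m x = u m x) \<and> (\<forall>m. \<forall>x\<in>Simp B' m. p m (h m x) = v m x)"
    using simplicial_map_comp[OF i h(1)] h(2,3) iS ri S' simplicial_map_Simp[OF i]
    by (intro exI[of _ "\<lambda>m x. h m (i m x)"]) (auto simp: subset_iff)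
qed

text \<open>A disjoint union of copies of \<open>K\<close>, so that all cells of one dimension can
  be attached at once. The first coordinate names the copy and is left alone by the
  operators.\<close>

lemma ext_lift_copies:
  assumes lift: "ext_lift K L X Y p"
    and S: "\<And>m. L m \<subseteq> Simp K m"
  shows "ext_lift \<lparr>Simp = (\<lambda>m. N \<times> Simp K m), Act = (\<lambda>n \<theta> z. (fst z, Act K n \<theta> (snd z)))\<rparr> (\<lambda>m. N \<times> L m) X Y p"
    (is "ext_lift ?B _ _ _ _")
proof (rule ext_liftI)
  fix u v
  assume u: "simplicial_map (subsset ?B (\<lambda>m. N \<times> L m)) X u" and v: "simplicial_map ?B Y v"
    and uv: "\<And>m x. x \<in> N \<times> L m \<Longrightarrow> p m (u m x) = v m x"
  have "\<exists>h. simplicial_map K X h \<and> (\<forall>m. \<forall>x\<in>L m. h m x = u m (a, x)) \<and> (\<forall>m. \<forall>x\<in>Simp K m. p m (h m x) = v m (a, x))"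
    if a: "a \<in> N" for a
  proof -
    have "simplicial_map (subsset K L) X (\<lambda>m x. u m (a, x))"
      using u a unfolding simplicial_map_def by (auto simp: Ball_def)
    moreover have "simplicial_map K Y (\<lambda>m x. v m (a, x))"
      using v a unfolding simplicial_map_def by (auto simp: Ball_def)
    ultimately show ?thesis
      by (rule ext_liftE[OF lift]) (use uv a in auto)
  qed
  then obtain h where h: "\<And>a. a \<in> N \<Longrightarrow> simplicial_map K X (h a)" "\<And>a m x. a \<in> N \<Longrightarrow> x \<in> L m \<Longrightarrow> h a m x = u m (a, x)"
    "\<And>a m x. a \<in> N \<Longrightarrow> x \<in> Simp K m \<Longrightarrow> p m (h a m x) = v m (a, x)"
    by metis
  show "\<exists>h. simplicial_map ?B X h \<and> (\<forall>m. \<forall>x\<in>N \<times> L m. h m x = u m x) \<and> (\<forall>m. \<forall>x\<in>Simp ?B m. p m (h m x) = v m x)"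
    using h by (intro exI[of _ "\<lambda>m z. h (fst z) m (snd z)"]) (auto simp: simplicial_map_def)
qed

text \<open>Simplices induced from dimensions strictly below \<open>n\<close>, so this is the
  (n-1)-skeleton, and it is empty for \<open>n = 0\<close>. An n-simplex is nondegenerate iff it
  lies outside \<open>skeleton B n n\<close>.\<close>

definition skeleton :: "'a sset \<Rightarrow> nat \<Rightarrow> nat \<Rightarrow> 'a set" where
  "skeleton B n m = {Act B k \<theta> y | k \<theta> y. k < n \<and> \<theta> \<in> Ops m k \<and> y \<in> Simp B k}"

lemma skeleton_Act:
  assumes "simplicial_set B" "x \<in> skeleton B n m" "\<theta> \<in> Ops l m"
  shows "Act B m \<theta> x \<in> skeleton B n l"
proof -
  obtain k \<phi> y where "k < n" "\<phi> \<in> Ops m k" "y \<in> Simp B k" "x = Act B k \<phi> y"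
    using assms(2) by (auto simp: skeleton_def)
  then show ?thesis
    using simplicial_set_comp[OF assms(1,3)] assms(3) unfolding skeleton_def by blast
qed

text \<open>The uniqueness part of the Eilenberg--Zilber lemma.\<close>

lemma nondegenerate_unique:
  assumes B: "simplicial_set B"
    and x: "x \<in> Simp B n" "x \<notin> skeleton B n n" and x': "x' \<in> Simp B n" "x' \<notin> skeleton B n n"
    and \<alpha>: "\<alpha> \<in> Ops m n" "\<alpha> \<notin> bdry_ops n m" and \<alpha>': "\<alpha>' \<in> Ops m n"
    and eq: "Act B n \<alpha> x = Act B n \<alpha>' x'"
  shows "x = x' \<and> \<alpha> = \<alpha>'"
proof -
  have *: "x = x' \<and> \<alpha>' ! i = \<alpha> ! i" if i: "i \<le> m" for i
  proof -
    \<comment> \<open>The section is made to pass through the given \<open>i\<close>, so that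
      \<open>op_comp \<alpha>' \<sigma>\<close>, evaluated at \<open>\<alpha> ! i\<close>, yields
      \<open>\<alpha>' ! i\<close>. This composite turns out to be the identity.\<close>
    obtain \<sigma> where \<sigma>: "\<sigma> \<in> Ops n m" "op_comp \<alpha> \<sigma> = op_id n" "\<sigma> ! (\<alpha> ! i) = i"
      using surjective_section[OF \<alpha> i] .
    have "x = Act B m \<sigma> (Act B n \<alpha> x)"
      using simplicial_set_comp[OF B \<sigma>(1) \<alpha>(1) x(1)] \<sigma>(2) simplicial_set_id[OF B x(1)] by simp
    then have xe: "x = Act B n (op_comp \<alpha>' \<sigma>) x'"
      using simplicial_set_comp[OF B \<sigma>(1) \<alpha>' x'(1)] eq by simp
    have ops: "op_comp \<alpha>' \<sigma> \<in> Ops n n" using \<sigma>(1) \<alpha>' by blast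
    have "op_comp \<alpha>' \<sigma> \<notin> bdry_ops n n"
    proof
      assume "op_comp \<alpha>' \<sigma> \<in> bdry_ops n n"
      then obtain l \<delta> \<beta> where "n = Suc l" "\<delta> \<in> Ops l n" "\<beta> \<in> Ops n l" "op_comp \<alpha>' \<sigma> = op_comp \<delta> \<beta>"
        by (rule bdry_ops_factor)
      then have "x = Act B l \<beta> (Act B n \<delta> x')" "Act B n \<delta> x' \<in> Simp B l"
        using xe simplicial_set_comp[OF B _ _ x'(1)] simplicial_set_Act[OF B _ x'(1)] by auto
      then have "x \<in> skeleton B n n"
        using \<open>n = Suc l\<close> \<open>\<beta> \<in> Ops n l\<close> unfolding skeleton_def by blast
      then show False using x by simp
    qed
    then have id: "op_comp \<alpha>' \<sigma> = op_id n" using surjective_endo ops by blast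
    have "\<alpha> ! i \<le> n" using Ops_le[OF \<alpha>(1) i] .
    then have "\<alpha>' ! i = \<alpha> ! i"
      using nth_op_comp[OF \<sigma>(1), of "\<alpha> ! i" \<alpha>'] \<sigma>(3) id nth_op_id by simp
    then show ?thesis using xe id simplicial_set_id[OF B x'(1)] by simp
  qed
  then show ?thesis using Ops_eqI[OF \<alpha>(1) \<alpha>'] by (metis le0)
qed

text \<open>The inclusion is built by attaching, for each nondegenerate n-simplex of
  \<open>B\<close> outside \<open>A\<close>, a cell of the form simplex times \<open>J\<close> along
  the part over the boundary or over \<open>J0\<close>. The factor \<open>J\<close> is a point for
  trivial fibrations and an interval for homotopy extension.\<close>

lemma ext_lift_skeletal:
  assumes B: "simplicial_set B" and J: "simplicial_set J"
    and A: "subcomplex B A" and J0: "subcomplex J J0"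
    and cell: "\<And>n. ext_lift (sset_prod (std_simplex n) J)
      (\<lambda>m. {z \<in> Ops m n \<times> Simp J m. fst z \<in> bdry_ops n m \<or> snd z \<in> J0 m}) X Y p"
  shows "ext_lift (sset_prod B J) (\<lambda>m. {z \<in> Simp B m \<times> Simp J m. fst z \<in> A m \<or> snd z \<in> J0 m}) X Y p"
proof -
  define C where "C n m = {z \<in> Simp B m \<times> Simp J m. fst z \<in> A m \<or> snd z \<in> J0 m \<or> fst z \<in> skeleton B n m}" for n m
  have A': "A m \<subseteq> Simp B m" "\<And>\<theta> x n. \<theta> \<in> Ops m n \<Longrightarrow> x \<in> A n \<Longrightarrow> Act B n \<theta> x \<in> A m" for m
    using A by (auto simp: subcomplex_def)
  have J0': "\<And>\<theta> x n. \<theta> \<in> Ops m n \<Longrightarrow> x \<in> J0 n \<Longrightarrow> Act J n \<theta> x \<in> J0 m" for m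
    using J0 by (auto simp: subcomplex_def)
  have sub: "subcomplex (sset_prod B J) (C n)" for n
    unfolding subcomplex_def C_def
    by (auto simp: simplicial_set_Act[OF B] simplicial_set_Act[OF J] A'(2) J0' skeleton_Act[OF B])
  have "ext_lift (sset_prod B J) (C 0) X Y p"
  proof (rule ext_lift_Union)
    show "subcomplex (sset_prod B J) (C n)" for n by (rule sub)
    show "C n m \<subseteq> C (Suc n) m" for n m
      by (auto simp: C_def skeleton_def intro: less_SucI)
    show "Simp (sset_prod B J) m = C (Suc m) m" for m
    proof -
      have "x \<in> skeleton B (Suc m) m" if "x \<in> Simp B m" for x
        using simplicial_set_id[OF B that] that op_id_Ops[of m] unfolding skeleton_def
        by (metis (mono_tags, lifting) lessI mem_Collect_eq)
      then show ?thesis by (auto simp: C_def)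
    qed
    fix n
    define N where "N = {x \<in> Simp B n. x \<notin> A n \<and> x \<notin> skeleton B n n}"
    define K where "K = sset_prod (std_simplex n) J"
    define L where "L m = {z \<in> Ops m n \<times> Simp J m. fst z \<in> bdry_ops n m \<or> snd z \<in> J0 m}" for m
    define T where "T = \<lparr>Simp = (\<lambda>m. N \<times> Simp K m), Act = (\<lambda>n \<theta> z. (fst z, Act K n \<theta> (snd z)))\<rparr>"
    define \<chi> where "\<chi> m z = (Act B n (fst (snd z)) (fst z), snd (snd z))" for m :: nat and z :: "'a \<times> nat list \<times> 'b"
    have T_simps [simp]: "Simp T m = N \<times> Ops m n \<times> Simp J m"
      "Act T k \<theta> z = (fst z, op_comp (fst (snd z)) \<theta>, Act J k \<theta> (snd (snd z)))" for m k \<theta> z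
      by (simp_all add: T_def K_def)
    have K: "simplicial_set K" unfolding K_def by (intro simplicial_set_prod simplicial_set_std_simplex J)
    \<comment> \<open>A non-surjective operator factors through a lower dimension and so lands in
      the skeleton. A surjective one has a section, which would bring \<open>x\<close> itself back
      into \<open>A\<close> or the skeleton.\<close>
    have key: "Act B n \<alpha> x \<in> A m \<or> Act B n \<alpha> x \<in> skeleton B n m \<longleftrightarrow> \<alpha> \<in> bdry_ops n m"
      if x: "x \<in> N" and \<alpha>: "\<alpha> \<in> Ops m n" for x \<alpha> m
    proof
      assume "\<alpha> \<in> bdry_ops n m"
      then obtain l \<delta> \<beta> where *: "n = Suc l" "\<delta> \<in> Ops l n" "\<beta> \<in> Ops m l" "\<alpha> = op_comp \<delta> \<beta>"
        by (rule bdry_ops_factor)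
      have xB: "x \<in> Simp B n" using x by (simp add: N_def)
      have "Act B n \<alpha> x = Act B l \<beta> (Act B n \<delta> x)" "Act B n \<delta> x \<in> Simp B l"
        using * simplicial_set_comp[OF B _ _ xB] simplicial_set_Act[OF B _ xB] by auto
      then show "Act B n \<alpha> x \<in> A m \<or> Act B n \<alpha> x \<in> skeleton B n m"
        using *(1,3) unfolding skeleton_def by blast
    next
      assume *: "Act B n \<alpha> x \<in> A m \<or> Act B n \<alpha> x \<in> skeleton B n m"
      have xB: "x \<in> Simp B n" using x by (simp add: N_def)
      show "\<alpha> \<in> bdry_ops n m"
      proof (rule ccontr)
        assume "\<alpha> \<notin> bdry_ops n m"
        then obtain \<sigma> where \<sigma>: "\<sigma> \<in> Ops n m" "op_comp \<alpha> \<sigma> = op_id n"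
          using surjective_section[OF \<alpha> _ le0] by blast
        then have "x = Act B m \<sigma> (Act B n \<alpha> x)"
          using simplicial_set_comp[OF B \<sigma>(1) \<alpha> xB] simplicial_set_id[OF B xB] by simp
        then have "x \<in> A n \<or> x \<in> skeleton B n n"
          using * A'(2)[OF \<sigma>(1)] skeleton_Act[OF B _ \<sigma>(1)] by metis
        then show False using x by (simp add: N_def)
      qed
    qed
    have NB: "x \<in> Simp B n" if "x \<in> N" for x using that by (simp add: N_def)
    show "ext_lift (subsset (sset_prod B J) (C (Suc n))) (C n) X Y p"
    proof (rule ext_lift_attach[where T = T and U = "\<lambda>m. N \<times> L m" and \<chi> = \<chi>])
      show "ext_lift T (\<lambda>m. N \<times> L m) X Y p"
        unfolding T_def by (rule ext_lift_copies) (use cell in \<open>auto simp: K_def L_def\<close>)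
      show "simplicial_set T"
        using K unfolding simplicial_set_def T_def by auto
      show "subcomplex (sset_prod B J) (C n)" by (rule sub)
      show "simplicial_map T (sset_prod B J) \<chi>"
        by (rule simplicial_mapI) (auto simp: \<chi>_def simplicial_set_Act[OF B] simplicial_set_comp[OF B] NB)
      show "t \<in> N \<times> L m \<longleftrightarrow> t \<in> Simp T m \<and> \<chi> m t \<in> C n m" for m t
        using key by (cases t) (auto simp: \<chi>_def C_def L_def simplicial_set_Act[OF B] NB)
      show "t = t'" if "t \<in> Simp T m" "t' \<in> Simp T m" "\<chi> m t = \<chi> m t'" "\<chi> m t \<notin> C n m" for m t t'
      proof -
        obtain x \<alpha> s x' \<alpha>' s' where t: "t = (x, \<alpha>, s)" "t' = (x', \<alpha>', s')"
          by (metis prod_cases3)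
        have *: "x \<in> N" "x' \<in> N" "\<alpha> \<in> Ops m n" "\<alpha>' \<in> Ops m n" "s = s'" "Act B n \<alpha> x = Act B n \<alpha>' x'" "s \<in> Simp J m"
          using that by (auto simp: t \<chi>_def)
        have "\<alpha> \<notin> bdry_ops n m"
          using that(4) key[OF *(1,3)] * by (auto simp: t \<chi>_def C_def simplicial_set_Act[OF B] NB)
        then show ?thesis
          using nondegenerate_unique[OF B, of x n x' \<alpha> m \<alpha>'] * by (auto simp: N_def t)
      qed
      show "C (Suc n) m = C n m \<union> \<chi> m ` Simp T m" for m
      proof (intro equalityI subsetI)
        fix z assume z: "z \<in> C (Suc n) m"
        show "z \<in> C n m \<union> \<chi> m ` Simp T m"
        proof (cases "z \<in> C n m")
          case False
          then obtain k \<theta> y where y: "k < Suc n" "\<theta> \<in> Ops m k" "y \<in> Simp B k" "fst z = Act B k \<theta> y"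
            and z': "fst z \<notin> A m" "fst z \<notin> skeleton B n m" "snd z \<in> Simp J m"
            using z by (auto simp: C_def skeleton_def[of B "Suc n"])
          have "\<not> k < n" using z'(2) y by (auto simp: skeleton_def)
          then have k: "k = n" using y(1) by simp
          \<comment> \<open>A simplex that is new at this stage is induced from dimension exactly
            \<open>n\<close>, and its generator is new as well, because \<open>A\<close> and the
            skeleton are closed under operators.\<close>
          have "y \<in> N"
            using y z' k A'(2)[OF y(2)] skeleton_Act[OF B _ y(2)] by (auto simp: N_def)
          then have "z = \<chi> m (y, \<theta>, snd z)" "(y, \<theta>, snd z) \<in> Simp T m"
            using y z' k by (auto simp: \<chi>_def prod_eq_iff)
          then show ?thesis by blast
        qed simp
      next
        fix z assume "z \<in> C n m \<union> \<chi> m ` Simp T m"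
        then show "z \<in> C (Suc n) m"
        proof
          assume "z \<in> \<chi> m ` Simp T m"
          then obtain x \<alpha> s where "x \<in> N" "\<alpha> \<in> Ops m n" "s \<in> Simp J m" "z = (Act B n \<alpha> x, s)"
            by (auto simp: \<chi>_def)
          then show ?thesis
            using NB[of x] by (auto simp: C_def skeleton_def simplicial_set_Act[OF B])
        qed (auto simp: C_def skeleton_def intro: less_SucI)
      qed
    qed
  qed
  moreover have "C 0 = (\<lambda>m. {z \<in> Simp B m \<times> Simp J m. fst z \<in> A m \<or> snd z \<in> J0 m})"
    by (auto simp: C_def skeleton_def)
  ultimately show ?thesis by simp
qed

section \<open>Trivial fibrations and homotopy extension\<close>

definition triv_fib :: "'a sset \<Rightarrow> 'b sset \<Rightarrow> (nat \<Rightarrow> 'a \<Rightarrow> 'b) \<Rightarrow> bool" where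
  "triv_fib X Y p \<longleftrightarrow> simplicial_set X \<and> simplicial_set Y \<and> simplicial_map X Y p \<and>
     (\<forall>n. ext_lift (std_simplex n) (bdry_ops n) X Y p)"

text \<open>By \<open>ext_lift_skeletal\<close> with a point as second factor, every inclusion of a
  subcomplex is built from boundary inclusions. The two uses of \<open>ext_lift_retract\<close>
  insert and remove the factor \<open>std_simplex 0\<close>.\<close>

lemma triv_fib_ext_lift:
  assumes p: "triv_fib X Y p" and B: "simplicial_set B" and A: "subcomplex B A"
  shows "ext_lift B A X Y p"
proof -
  let ?J = "std_simplex 0"
  have rep [simp]: "0 # replicate m 0 \<in> Ops m 0" for m
    using replicate_Ops[of m 0 0] by simp
  have Ops0 [simp]: "\<theta> \<in> Ops m 0 \<longleftrightarrow> \<theta> = 0 # replicate m 0" for \<theta> m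
    using Ops_0_target[of \<theta> m] replicate_Ops[of m 0 0] by auto
  have comp0: "op_comp (0 # replicate m 0) \<theta> = 0 # replicate l 0" if "\<theta> \<in> Ops l m" for \<theta> m l
    using op_comp_replicate[OF that, of 0] by simp
  have "ext_lift (sset_prod B ?J) (\<lambda>m. {z \<in> Simp B m \<times> Simp ?J m. fst z \<in> A m \<or> snd z \<in> (\<lambda>_. {}) m}) X Y p"
  proof (rule ext_lift_skeletal[OF B simplicial_set_std_simplex A])
    show "subcomplex ?J (\<lambda>_. {})" by (simp add: subcomplex_def)
    fix n
    have "ext_lift (std_simplex n) (bdry_ops n) X Y p" using p by (simp add: triv_fib_def)
    then show "ext_lift (sset_prod (std_simplex n) ?J)
      (\<lambda>m. {z \<in> Ops m n \<times> Simp ?J m. fst z \<in> bdry_ops n m \<or> snd z \<in> {}}) X Y p"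
      by (rule ext_lift_retract[where i = "\<lambda>m z. fst z" and r = "\<lambda>m x. (x, replicate (Suc m) 0)"])
        (auto simp: bdry_ops_def simplicial_map_def comp0)
  qed
  then show ?thesis
    by (rule ext_lift_retract[where r = "\<lambda>m z. fst z" and i = "\<lambda>m x. (x, replicate (Suc m) 0)"])
        (use A in \<open>auto simp: simplicial_map_def comp0 subcomplex_def\<close>)
qed

lemma kan_fibration_horn:
  "kan_fibration X Y p \<longleftrightarrow> simplicial_set X \<and> simplicial_set Y \<and> simplicial_map X Y p \<and>
     (\<forall>n\<ge>1. \<forall>k\<le>n. ext_lift (std_simplex n) (Simp (horn n k)) X Y p)"
  unfolding kan_fibration_def ext_lift_def by (simp add: horn_def subsset_def std_simplex_def)

text \<open>The prism is filtered by subcomplexes \<open>D k\<close>, and \<open>D k\<close> arises from \<open>D (k + 1)\<close> by attaching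
  along the horn \<open>\<Lambda>\<^sup>n\<^sup>+\<^sup>1\<^sub>k\<close> the \<open>(n+1)\<close>-simplex that jumps from level 0 to level 1 at the
  vertex \<open>k\<close>.\<close>

lemma kan_fibration_prism:
  assumes p: "kan_fibration X Y p"
  shows "ext_lift (sset_prod (std_simplex n) (std_simplex 1))
      (\<lambda>m. {z \<in> Ops m n \<times> Simp (std_simplex 1) m. fst z \<in> bdry_ops n m \<or> snd z \<in> {replicate (Suc m) 0}}) X Y p"
proof -
  let ?P = "sset_prod (std_simplex n) (std_simplex 1)"
  \<comment> \<open>Off the boundary part, level 1 is allowed only over the vertices from
    \<open>k\<close> on. Thus \<open>D 0\<close> is the whole prism, and in \<open>D (Suc n)\<close>
    only the boundary part and the bottom are left.\<close>
  define D where "D k m = {z \<in> Ops m n \<times> Ops m 1. fst z \<in> bdry_ops n m \<or> (\<forall>i\<le>m. snd z ! i = 1 \<longrightarrow> k \<le> fst z ! i)}" for k m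
  have sub: "subcomplex ?P (D k)" for k
    unfolding subcomplex_def
  proof (intro conjI allI ballI)
    show "D k m \<subseteq> Simp ?P m" for m by (auto simp: D_def)
    fix m l \<theta> z assume \<theta>: "\<theta> \<in> Ops m l" and z: "z \<in> D k l"
    then show "Act ?P l \<theta> z \<in> D k m"
      using Ops_le[OF \<theta>] by (auto simp: D_def bdry_ops_comp nth_op_comp[OF \<theta>])
  qed
  have step: "ext_lift (subsset ?P (D k)) (D (Suc k)) X Y p" if k: "k \<le> n" for k
  proof -
    \<comment> \<open>The pair \<open>(s, t)\<close> runs through
      \<open>(0,0), ..., (k,0), (k,1), ..., (n,1)\<close>: \<open>s\<close> repeats the vertex
      \<open>k\<close>, and \<open>t\<close> jumps there.\<close>
    define s where "s = mk_op (Suc n) (\<lambda>i. if i \<le> k then i else i - 1)"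
    define t where "t = mk_op (Suc n) (\<lambda>i. if i \<le> k then 0 else 1)"
    have s: "s \<in> Ops (Suc n) n" unfolding s_def by (rule mk_op_Ops) (use k in auto)
    have t: "t \<in> Ops (Suc n) 1" unfolding t_def by (rule mk_op_Ops) auto
    have s_nth: "op_comp s \<theta> ! i = (if \<theta> ! i \<le> k then \<theta> ! i else \<theta> ! i - 1)"
      and t_nth: "op_comp t \<theta> ! i = (if \<theta> ! i \<le> k then 0 else 1)"
      if "\<theta> \<in> Ops m (Suc n)" "i \<le> m" for \<theta> i m
      using that Ops_le[OF that] by (simp_all add: nth_op_comp s_def t_def)
    show ?thesis
    proof (rule ext_lift_attach[where T = "std_simplex (Suc n)" and U = "Simp (horn (Suc n) k)"
          and \<chi> = "\<lambda>m \<theta>. (op_comp s \<theta>, op_comp t \<theta>)"])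
      show "ext_lift (std_simplex (Suc n)) (Simp (horn (Suc n) k)) X Y p"
        using p k by (simp add: kan_fibration_horn)
      show "simplicial_set (std_simplex (Suc n))" by (rule simplicial_set_std_simplex)
      show "subcomplex ?P (D (Suc k))" by (rule sub)
      show "simplicial_map (std_simplex (Suc n)) ?P (\<lambda>m \<theta>. (op_comp s \<theta>, op_comp t \<theta>))"
        using s t by (auto simp: simplicial_map_def op_comp_assoc)
      show "\<theta> \<in> Simp (horn (Suc n) k) m \<longleftrightarrow>
          \<theta> \<in> Simp (std_simplex (Suc n)) m \<and> (op_comp s \<theta>, op_comp t \<theta>) \<in> D (Suc k) m" for m \<theta>
      proof (cases "\<theta> \<in> Ops m (Suc n)")
        case True
        note \<theta> = this
        have c: "op_comp s \<theta> \<in> Ops m n" "op_comp t \<theta> \<in> Ops m 1" using \<theta> s t by auto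
        have in_s: "l \<in> set (op_comp s \<theta>) \<longleftrightarrow> (\<exists>i\<le>m. (if \<theta> ! i \<le> k then \<theta> ! i else \<theta> ! i - 1) = l)" for l
          using s_nth[OF \<theta>] by (auto simp: Ops_set[OF c(1)])
        \<comment> \<open>\<open>Suc k\<close> is the only vertex sent to \<open>(k,1)\<close>, so
          operators that miss it lie in \<open>D (Suc k)\<close>. Those that miss another vertex
          than \<open>k\<close> lie in it through the boundary of the base. Missing only
          \<open>k\<close> does neither, since \<open>s\<close> still reaches \<open>k\<close> from
          \<open>Suc k\<close>; this leaves the horn.\<close>
        have D: "(op_comp s \<theta>, op_comp t \<theta>) \<in> D (Suc k) m \<longleftrightarrow>
            (\<exists>l\<le>n. l \<notin> set (op_comp s \<theta>)) \<or> Suc k \<notin> set \<theta>"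
          using c s_nth[OF \<theta>] t_nth[OF \<theta>] by (fastforce simp: D_def bdry_ops_def Ops_set[OF \<theta>])
        have "(\<exists>j\<le>Suc n. j \<noteq> k \<and> j \<notin> set \<theta>) \<longleftrightarrow> (\<exists>l\<le>n. l \<notin> set (op_comp s \<theta>)) \<or> Suc k \<notin> set \<theta>"
        proof
          assume "\<exists>j\<le>Suc n. j \<noteq> k \<and> j \<notin> set \<theta>"
          then obtain j where j: "j \<le> Suc n" "j \<noteq> k" "j \<notin> set \<theta>" by blast
          consider "j = Suc k" | "j < k" | "j > Suc k" using j by linarith
          then show "(\<exists>l\<le>n. l \<notin> set (op_comp s \<theta>)) \<or> Suc k \<notin> set \<theta>"
          proof cases
            case 2
            then have "j \<notin> set (op_comp s \<theta>)" using j by (auto simp: in_s Ops_set[OF \<theta>])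
            then show ?thesis using 2 k by auto
          next
            case 3
            then have "j - 1 \<notin> set (op_comp s \<theta>)" using j by (auto simp: in_s Ops_set[OF \<theta>])
            then show ?thesis using 3 j by (intro disjI1 exI[of _ "j - 1"]) auto
          qed (use j in auto)
        next
          assume "(\<exists>l\<le>n. l \<notin> set (op_comp s \<theta>)) \<or> Suc k \<notin> set \<theta>"
          then show "\<exists>j\<le>Suc n. j \<noteq> k \<and> j \<notin> set \<theta>"
          proof
            assume "\<exists>l\<le>n. l \<notin> set (op_comp s \<theta>)"
            then obtain l where l: "l \<le> n" "l \<notin> set (op_comp s \<theta>)" by blast
            show ?thesis
            proof (cases "l < k")
              case True
              then have "l \<notin> set \<theta>" using l by (auto simp: in_s Ops_set[OF \<theta>])
              then show ?thesis using True l by (intro exI[of _ l]) simp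
            next
              case False
              then have "Suc l \<notin> set \<theta>" using l by (force simp: in_s Ops_set[OF \<theta>])
              then show ?thesis using False l by (intro exI[of _ "Suc l"]) auto
            qed
          qed (use k in auto)
        qed
        then show ?thesis using \<theta> D by (auto simp: horn_def)
      qed (auto simp: horn_def)
      show "\<theta> = \<theta>'" if "\<theta> \<in> Simp (std_simplex (Suc n)) m" "\<theta>' \<in> Simp (std_simplex (Suc n)) m"
        "(op_comp s \<theta>, op_comp t \<theta>) = (op_comp s \<theta>', op_comp t \<theta>')" for m \<theta> \<theta>'
      proof (rule Ops_eqI)
        show "\<theta> \<in> Ops m (Suc n)" "\<theta>' \<in> Ops m (Suc n)" using that by auto
        fix i assume i: "i \<le> m"
        have eqs: "op_comp s \<theta> = op_comp s \<theta>'" "op_comp t \<theta> = op_comp t \<theta>'" using that(3) by auto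
        have \<theta>: "\<theta> \<in> Ops m (Suc n)" and \<theta>': "\<theta>' \<in> Ops m (Suc n)" using that by auto
        have arith: "a = b" if "(if a \<le> k then a else a - 1) = (if b \<le> k then b else b - 1)"
          "(if a \<le> k then 0 else 1 :: nat) = (if b \<le> k then 0 else 1)" for a b :: nat
          using that by (cases "a \<le> k"; cases "b \<le> k") simp_all
        show "\<theta> ! i = \<theta>' ! i"
        proof (rule arith)
          show "(if \<theta> ! i \<le> k then \<theta> ! i else \<theta> ! i - 1) = (if \<theta>' ! i \<le> k then \<theta>' ! i else \<theta>' ! i - 1)"
            unfolding s_nth[OF \<theta> i, symmetric] s_nth[OF \<theta>' i, symmetric] eqs by (rule refl)
          show "(if \<theta> ! i \<le> k then 0 else 1 :: nat) = (if \<theta>' ! i \<le> k then 0 else 1)"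
            unfolding t_nth[OF \<theta> i, symmetric] t_nth[OF \<theta>' i, symmetric] eqs by (rule refl)
        qed
      qed
      show "D k m = D (Suc k) m \<union> (\<lambda>\<theta>. (op_comp s \<theta>, op_comp t \<theta>)) ` Simp (std_simplex (Suc n)) m" for m
      proof (intro equalityI subsetI)
        fix z assume z: "z \<in> D k m"
        obtain \<alpha> \<beta> where z_eq: "z = (\<alpha>, \<beta>)" by fastforce
        have \<alpha>: "\<alpha> \<in> Ops m n" and \<beta>: "\<beta> \<in> Ops m 1" using z by (auto simp: D_def z_eq)
        show "z \<in> D (Suc k) m \<union> (\<lambda>\<theta>. (op_comp s \<theta>, op_comp t \<theta>)) ` Simp (std_simplex (Suc n)) m"
        proof (cases "z \<in> D (Suc k) m")
          case False
          have "\<alpha> \<notin> bdry_ops n m" using False \<alpha> \<beta> by (auto simp: D_def z_eq)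
          then have ge: "\<forall>i\<le>m. \<beta> ! i = 1 \<longrightarrow> k \<le> \<alpha> ! i" using z by (auto simp: D_def z_eq)
          \<comment> \<open>What \<open>D k\<close> adds to \<open>D (Suc k)\<close> passes through
            \<open>(k,1)\<close>; by monotonicity its part at level 0 then stays over the vertices
            up to \<open>k\<close>.\<close>
          obtain i0 where i0: "i0 \<le> m" "\<beta> ! i0 = 1" "\<alpha> ! i0 = k"
            using False \<alpha> \<beta> ge by (auto simp: D_def z_eq not_less_eq_eq)
          have le: "\<alpha> ! i \<le> k" if "i \<le> m" "\<beta> ! i = 0" for i
          proof (rule ccontr)
            assume "\<not> \<alpha> ! i \<le> k"
            then have "i0 \<le> i" using Ops_mono[OF \<alpha>, of i i0] i0 that by (metis nat_le_linear)
            then show False using Ops_mono[OF \<beta>, of i0 i] i0 that by simp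
          qed
          have \<beta>01: "\<beta> ! i = 0 \<or> \<beta> ! i = 1" if "i \<le> m" for i
            using Ops_le[OF \<beta> that] by linarith
          \<comment> \<open>Along the path traced by \<open>(s, t)\<close> the point
            \<open>(a, b)\<close> has number \<open>a + b\<close>.\<close>
          define \<theta> where "\<theta> = mk_op m (\<lambda>i. \<alpha> ! i + \<beta> ! i)"
          have \<theta>: "\<theta> \<in> Ops m (Suc n)" unfolding \<theta>_def
          proof (rule mk_op_Ops)
            show "\<alpha> ! i + \<beta> ! i \<le> Suc n" if "i \<le> m" for i
              using Ops_le[OF \<alpha> that] Ops_le[OF \<beta> that] by simp
            show "\<alpha> ! i + \<beta> ! i \<le> \<alpha> ! j + \<beta> ! j" if "i \<le> j" "j \<le> m" for i j
              using Ops_mono[OF \<alpha> that] Ops_mono[OF \<beta> that] by simp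
          qed
          have "op_comp s \<theta> = \<alpha>"
          proof (rule Ops_eqI[OF op_comp_Ops[OF \<theta> s] \<alpha>])
            fix i assume i: "i \<le> m"
            then show "op_comp s \<theta> ! i = \<alpha> ! i"
              unfolding s_nth[OF \<theta> i] using i \<beta>01[OF i] ge le[OF i] by (auto simp: \<theta>_def)
          qed
          moreover have "op_comp t \<theta> = \<beta>"
          proof (rule Ops_eqI[OF op_comp_Ops[OF \<theta> t] \<beta>])
            fix i assume i: "i \<le> m"
            then show "op_comp t \<theta> ! i = \<beta> ! i"
              unfolding t_nth[OF \<theta> i] using i \<beta>01[OF i] ge le[OF i] by (auto simp: \<theta>_def)
          qed
          ultimately show ?thesis using \<theta> z_eq by force
        qed simp
      next
        fix z assume "z \<in> D (Suc k) m \<union> (\<lambda>\<theta>. (op_comp s \<theta>, op_comp t \<theta>)) ` Simp (std_simplex (Suc n)) m"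
        then show "z \<in> D k m"
        proof
          assume "z \<in> (\<lambda>\<theta>. (op_comp s \<theta>, op_comp t \<theta>)) ` Simp (std_simplex (Suc n)) m"
          then obtain \<theta> where \<theta>: "\<theta> \<in> Ops m (Suc n)" and z: "z = (op_comp s \<theta>, op_comp t \<theta>)" by auto
          show ?thesis
            using s t \<theta> by (auto simp: z D_def s_nth[OF \<theta>] t_nth[OF \<theta>])
        qed (auto simp: D_def)
      qed
    qed
  qed
  have "ext_lift (subsset ?P (D k)) (D (Suc n)) X Y p" if "k \<le> Suc n" for k
    using that
  proof (induction rule: inc_induct)
    case (step k)
    show ?case
      by (rule ext_lift_trans[OF step.IH \<open>\<And>k. k \<le> n \<Longrightarrow> ext_lift (subsset ?P (D k)) (D (Suc k)) X Y p\<close>])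
        (use step in \<open>auto simp: D_def\<close>)
  qed (rule ext_lift_refl)
  from this[of 0] have "ext_lift (subsset ?P (D 0)) (D (Suc n)) X Y p" by simp
  moreover have "D 0 = Simp ?P" by (auto simp: D_def)
  moreover have "D (Suc n) = (\<lambda>m. {z \<in> Ops m n \<times> Simp (std_simplex 1) m. fst z \<in> bdry_ops n m \<or> snd z \<in> {replicate (Suc m) 0}})"
  proof
    fix m
    have "(\<forall>i\<le>m. \<beta> ! i = 1 \<longrightarrow> Suc n \<le> \<alpha> ! i) \<longleftrightarrow> \<beta> = replicate (Suc m) 0"
      if \<alpha>: "\<alpha> \<in> Ops m n" and \<beta>: "\<beta> \<in> Ops m 1" for \<alpha> \<beta>
    proof
      assume *: "\<forall>i\<le>m. \<beta> ! i = 1 \<longrightarrow> Suc n \<le> \<alpha> ! i"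
      show "\<beta> = replicate (Suc m) 0"
      proof (rule Ops_eqI[OF \<beta>])
        show "replicate (Suc m) 0 \<in> Ops m 1" by (simp del: replicate_Suc)
        fix i assume i: "i \<le> m"
        then show "\<beta> ! i = replicate (Suc m) 0 ! i"
          using * Ops_le[OF \<alpha> i] Ops_le[OF \<beta> i] by (auto simp: nth_replicate less_Suc_eq_le le_Suc_eq simp del: replicate_Suc)
      qed
    qed (auto simp: nth_replicate less_Suc_eq_le simp del: replicate_Suc)
    then show "D (Suc n) m = {z \<in> Ops m n \<times> Simp (std_simplex 1) m. fst z \<in> bdry_ops n m \<or> snd z \<in> {replicate (Suc m) 0}}"
      unfolding D_def by (auto simp del: replicate_Suc)
  qed
  ultimately show ?thesis by simp
qed

text \<open>The prism case is carried over to all \<open>B\<close> by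
  \<open>ext_lift_skeletal\<close>, with the interval as second factor. Since the end 0 is the
  prescribed one, homotopies are always transported from 0 to 1.\<close>

lemma kan_fibration_homotopy_extension:
  assumes p: "kan_fibration X Y p" and B: "simplicial_set B" and A: "subcomplex B A"
  shows "ext_lift (sset_prod B (std_simplex 1))
    (\<lambda>m. {z \<in> Simp B m \<times> Ops m 1. fst z \<in> A m \<or> snd z = replicate (Suc m) 0}) X Y p"
proof -
  have "subcomplex (std_simplex 1) (\<lambda>m. {replicate (Suc m) 0})"
    by (auto simp: subcomplex_def op_comp_replicate simp del: replicate_Suc)
  from ext_lift_skeletal[OF B simplicial_set_std_simplex A this kan_fibration_prism[OF p]]
  show ?thesis by simp
qed

section \<open>Trivial fibrations and weak equivalences\<close>

text \<open>Lifting against the empty inclusion gives a section \<open>s\<close>, and lifting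
  against the two ends of the cylinder on \<open>K\<close> gives a homotopy from \<open>s p\<close>
  to the identity. So \<open>p\<close> is a homotopy equivalence and induces bijections on homotopy
  classes of maps.\<close>

lemma triv_fib_weak_equivalence:
  assumes p: "triv_fib K L p"
  shows "weak_equivalence K L p"
proof -
  have K: "simplicial_set K" and L: "simplicial_set L" and pm: "simplicial_map K L p"
    using p by (auto simp: triv_fib_def)
  have "ext_lift L (\<lambda>_. {}) K L p"
    by (rule triv_fib_ext_lift[OF p L]) (simp add: subcomplex_def)
  then obtain s where s: "simplicial_map L K s" "\<And>m x. x \<in> Simp L m \<Longrightarrow> p m (s m x) = x"
    by (rule ext_liftE[of _ _ _ _ _ "\<lambda>_ _. undefined" "\<lambda>_ x. x"]) (auto simp: simplicial_map_def)
  let ?P = "sset_prod K (std_simplex 1)"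
  let ?A = "\<lambda>m. {z \<in> Simp K m \<times> Ops m 1. snd z = replicate (Suc m) 0 \<or> snd z = replicate (Suc m) 1}"
  have P: "simplicial_set ?P" by (intro simplicial_set_prod K simplicial_set_std_simplex)
  have A: "subcomplex ?P ?A"
    by (auto simp: subcomplex_def simplicial_set_Act[OF K] op_comp_replicate simp del: replicate_Suc)
  define u where "u m z = (if snd z = replicate (Suc m) 0 then s m (p m (fst z)) else fst z)" for m and z :: "'a \<times> nat list"
  have "simplicial_map (subsset ?P ?A) K u"
  proof (rule simplicial_mapI)
    fix n z assume z: "z \<in> Simp (subsset ?P ?A) n"
    then show "u n z \<in> Simp K n"
      using simplicial_map_Simp[OF s(1)] simplicial_map_Simp[OF pm] by (auto simp: u_def)
    fix m \<theta> assume \<theta>: "\<theta> \<in> Ops m n"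
    then show "u m (Act (subsset ?P ?A) n \<theta> z) = Act K n \<theta> (u n z)"
      using z simplicial_map_Act[OF s(1)] simplicial_map_Act[OF pm] simplicial_map_Simp[OF pm]
      by (auto simp: u_def op_comp_replicate simp del: replicate_Suc)
  qed
  moreover have "simplicial_map ?P L (\<lambda>m z. p m (fst z))"
    using pm by (auto simp: simplicial_map_def)
  ultimately obtain H where H: "simplicial_map ?P K H" "\<And>m z. z \<in> ?A m \<Longrightarrow> H m z = u m z"
    by (rule ext_liftE[OF triv_fib_ext_lift[OF p P A]]) (use simplicial_map_Simp[OF pm] s(2) in \<open>auto simp: u_def\<close>)
  have H0: "H n (x, replicate (Suc n) 0) = s n (p n x)" "H n (x, replicate (Suc n) 1) = x" if "x \<in> Simp K n" for n x
    using H(2) that by (auto simp: u_def simp del: replicate_Suc)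
  show ?thesis
    unfolding weak_equivalence_def
  proof (intro conjI K L pm allI impI)
    fix Z :: "('a + 'b) list sset" and g assume g: "simplicial_map K Z g"
    have "sset_homotopic K Z (\<lambda>n x. g n (s n (p n x))) g"
      unfolding sset_homotopic_def
      by (rule exI[of _ "\<lambda>n z. g n (H n z)"]) (use simplicial_map_comp[OF H(1) g] H0 in \<open>simp del: replicate_Suc\<close>)
    then show "\<exists>h. simplicial_map L Z h \<and> sset_homotopic K Z (\<lambda>n x. h n (p n x)) g"
      using simplicial_map_comp[OF s(1) g] by (intro exI[of _ "\<lambda>n x. g n (s n x)"]) simp
  next
    fix Z :: "('a + 'b) list sset" and h h'
    assume "sset_homotopic K Z (\<lambda>n x. h n (p n x)) (\<lambda>n x. h' n (p n x))"
    then obtain G where G: "simplicial_map ?P Z G" "\<And>n x. x \<in> Simp K n \<Longrightarrow> G n (x, replicate (Suc n) 0) = h n (p n x)"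
      "\<And>n x. x \<in> Simp K n \<Longrightarrow> G n (x, replicate (Suc n) 1) = h' n (p n x)"
      unfolding sset_homotopic_def by blast
    have "simplicial_map (sset_prod L (std_simplex 1)) ?P (\<lambda>n z. (s n (fst z), snd z))"
      using s(1) by (auto simp: simplicial_map_def)
    from simplicial_map_comp[OF this G(1)] show "sset_homotopic L Z h h'"
      unfolding sset_homotopic_def
      by (intro exI[of _ "\<lambda>n z. G n (s n (fst z), snd z)"])
        (use G simplicial_map_Simp[OF s(1)] s(2) in \<open>simp del: replicate_Suc\<close>)
  qed
qed

lemma subcomplex_bdry_ops: "subcomplex (std_simplex n) (bdry_ops n)"
  using bdry_ops_comp by (simp add: subcomplex_def) (auto simp: bdry_ops_def)

section \<open>Relabelling, and fibrations between Kan complexes\<close>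

lemma relabel_simps [simp]:
  "Simp (relabel e X) n = e ` Simp X n" "Act (relabel e X) n \<theta> y = e (Act X n \<theta> (inv e y))"
  by (simp_all add: relabel_def)

lemma simplicial_map_relabel: "inj e \<Longrightarrow> simplicial_map X (relabel e X) (\<lambda>n. e)"
  by (simp add: simplicial_map_def)

lemma simplicial_map_relabel_inv: "inj e \<Longrightarrow> simplicial_map (relabel e X) X (\<lambda>n. inv e)"
  by (auto simp: simplicial_map_def)

lemma simplicial_set_relabel: "inj e \<Longrightarrow> simplicial_set X \<Longrightarrow> simplicial_set (relabel e X)"
  by (auto simp: simplicial_set_def)

text \<open>The test objects in \<open>weak_equivalence\<close> have lists as simplices; this puts a
  copy of the source or the target of the map among them.\<close>

lemma kan_complex_relabel:
  assumes e: "inj e" and X: "kan_complex X"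
  shows "kan_complex (relabel e X)"
  unfolding kan_complex_def
proof (intro conjI allI impI)
  show "simplicial_set (relabel e X)" using simplicial_set_relabel[OF e] X by (simp add: kan_complex_def)
  fix n k u assume nk: "1 \<le> n" "k \<le> n" and u: "simplicial_map (horn n k) (relabel e X) u"
  from simplicial_map_comp[OF u simplicial_map_relabel_inv[OF e]]
  obtain h where h: "simplicial_map (std_simplex n) X h" "\<And>m \<alpha>. \<alpha> \<in> Simp (horn n k) m \<Longrightarrow> h m \<alpha> = inv e (u m \<alpha>)"
    using X nk unfolding kan_complex_def by metis
  have "e (h m \<alpha>) = u m \<alpha>" if "\<alpha> \<in> Simp (horn n k) m" for m \<alpha>
    using simplicial_map_Simp[OF u that] h(2)[OF that] e by auto
  then show "\<exists>h. simplicial_map (std_simplex n) (relabel e X) h \<and> (\<forall>m. \<forall>\<alpha>\<in>Simp (horn n k) m. h m \<alpha> = u m \<alpha>)"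
    using simplicial_map_comp[OF h(1) simplicial_map_relabel[OF e]] by (intro exI[of _ "\<lambda>m \<alpha>. e (h m \<alpha>)"]) simp
qed

text \<open>Lets \<open>kan_fibration_square\<close> be used over a point, where it composes
  homotopies in a Kan complex.\<close>

lemma kan_fibration_to_point:
  assumes "kan_complex X"
  shows "kan_fibration X (std_simplex 0) (\<lambda>m _. replicate (Suc m) 0)"
proof -
  have "v m \<alpha> = replicate (Suc m) 0" if "simplicial_map (std_simplex n) (std_simplex 0) v" "\<alpha> \<in> Ops m n" for n v m \<alpha>
    using simplicial_map_Simp[OF that(1), of \<alpha> m] that(2) Ops_0_target by simp
  moreover have "simplicial_map X (std_simplex 0) (\<lambda>m _. replicate (Suc m) 0)"
    by (auto simp: simplicial_map_def op_comp_replicate simp del: replicate_Suc)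
  ultimately show ?thesis
    using assms unfolding kan_fibration_def kan_complex_def
    by (simp add: simplicial_set_std_simplex del: replicate_Suc)
qed

text \<open>An open box with coordinates \<open>(\<sigma>, \<tau>)\<close> over \<open>C\<close>:
  \<open>K1\<close> is the side \<open>\<sigma> = 0\<close>, \<open>K2\<close> the side
  \<open>\<sigma> = 1\<close>, and the side \<open>\<tau> = 0\<close> is constant in
  \<open>\<sigma>\<close>. Homotopy extension in the direction \<open>\<tau>\<close>, relative to
  the two ends in the direction \<open>\<sigma>\<close>, fills the box over \<open>V\<close>;
  \<open>T\<close> is the remaining side.\<close>

lemma kan_fibration_square:
  assumes q: "kan_fibration X Y q" and C: "simplicial_set C"
    and K1: "simplicial_map (sset_prod C (std_simplex 1)) X K1"
    and K2: "simplicial_map (sset_prod C (std_simplex 1)) X K2"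
    and V: "simplicial_map (sset_prod (sset_prod C (std_simplex 1)) (std_simplex 1)) Y V"
    and start: "\<And>m x. x \<in> Simp C m \<Longrightarrow> K1 m (x, replicate (Suc m) 0) = K2 m (x, replicate (Suc m) 0)"
    and V1: "\<And>m x \<tau>. x \<in> Simp C m \<Longrightarrow> \<tau> \<in> Ops m 1 \<Longrightarrow> q m (K1 m (x, \<tau>)) = V m ((x, replicate (Suc m) 0), \<tau>)"
    and V2: "\<And>m x \<tau>. x \<in> Simp C m \<Longrightarrow> \<tau> \<in> Ops m 1 \<Longrightarrow> q m (K2 m (x, \<tau>)) = V m ((x, replicate (Suc m) 1), \<tau>)"
    and V0: "\<And>m x \<sigma>. x \<in> Simp C m \<Longrightarrow> \<sigma> \<in> Ops m 1 \<Longrightarrow>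
      q m (K1 m (x, replicate (Suc m) 0)) = V m ((x, \<sigma>), replicate (Suc m) 0)"
  obtains T where "simplicial_map (sset_prod C (std_simplex 1)) X T"
    "\<And>m x. x \<in> Simp C m \<Longrightarrow> T m (x, replicate (Suc m) 0) = K1 m (x, replicate (Suc m) 1)"
    "\<And>m x. x \<in> Simp C m \<Longrightarrow> T m (x, replicate (Suc m) 1) = K2 m (x, replicate (Suc m) 1)"
    "\<And>m x \<sigma>. x \<in> Simp C m \<Longrightarrow> \<sigma> \<in> Ops m 1 \<Longrightarrow> q m (T m (x, \<sigma>)) = V m ((x, \<sigma>), replicate (Suc m) 1)"
proof -
  let ?B = "sset_prod C (std_simplex 1)"
  let ?A = "\<lambda>m. {z \<in> Simp C m \<times> Ops m 1. snd z = replicate (Suc m) 0 \<or> snd z = replicate (Suc m) 1}"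
  let ?D = "\<lambda>m. {z \<in> Simp ?B m \<times> Ops m 1. fst z \<in> ?A m \<or> snd z = replicate (Suc m) 0}"
  have B: "simplicial_set ?B" by (intro simplicial_set_prod C simplicial_set_std_simplex)
  have A: "subcomplex ?B ?A"
    by (auto simp: subcomplex_def simplicial_set_Act[OF C] op_comp_replicate simp del: replicate_Suc)
  define u where "u m z = (if snd (fst z) = replicate (Suc m) 1 then K2 m (fst (fst z), snd z) else K1 m (fst (fst z), snd z))"
    for m and z :: "('c \<times> nat list) \<times> nat list"
  have ne: "replicate (Suc m) 0 \<noteq> replicate (Suc m) (1::nat)" for m by simp
  have "simplicial_map (subsset (sset_prod ?B (std_simplex 1)) ?D) X u"
  proof (rule simplicial_mapI)
    fix n z assume z: "z \<in> Simp (subsset (sset_prod ?B (std_simplex 1)) ?D) n"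
    obtain x \<sigma> \<tau> where ze: "z = ((x, \<sigma>), \<tau>)" by (metis prod.collapse)
    have x: "x \<in> Simp C n" and \<sigma>: "\<sigma> \<in> Ops n 1" and \<tau>: "\<tau> \<in> Ops n 1"
      and d: "\<sigma> = replicate (Suc n) 0 \<or> \<sigma> = replicate (Suc n) 1 \<or> \<tau> = replicate (Suc n) 0"
      using z by (auto simp: ze simp del: replicate_Suc)
    show "u n z \<in> Simp X n"
      using simplicial_map_Simp[OF K1, of "(x, \<tau>)" n] simplicial_map_Simp[OF K2, of "(x, \<tau>)" n] x \<tau> by (simp add: u_def ze)
    fix m \<theta> assume \<theta>: "\<theta> \<in> Ops m n"
    have K1': "K1 m (Act C n \<theta> x, op_comp \<tau> \<theta>) = Act X n \<theta> (K1 n (x, \<tau>))"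
      and K2': "K2 m (Act C n \<theta> x, op_comp \<tau> \<theta>) = Act X n \<theta> (K2 n (x, \<tau>))"
      using simplicial_map_Act[OF K1 \<theta>, of "(x, \<tau>)"] simplicial_map_Act[OF K2 \<theta>, of "(x, \<tau>)"] x \<tau> by auto
    show "u m (Act (subsset (sset_prod ?B (std_simplex 1)) ?D) n \<theta> z) = Act X n \<theta> (u n z)"
    proof (cases "\<sigma> = replicate (Suc n) 1")
      case True
      then show ?thesis by (simp add: u_def ze op_comp_replicate[OF \<theta>] K2' del: replicate_Suc)
    next
      case False
      show ?thesis
      proof (cases "op_comp \<sigma> \<theta> = replicate (Suc m) 1")
        \<comment> \<open>An operator may carry a simplex that is not over the end 1 into that end,
          where \<open>u\<close> switches from \<open>K1\<close> to \<open>K2\<close>. Such a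
          simplex lies on the side on which both agree.\<close>
        case True
        then have "\<sigma> \<noteq> replicate (Suc n) 0" using op_comp_replicate[OF \<theta>] ne by metis
        then have "\<tau> = replicate (Suc n) 0" using d False by blast
        then have "K2 m (Act C n \<theta> x, op_comp \<tau> \<theta>) = K1 m (Act C n \<theta> x, op_comp \<tau> \<theta>)"
          using start[OF simplicial_set_Act[OF C \<theta> x]] op_comp_replicate[OF \<theta>] by simp
        then show ?thesis using False True by (simp add: u_def ze K1' del: replicate_Suc)
      qed (use False in \<open>simp add: u_def ze K1' del: replicate_Suc\<close>)
    qed
  qed
  moreover have "q m (u m z) = V m z" if "z \<in> ?D m" for m z
    using that V1 V2 V0 start ne[of m] by (cases z) (auto simp: u_def simp del: replicate_Suc)
  ultimately obtain h where h: "simplicial_map (sset_prod ?B (std_simplex 1)) X h" "\<And>m z. z \<in> ?D m \<Longrightarrow> h m z = u m z"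
    "\<And>m z. z \<in> Simp (sset_prod ?B (std_simplex 1)) m \<Longrightarrow> q m (h m z) = V m z"
    by (rule ext_liftE[OF kan_fibration_homotopy_extension[OF q B A] _ V]) blast+
  show ?thesis
  proof (rule that[of "\<lambda>m z. h m (z, replicate (Suc m) 1)"])
    have "simplicial_map ?B (sset_prod ?B (std_simplex 1)) (\<lambda>m z. (z, replicate (Suc m) 1))"
      by (auto simp: simplicial_map_def op_comp_replicate simp del: replicate_Suc)
    from simplicial_map_comp[OF this h(1)] show "simplicial_map ?B X (\<lambda>m z. h m (z, replicate (Suc m) 1))" .
  qed (use h(2,3) ne in \<open>auto simp: u_def simp del: replicate_Suc\<close>)
qed

text \<open>A fibrewise deformation retraction is obtained as in Dold's theorem: a homotopy \<open>T\<close> from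
  \<open>s p\<close> to the identity is made fibrewise by filling the square with sides \<open>s p T\<close> and \<open>T\<close>.\<close>

lemma kan_fibration_weak_equivalence_triv_fib:
  assumes p: "kan_fibration E B p" and w: "weak_equivalence E B p"
    and E: "kan_complex E" and B: "kan_complex B"
  shows "triv_fib E B p"
proof -
  have Es: "simplicial_set E" and Bs: "simplicial_set B" and pm: "simplicial_map E B p"
    using p by (auto simp: kan_fibration_def)
  let ?I = "std_simplex 1"
  obtain g H where g: "simplicial_map B E g" and H: "simplicial_map (sset_prod E ?I) E H"
    "\<And>n x. x \<in> Simp E n \<Longrightarrow> H n (x, replicate (Suc n) 0) = g n (p n x)"
    "\<And>n x. x \<in> Simp E n \<Longrightarrow> H n (x, replicate (Suc n) 1) = x"
  proof -
    define e where "e = (\<lambda>x :: 'a. [Inl x :: 'a + 'b])"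
    have e: "inj e" by (auto simp: e_def inj_on_def)
    obtain h where h: "simplicial_map B (relabel e E) h" "sset_homotopic E (relabel e E) (\<lambda>n x. h n (p n x)) (\<lambda>n. e)"
      using w kan_complex_relabel[OF e E] simplicial_map_relabel[OF e, of E] unfolding weak_equivalence_def by blast
    then obtain H where H: "simplicial_map (sset_prod E ?I) (relabel e E) H"
      "\<And>n x. x \<in> Simp E n \<Longrightarrow> H n (x, replicate (Suc n) 0) = h n (p n x)"
      "\<And>n x. x \<in> Simp E n \<Longrightarrow> H n (x, replicate (Suc n) 1) = e x"
      unfolding sset_homotopic_def by blast
    show ?thesis
    proof (rule that)
      show "simplicial_map B E (\<lambda>n x. inv e (h n x))"
        by (rule simplicial_map_comp[OF h(1) simplicial_map_relabel_inv[OF e]])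
      show "simplicial_map (sset_prod E ?I) E (\<lambda>n x. inv e (H n x))"
        by (rule simplicial_map_comp[OF H(1) simplicial_map_relabel_inv[OF e]])
    qed (use H(2,3) e in \<open>simp_all del: replicate_Suc\<close>)
  qed
  \<comment> \<open>Testing on a copy of \<open>B\<close>: \<open>p g\<close> and the identity
    become homotopic after precomposition with \<open>p\<close>, hence are homotopic.\<close>
  obtain G where G: "simplicial_map (sset_prod B ?I) B G"
    "\<And>n x. x \<in> Simp B n \<Longrightarrow> G n (x, replicate (Suc n) 0) = p n (g n x)"
    "\<And>n x. x \<in> Simp B n \<Longrightarrow> G n (x, replicate (Suc n) 1) = x"
  proof -
    define e where "e = (\<lambda>x :: 'b. [Inr x :: 'a + 'b])"
    have e: "inj e" by (auto simp: e_def inj_on_def)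
    note em = simplicial_map_relabel[OF e, of B]
    have 1: "simplicial_map B (relabel e B) (\<lambda>n x. e (p n (g n x)))"
      using simplicial_map_comp[OF simplicial_map_comp[OF g pm] em] .
    have 2: "sset_homotopic E (relabel e B) (\<lambda>n x. e (p n (g n (p n x)))) (\<lambda>n x. e (p n x))"
      unfolding sset_homotopic_def
      by (rule exI[of _ "\<lambda>n x. e (p n (H n x))"])
        (use H simplicial_map_comp[OF simplicial_map_comp[OF H(1) pm] em] in \<open>simp del: replicate_Suc\<close>)
    have "sset_homotopic B (relabel e B) (\<lambda>n x. e (p n (g n x))) (\<lambda>n. e)"
      using w kan_complex_relabel[OF e B] 1 2 em unfolding weak_equivalence_def by blast
    then obtain G where G: "simplicial_map (sset_prod B ?I) (relabel e B) G"
      "\<And>n x. x \<in> Simp B n \<Longrightarrow> G n (x, replicate (Suc n) 0) = e (p n (g n x))"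
      "\<And>n x. x \<in> Simp B n \<Longrightarrow> G n (x, replicate (Suc n) 1) = e x"
      unfolding sset_homotopic_def by blast
    show ?thesis
    proof (rule that)
      show "simplicial_map (sset_prod B ?I) B (\<lambda>n x. inv e (G n x))"
        by (rule simplicial_map_comp[OF G(1) simplicial_map_relabel_inv[OF e]])
    qed (use G(2,3) e in \<open>simp_all del: replicate_Suc\<close>)
  qed
  have end_map: "simplicial_map C (sset_prod C ?I) (\<lambda>m z. (z, replicate (Suc m) 1))" for C :: "'c sset"
    by (auto simp: simplicial_map_def op_comp_replicate simp del: replicate_Suc)
  have ne: "replicate (Suc m) 0 \<noteq> replicate (Suc m) (1::nat)" for m by simp
  \<comment> \<open>Lifting the homotopy from \<open>p g\<close> to the identity, with start
    \<open>g\<close>, replaces \<open>g\<close> by a strict section, the end \<open>s\<close> of the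
    lift.\<close>
  obtain G' where G': "simplicial_map (sset_prod B ?I) E G'"
    "\<And>m x. x \<in> Simp B m \<Longrightarrow> G' m (x, replicate (Suc m) 0) = g m x"
    "\<And>m x \<tau>. x \<in> Simp B m \<Longrightarrow> \<tau> \<in> Ops m 1 \<Longrightarrow> p m (G' m (x, \<tau>)) = G m (x, \<tau>)"
  proof -
    have A: "subcomplex B (\<lambda>_. {})" by (simp add: subcomplex_def)
    let ?S = "\<lambda>m. {z \<in> Simp B m \<times> Ops m 1. fst z \<in> {} \<or> snd z = replicate (Suc m) 0}"
    have 1: "simplicial_map (subsset (sset_prod B ?I) ?S) E (\<lambda>m z. g m (fst z))"
      using g by (auto simp: simplicial_map_def)
    have 2: "p m (g m (fst z)) = G m z" if "z \<in> ?S m" for m z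
      using G(2)[of "fst z" m] that by (cases z) (auto simp del: replicate_Suc)
    show ?thesis
    proof (rule ext_liftE[OF kan_fibration_homotopy_extension[OF p Bs A] 1 G(1) 2])
      fix h assume h: "simplicial_map (sset_prod B ?I) E h" "\<And>m z. z \<in> ?S m \<Longrightarrow> h m z = g m (fst z)"
        "\<And>m z. z \<in> Simp (sset_prod B ?I) m \<Longrightarrow> p m (h m z) = G m z"
      show ?thesis
        by (rule that[OF h(1)]) (use h(2,3) in \<open>simp_all del: replicate_Suc\<close>)
    qed
  qed
  define s where "s m x = G' m (x, replicate (Suc m) 1)" for m x
  have s: "simplicial_map B E s"
    unfolding s_def by (rule simplicial_map_comp[OF end_map G'(1)])
  have ps: "p m (s m x) = x" if "x \<in> Simp B m" for m x
    using that G'(3) G(3) by (simp add: s_def del: replicate_Suc)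
  have pS: "p m x \<in> Simp B m" if "x \<in> Simp E m" for m x using simplicial_map_Simp[OF pm that] .
  \<comment> \<open>\<open>G'\<close> composed with \<open>p\<close> and \<open>H\<close> both start
    at \<open>g p\<close>; the square over a point joins their ends \<open>s p\<close> and the
    identity.\<close>
  obtain T where T: "simplicial_map (sset_prod E ?I) E T"
    "\<And>m x. x \<in> Simp E m \<Longrightarrow> T m (x, replicate (Suc m) 0) = s m (p m x)"
    "\<And>m x. x \<in> Simp E m \<Longrightarrow> T m (x, replicate (Suc m) 1) = x"
  proof -
    have "simplicial_map (sset_prod E ?I) (sset_prod B ?I) (\<lambda>m z. (p m (fst z), snd z))"
      using pm by (auto simp: simplicial_map_def)
    from simplicial_map_comp[OF this G'(1)]
    have 1: "simplicial_map (sset_prod E ?I) E (\<lambda>m z. G' m (p m (fst z), snd z))" .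
    have 2: "simplicial_map C (std_simplex 0) (\<lambda>m _. replicate (Suc m) 0)" for C :: "'c sset"
      by (auto simp: simplicial_map_def op_comp_replicate simp del: replicate_Suc)
    show ?thesis
    proof (rule kan_fibration_square[OF kan_fibration_to_point[OF E] Es 1 H(1) 2])
      fix T assume T: "simplicial_map (sset_prod E ?I) E T"
        "\<And>m x. x \<in> Simp E m \<Longrightarrow> T m (x, replicate (Suc m) 0) = G' m (p m (fst (x, replicate (Suc m) (1::nat))), snd (x, replicate (Suc m) 1))"
        "\<And>m x. x \<in> Simp E m \<Longrightarrow> T m (x, replicate (Suc m) 1) = H m (x, replicate (Suc m) 1)"
      show ?thesis
        by (rule that[OF T(1)]) (use T(2,3) H(3) in \<open>simp_all add: s_def del: replicate_Suc\<close>)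
    qed (use H(2) G'(2) pS in \<open>simp_all del: replicate_Suc\<close>)
  qed
  \<comment> \<open>As \<open>p s\<close> is the identity, \<open>s p T\<close> and \<open>T\<close>
    both start at \<open>s p\<close> and have the same image \<open>p T\<close>. The fourth side of
    the square joins their ends within the fibres of \<open>p\<close>.\<close>
  obtain \<Theta> where \<Theta>: "simplicial_map (sset_prod E ?I) E \<Theta>"
    "\<And>m x. x \<in> Simp E m \<Longrightarrow> \<Theta> m (x, replicate (Suc m) 0) = s m (p m x)"
    "\<And>m x. x \<in> Simp E m \<Longrightarrow> \<Theta> m (x, replicate (Suc m) 1) = x"
    "\<And>m x \<sigma>. x \<in> Simp E m \<Longrightarrow> \<sigma> \<in> Ops m 1 \<Longrightarrow> p m (\<Theta> m (x, \<sigma>)) = p m x"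
  proof -
    have TS: "T m (x, \<tau>) \<in> Simp E m" if "x \<in> Simp E m" "\<tau> \<in> Ops m 1" for m x \<tau>
      using simplicial_map_Simp[OF T(1), of "(x, \<tau>)" m] that by simp
    have 1: "simplicial_map (sset_prod E ?I) E (\<lambda>m z. s m (p m (T m z)))"
      using simplicial_map_comp[OF simplicial_map_comp[OF T(1) pm] s] .
    have 2: "simplicial_map (sset_prod (sset_prod E ?I) ?I) (sset_prod E ?I) (\<lambda>m z. (fst (fst z), snd z))"
      by (auto simp: simplicial_map_def)
    from simplicial_map_comp[OF this simplicial_map_comp[OF T(1) pm]]
    have 3: "simplicial_map (sset_prod (sset_prod E ?I) ?I) B (\<lambda>m z. p m (T m (fst (fst z), snd z)))" .
    show ?thesis
    proof (rule kan_fibration_square[OF p Es 1 T(1) 3])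
      fix \<Theta> assume \<Theta>: "simplicial_map (sset_prod E ?I) E \<Theta>"
        "\<And>m x. x \<in> Simp E m \<Longrightarrow> \<Theta> m (x, replicate (Suc m) 0) = s m (p m (T m (x, replicate (Suc m) 1)))"
        "\<And>m x. x \<in> Simp E m \<Longrightarrow> \<Theta> m (x, replicate (Suc m) 1) = T m (x, replicate (Suc m) 1)"
        "\<And>m x \<sigma>. x \<in> Simp E m \<Longrightarrow> \<sigma> \<in> Ops m 1 \<Longrightarrow>
          p m (\<Theta> m (x, \<sigma>)) = p m (T m (fst (fst ((x, \<sigma>), replicate (Suc m) (1::nat))), snd ((x, \<sigma>), replicate (Suc m) 1)))"
      show ?thesis
        by (rule that[OF \<Theta>(1)]) (use \<Theta>(2,3,4) T(3) in \<open>simp_all del: replicate_Suc\<close>)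
    qed (use T(2) TS ps pS simplicial_map_Simp[OF s] in \<open>simp_all del: replicate_Suc\<close>)
  qed
  have "ext_lift (std_simplex n) (bdry_ops n) E B p" for n
  proof (rule ext_liftI)
    fix u v
    assume u: "simplicial_map (subsset (std_simplex n) (bdry_ops n)) E u" and v: "simplicial_map (std_simplex n) B v"
      and uv: "\<And>m x. x \<in> bdry_ops n m \<Longrightarrow> p m (u m x) = v m x"
    note A = subcomplex_bdry_ops[of n]
    let ?S = "\<lambda>m. {z \<in> Simp (std_simplex n) m \<times> Ops m 1. fst z \<in> bdry_ops n m \<or> snd z = replicate (Suc m) 0}"
    \<comment> \<open>The lift starts as \<open>s v\<close>, which has the right image but the wrong
      boundary. \<open>\<Theta>\<close> moves the boundary to \<open>u\<close> within the fibres,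
      and homotopy extension carries the interior along.\<close>
    define u' where "u' m z = (if fst z \<in> bdry_ops n m then \<Theta> m (u m (fst z), snd z) else s m (v m (fst z)))"
      for m and z :: "nat list \<times> nat list"
    have uS: "u m \<alpha> \<in> Simp E m" if "\<alpha> \<in> bdry_ops n m" for m \<alpha>
      using simplicial_map_Simp[OF u] that by simp
    have vS: "v m \<alpha> \<in> Simp B m" if "\<alpha> \<in> Ops m n" for m \<alpha>
      using simplicial_map_Simp[OF v] that by simp
    have 1: "simplicial_map (subsset (sset_prod (std_simplex n) ?I) ?S) E u'"
    proof (rule simplicial_mapI)
      fix k z assume z: "z \<in> Simp (subsset (sset_prod (std_simplex n) ?I) ?S) k"
      obtain \<alpha> \<tau> where ze: "z = (\<alpha>, \<tau>)" by fastforce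
      have \<alpha>: "\<alpha> \<in> Ops k n" and \<tau>: "\<tau> \<in> Ops k 1" and d: "\<alpha> \<in> bdry_ops n k \<or> \<tau> = replicate (Suc k) 0"
        using z by (auto simp: ze)
      show "u' k z \<in> Simp E k"
        using simplicial_map_Simp[OF \<Theta>(1), of "(u k \<alpha>, \<tau>)" k] uS simplicial_map_Simp[OF s] vS \<alpha> \<tau> by (simp add: u'_def ze)
      fix m \<theta> assume \<theta>: "\<theta> \<in> Ops m k"
      have sv: "s m (v m (op_comp \<alpha> \<theta>)) = Act E k \<theta> (s k (v k \<alpha>))"
        using simplicial_map_Act[OF v \<theta>, of \<alpha>] simplicial_map_Act[OF s \<theta> vS[OF \<alpha>]] \<alpha> by simp
      show "u' m (Act (subsset (sset_prod (std_simplex n) ?I) ?S) k \<theta> z) = Act E k \<theta> (u' k z)"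
      proof (cases "\<alpha> \<in> bdry_ops n k")
        case True
        then show ?thesis
          using bdry_ops_comp[OF True \<theta>] simplicial_map_Act[OF u \<theta>, of \<alpha>] simplicial_map_Act[OF \<Theta>(1) \<theta>, of "(u k \<alpha>, \<tau>)"] uS[OF True] \<tau>
          by (simp add: u'_def ze)
      next
        case False
        then have \<tau>0: "\<tau> = replicate (Suc k) 0" using d by blast
        show ?thesis
        proof (cases "op_comp \<alpha> \<theta> \<in> bdry_ops n m")
          case True
          then show ?thesis
            using False \<Theta>(2)[OF uS[OF True]] uv[OF True] sv
            by (simp add: u'_def ze \<tau>0 op_comp_replicate[OF \<theta>] del: replicate_Suc)
        qed (use False sv in \<open>simp add: u'_def ze\<close>)
      qed
    qed
    have 2: "simplicial_map (sset_prod (std_simplex n) ?I) B (\<lambda>m z. v m (fst z))"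
      using v by (auto simp: simplicial_map_def)
    have 3: "p m (u' m z) = v m (fst z)" if "z \<in> ?S m" for m z
      using that uS vS \<Theta>(4) ps uv by (auto simp: u'_def simp del: replicate_Suc)
    obtain h where h: "simplicial_map (sset_prod (std_simplex n) ?I) E h" "\<And>m z. z \<in> ?S m \<Longrightarrow> h m z = u' m z"
      "\<And>m z. z \<in> Simp (sset_prod (std_simplex n) ?I) m \<Longrightarrow> p m (h m z) = v m (fst z)"
      by (rule ext_liftE[OF kan_fibration_homotopy_extension[OF p simplicial_set_std_simplex A] 1 2 3]) simp_all
    show "\<exists>h. simplicial_map (std_simplex n) E h \<and> (\<forall>m. \<forall>x\<in>bdry_ops n m. h m x = u m x) \<and>
        (\<forall>m. \<forall>x\<in>Simp (std_simplex n) m. p m (h m x) = v m x)"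
    proof (intro exI conjI allI ballI)
      show "simplicial_map (std_simplex n) E (\<lambda>m x. h m (x, replicate (Suc m) 1))"
        by (rule simplicial_map_comp[OF end_map h(1)])
      show "h m (x, replicate (Suc m) 1) = u m x" if x: "x \<in> bdry_ops n m" for m x
      proof -
        have "x \<in> Ops m n" using x by (simp add: bdry_ops_def)
        then show ?thesis using h(2)[of "(x, replicate (Suc m) 1)" m] \<Theta>(3)[OF uS[OF x]] x
          by (simp add: u'_def del: replicate_Suc)
      qed
      show "p m (h m (x, replicate (Suc m) 1)) = v m x" if x: "x \<in> Simp (std_simplex n) m" for m x
        using h(3)[of "(x, replicate (Suc m) 1)" m] x by (simp del: replicate_Suc)
    qed
  qed
  then show ?thesis using Es Bs pm by (simp add: triv_fib_def)
qed

section \<open>Path and loop spaces\<close>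

text \<open>The operator on cones that fixes the cone point, the new vertex 0; path and loop spaces
  use it for their action. In this picture \<open>map Suc \<theta>\<close> is
  \<open>\<theta>\<close> followed by the inclusion of the base, and
  \<open>map Suc (op_id n)\<close> is the face opposite to the cone point.\<close>

definition cone_op :: "nat list \<Rightarrow> nat list" where
  "cone_op \<theta> = 0 # map Suc \<theta>"

lemma cone_op_Ops [intro]: "\<theta> \<in> Ops m n \<Longrightarrow> cone_op \<theta> \<in> Ops (Suc m) (Suc n)"
  by (auto simp: Ops_def cone_op_def sorted_map intro: sorted_wrt_mono_rel[of _ "(\<le>)"])

lemma map_Suc_Ops [intro]: "\<theta> \<in> Ops m n \<Longrightarrow> map Suc \<theta> \<in> Ops m (Suc n)"
  by (auto simp: Ops_def sorted_map intro: sorted_wrt_mono_rel[of _ "(\<le>)"])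

lemma zero_Ops [simp, intro]: "[0] \<in> Ops 0 n"
  by (simp add: Ops_def)

lemma nth_cone_op: "\<theta> \<in> Ops m n \<Longrightarrow> i \<le> Suc m \<Longrightarrow> cone_op \<theta> ! i = (if i = 0 then 0 else Suc (\<theta> ! (i - 1)))"
  by (auto simp: cone_op_def nth_Cons Ops_iff split: nat.splits)

lemma op_comp_cone_op: "\<theta> \<in> Ops l m \<Longrightarrow> op_comp (cone_op \<alpha>) (cone_op \<theta>) = cone_op (op_comp \<alpha> \<theta>)" if "\<alpha> \<in> Ops m n"
  using that by (auto simp: op_comp_def cone_op_def Ops_def less_Suc_eq_le)

lemma op_comp_cone_op_map_Suc: "\<theta> \<in> Ops l m \<Longrightarrow> op_comp (cone_op \<alpha>) (map Suc \<theta>) = map Suc (op_comp \<alpha> \<theta>)" if "\<alpha> \<in> Ops m n"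
  using that by (auto simp: op_comp_def cone_op_def Ops_iff list_eq_iff_nth_eq less_Suc_eq_le)

lemma op_comp_map_Suc: "\<theta> \<in> Ops l m \<Longrightarrow> op_comp (map Suc \<alpha>) \<theta> = map Suc (op_comp \<alpha> \<theta>)" if "\<alpha> \<in> Ops m n"
  using that by (auto simp: op_comp_def Ops_iff list_eq_iff_nth_eq less_Suc_eq_le)

lemma op_comp_cone_op_zero: "op_comp (cone_op \<alpha>) [0] = [0]"
  by (simp add: op_comp_def cone_op_def)

lemma cone_op_id: "cone_op (op_id n) = op_id (Suc n)"
  by (simp add: cone_op_def op_id_def map_Suc_upt upt_conv_Cons del: upt_Suc)

lemma face_zero: "[1..<Suc (Suc n)] = map Suc (op_id n)"
  by (simp add: op_id_def map_Suc_upt del: upt_Suc)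

text \<open>A map out of a subcomplex \<open>S\<close> of \<open>\<Delta>\<^sup>n\<close> into a path object is a map out of the cone on \<open>S\<close>; it is
  glued here with a map on \<open>W \<supseteq> S\<close> in the base of the cone.  An operator \<open>\<beta>\<close> into the cone is
  decomposed as \<open>cone_op \<gamma> \<circ> e\<close>, where \<open>e\<close> collapses the zeros of \<open>\<beta>\<close>.\<close>

definition cone_base :: "nat \<Rightarrow> nat list \<Rightarrow> nat list" where
  "cone_base m \<beta> = mk_op m (\<lambda>i. \<beta> ! max i (LEAST i. 0 < \<beta> ! i) - 1)"

definition cone_part :: "(nat \<Rightarrow> nat list set) \<Rightarrow> (nat \<Rightarrow> nat list set) \<Rightarrow> nat \<Rightarrow> nat \<Rightarrow> nat list set" where
  "cone_part S W n m = {\<beta> \<in> Ops m (Suc n).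
     \<beta> = replicate (Suc m) 0 \<or> \<beta> ! 0 > 0 \<and> cone_base m \<beta> \<in> W m \<or>
     \<beta> ! 0 = 0 \<and> \<beta> \<noteq> replicate (Suc m) 0 \<and> cone_base m \<beta> \<in> S m}"

lemma Ops_nonzero:
  assumes \<beta>: "\<beta> \<in> Ops m n" and nz: "\<beta> \<noteq> replicate (Suc m) 0"
  shows "(LEAST i. 0 < \<beta> ! i) \<le> m" "0 < \<beta> ! (LEAST i. 0 < \<beta> ! i)"
proof -
  have "\<exists>i\<le>m. 0 < \<beta> ! i"
  proof (rule ccontr)
    assume "\<not> (\<exists>i\<le>m. 0 < \<beta> ! i)"
    then have "\<beta> = replicate (Suc m) 0"
      by (intro Ops_eqI[OF \<beta>, of _ 0]) (auto simp: nth_replicate less_Suc_eq_le simp del: replicate_Suc)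
    then show False using nz by simp
  qed
  then obtain i where "i \<le> m" "0 < \<beta> ! i" by blast
  then show "(LEAST i. 0 < \<beta> ! i) \<le> m" "0 < \<beta> ! (LEAST i. 0 < \<beta> ! i)"
    using Least_le[of "\<lambda>i. 0 < \<beta> ! i" i] LeastI[of "\<lambda>i. 0 < \<beta> ! i" i] by auto
qed

lemma Ops_max_positive:
  assumes \<beta>: "\<beta> \<in> Ops m n" and nz: "\<beta> \<noteq> replicate (Suc m) 0" and i: "i \<le> m"
  shows "max i (LEAST i. 0 < \<beta> ! i) \<le> m" "0 < \<beta> ! max i (LEAST i. 0 < \<beta> ! i)"
    "0 < \<beta> ! i \<Longrightarrow> max i (LEAST i. 0 < \<beta> ! i) = i"
  using Ops_nonzero[OF \<beta> nz] Ops_mono[OF \<beta>, of "LEAST i. 0 < \<beta> ! i" i] i Least_le[of "\<lambda>i. 0 < \<beta> ! i" i]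
  by (auto simp: max_def)

lemma nth_cone_base: "i \<le> m \<Longrightarrow> cone_base m \<beta> ! i = \<beta> ! max i (LEAST i. 0 < \<beta> ! i) - 1"
  by (simp add: cone_base_def)

lemma nth_cone_base_positive:
  "\<beta> \<in> Ops m n \<Longrightarrow> i \<le> m \<Longrightarrow> 0 < \<beta> ! i \<Longrightarrow> cone_base m \<beta> ! i = \<beta> ! i - 1"
  using Ops_max_positive(3)[of \<beta> m n i] nth_replicate[of i "Suc m" "0 :: nat"]
  by (cases "\<beta> = replicate (Suc m) 0") (simp_all add: nth_cone_base del: replicate_Suc)

lemma cone_base_Ops:
  assumes \<beta>: "\<beta> \<in> Ops m (Suc n)" and nz: "\<beta> \<noteq> replicate (Suc m) 0"
  shows "cone_base m \<beta> \<in> Ops m n"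
  unfolding cone_base_def
proof (rule mk_op_Ops)
  let ?r = "LEAST i. 0 < \<beta> ! i"
  show "\<beta> ! max i ?r - 1 \<le> n" if "i \<le> m" for i
    using Ops_le[OF \<beta> Ops_max_positive(1)[OF \<beta> nz that]] by simp
  show "\<beta> ! max i ?r - 1 \<le> \<beta> ! max j ?r - 1" if "i \<le> j" "j \<le> m" for i j
    using Ops_mono[OF \<beta>, of "max i ?r" "max j ?r"] Ops_max_positive(1)[OF \<beta> nz that(2)] that by (simp add: max.coboundedI1 diff_le_mono)
qed

text \<open>The zeros of \<open>\<beta>\<close> are filled with its first positive value, so no
  vertex of the base is added, and it can be read off from \<open>\<beta>\<close> whether
  \<open>cone_base\<close> lies in the boundary.\<close>

lemma set_cone_base:
  assumes \<beta>: "\<beta> \<in> Ops m (Suc n)" and nz: "\<beta> \<noteq> replicate (Suc m) 0"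
  shows "j \<in> set (cone_base m \<beta>) \<longleftrightarrow> Suc j \<in> set \<beta>"
proof -
  let ?r = "LEAST i. 0 < \<beta> ! i"
  have "(\<exists>i\<le>m. \<beta> ! max i ?r - 1 = j) \<longleftrightarrow> (\<exists>i\<le>m. \<beta> ! i = Suc j)"
  proof
    assume "\<exists>i\<le>m. \<beta> ! max i ?r - 1 = j"
    then obtain i where "i \<le> m" "\<beta> ! max i ?r - 1 = j" by blast
    then show "\<exists>i\<le>m. \<beta> ! i = Suc j"
      using Ops_max_positive[OF \<beta> nz, of i] by (intro exI[of _ "max i ?r"]) auto
  next
    assume "\<exists>i\<le>m. \<beta> ! i = Suc j"
    then obtain i where "i \<le> m" "\<beta> ! i = Suc j" by blast
    then show "\<exists>i\<le>m. \<beta> ! max i ?r - 1 = j"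
      using Ops_max_positive(3)[OF \<beta> nz, of i] by (intro exI[of _ i]) auto
  qed
  then show ?thesis
    by (simp add: Ops_set[OF \<beta>] Ops_set[OF cone_base_Ops[OF \<beta> nz]] nth_cone_base cong: conj_cong)
qed

text \<open>The three clauses of \<open>cone_part\<close> correspond to three rules for a map on it:
  constant at \<open>x0\<close> on the cone point, \<open>w\<close> on the base, and
  \<open>u\<close> in between, with \<open>u_start\<close> and \<open>u_end\<close> as
  compatibilities. For \<open>S = bdry_ops n\<close> the subcomplex is the full boundary if
  \<open>W\<close> is the whole base, and a horn if \<open>W = S\<close>; both are needed
  below.\<close>

lemma cone_lift:
  assumes lift: "ext_lift (std_simplex (Suc n)) (cone_part S W n) X Y p"
    and X: "simplicial_set X" and Y: "simplicial_set Y" and p: "simplicial_map X Y p"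
    and S: "subcomplex (std_simplex n) S" and W: "subcomplex (std_simplex n) W" and SW: "\<And>m. S m \<subseteq> W m"
    and u: "\<And>m \<alpha>. \<alpha> \<in> S m \<Longrightarrow> u m \<alpha> \<in> Simp X (Suc m)"
    and u_nat: "\<And>l m \<alpha> \<theta>. \<alpha> \<in> S m \<Longrightarrow> \<theta> \<in> Ops l m \<Longrightarrow> u l (op_comp \<alpha> \<theta>) = Act X (Suc m) (cone_op \<theta>) (u m \<alpha>)"
    and w: "simplicial_map (subsset (std_simplex n) W) X w"
    and x0: "x0 \<in> Simp X 0"
    and u_end: "\<And>m \<alpha>. \<alpha> \<in> S m \<Longrightarrow> Act X (Suc m) (map Suc (op_id m)) (u m \<alpha>) = w m \<alpha>"
    and u_start: "\<And>m \<alpha>. \<alpha> \<in> S m \<Longrightarrow> Act X (Suc m) [0] (u m \<alpha>) = x0"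
    and y: "y \<in> Simp Y (Suc n)"
    and pu: "\<And>m \<alpha>. \<alpha> \<in> S m \<Longrightarrow> p (Suc m) (u m \<alpha>) = Act Y (Suc n) (cone_op \<alpha>) y"
    and pw: "\<And>m \<alpha>. \<alpha> \<in> W m \<Longrightarrow> p m (w m \<alpha>) = Act Y (Suc n) (map Suc \<alpha>) y"
    and px0: "p 0 x0 = Act Y (Suc n) [0] y"
  shows "\<exists>z. z \<in> Simp X (Suc n) \<and> p (Suc n) z = y \<and>
    (\<forall>m. \<forall>\<alpha>\<in>S m. Act X (Suc n) (cone_op \<alpha>) z = u m \<alpha>) \<and>
    (\<forall>m. \<forall>\<alpha>\<in>W m. Act X (Suc n) (map Suc \<alpha>) z = w m \<alpha>) \<and> Act X (Suc n) [0] z = x0"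
proof -
  define e where "e m \<beta> = mk_op m (\<lambda>i. if \<beta> ! i = 0 then 0 else Suc i)" for m and \<beta> :: "nat list"
  define C where "C = cone_part S W n"
  have S': "S m \<subseteq> Ops m n" "\<And>\<theta> \<alpha> l. \<alpha> \<in> S m \<Longrightarrow> \<theta> \<in> Ops l m \<Longrightarrow> op_comp \<alpha> \<theta> \<in> S l" for m
    using S by (auto simp: subcomplex_def)
  have W': "W m \<subseteq> Ops m n" "\<And>\<theta> \<alpha> l. \<alpha> \<in> W m \<Longrightarrow> \<theta> \<in> Ops l m \<Longrightarrow> op_comp \<alpha> \<theta> \<in> W l" for m
    using W by (auto simp: subcomplex_def)
  have w_Simp: "w m \<alpha> \<in> Simp X m" if "\<alpha> \<in> W m" for m \<alpha>
    using simplicial_map_Simp[OF w] that by simp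
  have w_nat: "w l (op_comp \<alpha> \<theta>) = Act X m \<theta> (w m \<alpha>)" if "\<alpha> \<in> W m" "\<theta> \<in> Ops l m" for l m \<alpha> \<theta>
    using simplicial_map_Act[OF w that(2)] that by simp
  have e_Ops: "e m \<beta> \<in> Ops m (Suc m)" if "\<beta> \<in> Ops m k" for m \<beta> k
    unfolding e_def
  proof (rule mk_op_Ops)
    fix i j assume "i \<le> j" "j \<le> m"
    then show "(if \<beta> ! i = 0 then 0 else Suc i) \<le> (if \<beta> ! j = 0 then 0 else Suc j)"
      using Ops_mono[OF that, of i j] by auto
  qed auto
  have nz_pos: "\<beta> \<noteq> replicate (Suc m) 0" if "\<beta> ! 0 > 0" for \<beta> :: "nat list" and m
    using that by auto
  have decomp: "op_comp (cone_op (cone_base m \<beta>)) (e m \<beta>) = \<beta>"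
    if \<beta>: "\<beta> \<in> Ops m (Suc n)" and nz: "\<beta> \<noteq> replicate (Suc m) 0" for m \<beta>
  proof (rule Ops_eqI[OF op_comp_Ops[OF e_Ops[OF \<beta>] cone_op_Ops[OF cone_base_Ops[OF \<beta> nz]]] \<beta>])
    fix i assume i: "i \<le> m"
    have ei: "e m \<beta> ! i = (if \<beta> ! i = 0 then 0 else Suc i)" using i by (simp add: e_def)
    show "op_comp (cone_op (cone_base m \<beta>)) (e m \<beta>) ! i = \<beta> ! i"
      unfolding nth_op_comp[OF e_Ops[OF \<beta>] i] ei
      using i nth_cone_base_positive[OF \<beta> i] by (auto simp: nth_cone_op[OF cone_base_Ops[OF \<beta> nz]])
  qed
  \<comment> \<open>\<open>cone_base\<close> need not commute with operators at the zeros of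
    \<open>\<beta>\<close>. This is harmless: \<open>e\<close> sends these places to the cone point
    and absorbs \<open>\<rho>\<close>, which moves them onto the first positive place.\<close>
  have agree: "Act X (Suc m) (e m \<beta>) (u m \<gamma>) = Act X (Suc m) (e m \<beta>) (u m \<gamma>')"
    if \<beta>: "\<beta> \<in> Ops m (Suc n)" and nz: "\<beta> \<noteq> replicate (Suc m) 0"
      and \<gamma>: "\<gamma> \<in> S m" and \<gamma>': "\<gamma>' \<in> S m" and eq: "\<And>i. i \<le> m \<Longrightarrow> \<beta> ! i > 0 \<Longrightarrow> \<gamma> ! i = \<gamma>' ! i" for m \<beta> \<gamma> \<gamma>'
  proof -
    let ?r = "LEAST i. 0 < \<beta> ! i"
    define \<rho> where "\<rho> = mk_op m (\<lambda>i. max i ?r)"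
    have \<rho>: "\<rho> \<in> Ops m m" unfolding \<rho>_def by (rule mk_op_Ops) (use Ops_max_positive(1)[OF \<beta> nz] in auto)
    have e\<rho>: "op_comp (cone_op \<rho>) (e m \<beta>) = e m \<beta>"
    proof (rule Ops_eqI[OF op_comp_Ops[OF e_Ops[OF \<beta>] cone_op_Ops[OF \<rho>]] e_Ops[OF \<beta>]])
      fix i assume i: "i \<le> m"
      have ei: "e m \<beta> ! i = (if \<beta> ! i = 0 then 0 else Suc i)" using i by (simp add: e_def)
      show "op_comp (cone_op \<rho>) (e m \<beta>) ! i = e m \<beta> ! i"
        unfolding nth_op_comp[OF e_Ops[OF \<beta>] i] ei
        using i Ops_max_positive(3)[OF \<beta> nz i] by (auto simp: nth_cone_op[OF \<rho>]) (simp add: \<rho>_def)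
    qed
    have *: "Act X (Suc m) (e m \<beta>) (u m \<delta>) = Act X (Suc m) (e m \<beta>) (u m (op_comp \<delta> \<rho>))" if "\<delta> \<in> S m" for \<delta>
      using u_nat[OF that \<rho>] simplicial_set_comp[OF X e_Ops[OF \<beta>] cone_op_Ops[OF \<rho>] u[OF that]] e\<rho> by simp
    have "op_comp \<gamma> \<rho> = op_comp \<gamma>' \<rho>"
    proof (rule Ops_eqI)
      show "op_comp \<gamma> \<rho> \<in> Ops m n" "op_comp \<gamma>' \<rho> \<in> Ops m n" using \<gamma> \<gamma>' \<rho> S' by blast+
      fix i assume i: "i \<le> m"
      show "op_comp \<gamma> \<rho> ! i = op_comp \<gamma>' \<rho> ! i"
        unfolding nth_op_comp[OF \<rho> i] using eq Ops_max_positive[OF \<beta> nz i] i by (simp add: \<rho>_def)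
    qed
    then show ?thesis using *[OF \<gamma>] *[OF \<gamma>'] by simp
  qed
  define h where "h m \<beta> = (if \<beta> = replicate (Suc m) 0 then degen X m x0
      else if \<beta> ! 0 > 0 then w m (cone_base m \<beta>) else Act X (Suc m) (e m \<beta>) (u m (cone_base m \<beta>)))" for m \<beta>
  have h: "simplicial_map (subsset (std_simplex (Suc n)) C) X h"
  proof (rule simplicial_mapI)
    fix m \<beta> assume "\<beta> \<in> Simp (subsset (std_simplex (Suc n)) C) m"
    then have \<beta>C: "\<beta> \<in> C m" and \<beta>: "\<beta> \<in> Ops m (Suc n)" by (auto simp: C_def cone_part_def)
    show "h m \<beta> \<in> Simp X m"
      using \<beta>C degen_Simp[OF X x0] w_Simp u simplicial_set_Act[OF X e_Ops[OF \<beta>]]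
      by (auto simp: h_def C_def cone_part_def simp del: replicate_Suc)
    fix l \<theta> assume \<theta>: "\<theta> \<in> Ops l m"
    let ?\<beta> = "cone_base m \<beta>" and ?\<beta>\<theta> = "op_comp \<beta> \<theta>"
    have \<beta>\<theta>: "?\<beta>\<theta> \<in> Ops l (Suc n)" using \<beta> \<theta> by blast
    have nth: "?\<beta>\<theta> ! i = \<beta> ! (\<theta> ! i)" if "i \<le> l" for i using nth_op_comp[OF \<theta> that] .
    have base: "op_comp ?\<beta> \<theta> ! i = cone_base l ?\<beta>\<theta> ! i" if "i \<le> l" "0 < ?\<beta>\<theta> ! i" for i
      using nth_cone_base_positive[OF \<beta> Ops_le[OF \<theta> that(1)]] nth_cone_base_positive[OF \<beta>\<theta> that] nth that
      by (simp add: nth_op_comp[OF \<theta>])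
    have base_eq: "op_comp ?\<beta> \<theta> = cone_base l ?\<beta>\<theta>" if "?\<beta>\<theta> ! 0 > 0" and nz: "\<beta> \<noteq> replicate (Suc m) 0"
    proof (rule Ops_eqI[OF op_comp_Ops[OF \<theta> cone_base_Ops[OF \<beta> nz]] cone_base_Ops[OF \<beta>\<theta> nz_pos]])
      fix i assume i: "i \<le> l"
      then show "op_comp ?\<beta> \<theta> ! i = cone_base l ?\<beta>\<theta> ! i"
        using base[OF i] Ops_mono[OF \<beta>\<theta>, of 0 i] that by auto
    qed (use that in auto)
    consider (zero) "\<beta> = replicate (Suc m) 0" | (pos) "\<beta> ! 0 > 0" "?\<beta> \<in> W m"
      | (mixed) "\<beta> ! 0 = 0" "\<beta> \<noteq> replicate (Suc m) 0" "?\<beta> \<in> S m"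
      using \<beta>C by (auto simp: C_def cone_part_def)
    then have "h l ?\<beta>\<theta> = Act X m \<theta> (h m \<beta>)"
    proof cases
      case zero
      then show ?thesis
        using degen_Act[OF X x0 \<theta>] by (simp add: h_def op_comp_replicate[OF \<theta>] del: replicate_Suc)
    next
      case pos
      have "?\<beta>\<theta> ! 0 > 0" using Ops_mono[OF \<beta>, of 0 "\<theta> ! 0"] Ops_le[OF \<theta>, of 0] pos by (simp add: nth)
      then show ?thesis
        using pos nz_pos[of \<beta> m] nz_pos[of ?\<beta>\<theta> l] base_eq w_nat[OF pos(2) \<theta>] by (simp add: h_def del: replicate_Suc)
    next
      case mixed
      note nz = mixed(2)
      have hm: "h m \<beta> = Act X (Suc m) (e m \<beta>) (u m ?\<beta>)" using mixed by (simp add: h_def del: replicate_Suc)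
      have Ah: "Act X m \<theta> (h m \<beta>) = Act X (Suc m) (op_comp (e m \<beta>) \<theta>) (u m ?\<beta>)"
        unfolding hm by (rule simplicial_set_comp[OF X \<theta> e_Ops[OF \<beta>] u[OF mixed(3)]])
      have e\<theta>: "op_comp (e m \<beta>) \<theta> \<in> Ops l (Suc m)" using e_Ops[OF \<beta>] \<theta> by blast
      have e\<theta>_nth: "op_comp (e m \<beta>) \<theta> ! i = (if ?\<beta>\<theta> ! i = 0 then 0 else Suc (\<theta> ! i))" if "i \<le> l" for i
        using nth_op_comp[OF \<theta> that] nth[OF that] Ops_le[OF \<theta> that] by (simp add: e_def)
      \<comment> \<open>An operator may carry a mixed simplex to the cone point, into the base or to
        a mixed simplex, so naturality compares different clauses of \<open>h\<close>. The three
        cases rest on \<open>u_start\<close>, \<open>u_end\<close> and \<open>agree\<close>.\<close>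
      consider (zero') "?\<beta>\<theta> = replicate (Suc l) 0" | (pos') "?\<beta>\<theta> ! 0 > 0"
        | (mixed') "?\<beta>\<theta> ! 0 = 0" "?\<beta>\<theta> \<noteq> replicate (Suc l) 0" by blast
      then show ?thesis
      proof cases
        case zero'
        have "op_comp (e m \<beta>) \<theta> ! i = 0" if "i \<le> l" for i
          using e\<theta>_nth[OF that] that unfolding zero' by (simp add: nth_replicate del: replicate_Suc)
        then have "op_comp (e m \<beta>) \<theta> = op_comp [0] (replicate (Suc l) 0)"
          by (intro nth_equalityI)
            (simp_all add: Ops_length[OF \<theta>] nth_op_comp[of _ l 0] nth_replicate less_Suc_eq_le del: replicate_Suc)
        then have "Act X m \<theta> (h m \<beta>) = degen X l (Act X (Suc m) [0] (u m ?\<beta>))"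
          unfolding Ah degen_def
          by (subst simplicial_set_comp[OF X _ zero_Ops u[OF mixed(3)], of _ l]) (simp_all del: replicate_Suc)
        then show ?thesis using zero' u_start[OF mixed(3)] by (simp add: h_def del: replicate_Suc)
      next
        case pos'
        have "op_comp (e m \<beta>) \<theta> = op_comp (map Suc (op_id m)) \<theta>"
        proof (rule Ops_eqI[OF e\<theta>, of _ "Suc m"])
          show "op_comp (map Suc (op_id m)) \<theta> \<in> Ops l (Suc m)" using \<theta> by (intro op_comp_Ops[OF \<theta>] map_Suc_Ops op_id_Ops)
          fix i assume i: "i \<le> l"
          have "?\<beta>\<theta> ! i > 0" using Ops_mono[OF \<beta>\<theta>, of 0 i] pos' i by simp
          then show "op_comp (e m \<beta>) \<theta> ! i = op_comp (map Suc (op_id m)) \<theta> ! i"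
            using e\<theta>_nth[OF i] Ops_le[OF \<theta> i] nth_op_comp[OF \<theta> i] nth_op_id[of "\<theta> ! i" m] Ops_length[OF op_id_Ops[of m]] by simp
        qed
        then have "Act X m \<theta> (h m \<beta>) = Act X m \<theta> (Act X (Suc m) (map Suc (op_id m)) (u m ?\<beta>))"
          unfolding Ah by (simp add: simplicial_set_comp[OF X \<theta> map_Suc_Ops[OF op_id_Ops] u[OF mixed(3)]])
        also have "\<dots> = w l (op_comp ?\<beta> \<theta>)"
          using u_end[OF mixed(3)] w_nat[OF subsetD[OF SW mixed(3)] \<theta>] by simp
        finally show ?thesis
          using pos' nz_pos[OF pos', of l] base_eq[OF pos' nz] by (simp add: h_def del: replicate_Suc)
      next
        case mixed'
        let ?r = "LEAST i. 0 < ?\<beta>\<theta> ! i"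
        define \<rho> where "\<rho> = mk_op l (\<lambda>i. max i ?r)"
        have \<rho>: "\<rho> \<in> Ops l l" unfolding \<rho>_def by (rule mk_op_Ops) (use Ops_max_positive(1)[OF \<beta>\<theta> mixed'(2)] in auto)
        have \<beta>'\<theta>: "op_comp ?\<beta> \<theta> \<in> S l" using S'(2)[OF mixed(3) \<theta>] .
        have "cone_base l ?\<beta>\<theta> = op_comp (op_comp ?\<beta> \<theta>) \<rho>"
        proof (rule Ops_eqI[OF cone_base_Ops[OF \<beta>\<theta> mixed'(2)], of _ n])
          show "op_comp (op_comp ?\<beta> \<theta>) \<rho> \<in> Ops l n" using \<rho> \<beta>'\<theta> S' by blast
          fix i assume i: "i \<le> l"
          have "\<rho> ! i = max i ?r" using i by (simp add: \<rho>_def)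
          moreover have "cone_base l ?\<beta>\<theta> ! i = cone_base l ?\<beta>\<theta> ! max i ?r"
            using i Ops_max_positive(1)[OF \<beta>\<theta> mixed'(2) i] by (simp add: nth_cone_base)
          ultimately show "cone_base l ?\<beta>\<theta> ! i = op_comp (op_comp ?\<beta> \<theta>) \<rho> ! i"
            using base[of "max i ?r"] Ops_max_positive(1,2)[OF \<beta>\<theta> mixed'(2) i] nth_op_comp[OF \<rho> i] by simp
        qed
        then have cb: "cone_base l ?\<beta>\<theta> \<in> S l" using S'(2)[OF \<beta>'\<theta> \<rho>] by simp
        have "op_comp (e m \<beta>) \<theta> = op_comp (cone_op \<theta>) (e l ?\<beta>\<theta>)"
        proof (rule Ops_eqI[OF e\<theta> op_comp_Ops[OF e_Ops[OF \<beta>\<theta>] cone_op_Ops[OF \<theta>]]])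
          fix i assume i: "i \<le> l"
          have "e l ?\<beta>\<theta> ! i = (if ?\<beta>\<theta> ! i = 0 then 0 else Suc i)" using i by (simp add: e_def)
          then show "op_comp (e m \<beta>) \<theta> ! i = op_comp (cone_op \<theta>) (e l ?\<beta>\<theta>) ! i"
            unfolding e\<theta>_nth[OF i] nth_op_comp[OF e_Ops[OF \<beta>\<theta>] i] using i by (simp add: nth_cone_op[OF \<theta>])
        qed
        then have "Act X m \<theta> (h m \<beta>) = Act X (Suc l) (e l ?\<beta>\<theta>) (u l (op_comp ?\<beta> \<theta>))"
          unfolding Ah u_nat[OF mixed(3) \<theta>]
          by (simp add: simplicial_set_comp[OF X e_Ops[OF \<beta>\<theta>] cone_op_Ops[OF \<theta>] u[OF mixed(3)]])
        also have "\<dots> = Act X (Suc l) (e l ?\<beta>\<theta>) (u l (cone_base l ?\<beta>\<theta>))"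
          by (rule agree[OF \<beta>\<theta> mixed'(2) \<beta>'\<theta> cb base])
        finally show ?thesis using mixed' by (simp add: h_def del: replicate_Suc)
      qed
    qed
    then show "h l (Act (subsset (std_simplex (Suc n)) C) m \<theta> \<beta>) = Act X m \<theta> (h m \<beta>)" by simp
  qed
  have ph: "p m (h m \<beta>) = Act Y (Suc n) \<beta> y" if \<beta>C: "\<beta> \<in> C m" for m \<beta>
  proof -
    have \<beta>: "\<beta> \<in> Ops m (Suc n)" using \<beta>C by (simp add: C_def cone_part_def)
    consider (zero) "\<beta> = replicate (Suc m) 0" | (pos) "\<beta> ! 0 > 0" "cone_base m \<beta> \<in> W m"
      | (mixed) "\<beta> ! 0 = 0" "\<beta> \<noteq> replicate (Suc m) 0" "cone_base m \<beta> \<in> S m"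
      using \<beta>C by (auto simp: C_def cone_part_def)
    then show ?thesis
    proof cases
      case zero
      have *: "replicate (Suc m) 0 \<in> Ops m 0" by (simp del: replicate_Suc)
      have "op_comp [0] (replicate (Suc m) 0) = replicate (Suc m) 0"
        by (rule nth_equalityI) (auto simp: op_comp_def nth_replicate simp del: replicate_Suc)
      then show ?thesis
        using degen_map[OF p x0, of m] simplicial_set_comp[OF Y * zero_Ops y] px0
        by (simp add: h_def zero degen_def del: replicate_Suc)
    next
      case pos
      have "map Suc (cone_base m \<beta>) = \<beta>"
      proof (rule Ops_eqI[OF map_Suc_Ops[OF cone_base_Ops[OF \<beta> nz_pos[OF pos(1)]]] \<beta>])
        fix i assume i: "i \<le> m"
        have "0 < \<beta> ! i" using Ops_mono[OF \<beta>, of 0 i] pos i by simp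
        then show "map Suc (cone_base m \<beta>) ! i = \<beta> ! i"
          using nth_cone_base_positive[OF \<beta> i] i by (simp add: cone_base_def del: upt_Suc)
      qed
      then show ?thesis using pos pw[OF pos(2)] nz_pos[OF pos(1), of m] by (simp add: h_def del: replicate_Suc)
    next
      case mixed
      then show ?thesis
        using simplicial_map_Act[OF p e_Ops[OF \<beta>] u[OF mixed(3)]] pu[OF mixed(3)] decomp[OF \<beta> mixed(2)]
          simplicial_set_comp[OF Y e_Ops[OF \<beta>] cone_op_Ops[OF cone_base_Ops[OF \<beta> mixed(2)]] y]
        by (simp add: h_def del: replicate_Suc)
    qed
  qed
  obtain k where k: "simplicial_map (std_simplex (Suc n)) X k" "\<And>m \<beta>. \<beta> \<in> C m \<Longrightarrow> k m \<beta> = h m \<beta>"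
    "\<And>m \<beta>. \<beta> \<in> Ops m (Suc n) \<Longrightarrow> p m (k m \<beta>) = Act Y (Suc n) \<beta> y"
    by (rule ext_liftE[OF lift[folded C_def] h yoneda_map[OF Y y] ph]) auto
  define z where "z = k (Suc n) (op_id (Suc n))"
  have kz: "k m \<beta> = Act X (Suc n) \<beta> z" if "\<beta> \<in> Ops m (Suc n)" for m \<beta>
    unfolding z_def by (rule simplicial_map_yoneda[OF k(1) that])
  show ?thesis
  proof (intro exI[of _ z] conjI allI ballI)
    show "z \<in> Simp X (Suc n)" unfolding z_def by (rule simplicial_map_Simp[OF k(1)]) simp
    show "p (Suc n) z = y" unfolding z_def using k(3)[OF op_id_Ops] simplicial_set_id[OF Y y] by simp
    show "Act X (Suc n) [0] z = x0"
    proof -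
      have "[0] \<in> C 0" by (simp add: C_def cone_part_def)
      then show ?thesis using k(2)[of "[0]" 0] kz[OF zero_Ops] degen_0[OF X x0] by (simp add: h_def)
    qed
    fix m \<alpha>
    show "Act X (Suc n) (map Suc \<alpha>) z = w m \<alpha>" if \<alpha>: "\<alpha> \<in> W m"
    proof -
      have \<alpha>O: "\<alpha> \<in> Ops m n" using \<alpha> W' by blast
      have nth: "map Suc \<alpha> ! i = Suc (\<alpha> ! i)" if "i \<le> m" for i using Ops_length[OF \<alpha>O] that by simp
      have s: "map Suc \<alpha> \<in> Ops m (Suc n)" using \<alpha>O by blast
      have pos: "map Suc \<alpha> ! 0 > 0" by (simp add: nth)
      have "cone_base m (map Suc \<alpha>) = \<alpha>"
        by (rule Ops_eqI[OF cone_base_Ops[OF s nz_pos[OF pos]] \<alpha>O]) (simp add: nth_cone_base_positive[OF s] nth)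
      moreover then have "map Suc \<alpha> \<in> C m" using s pos \<alpha> by (simp add: C_def cone_part_def)
      ultimately show ?thesis
        using k(2)[of "map Suc \<alpha>" m] kz[OF s] pos nz_pos[OF pos, of m] by (simp add: h_def del: replicate_Suc)
    qed
    show "Act X (Suc n) (cone_op \<alpha>) z = u m \<alpha>" if \<alpha>: "\<alpha> \<in> S m"
    proof -
      have \<alpha>O: "\<alpha> \<in> Ops m n" using \<alpha> S' by blast
      let ?\<beta> = "cone_op \<alpha>"
      have \<beta>: "?\<beta> \<in> Ops (Suc m) (Suc n)" using \<alpha>O by blast
      have \<beta>0: "?\<beta> ! 0 = 0" by (simp add: cone_op_def)
      have nz: "?\<beta> \<noteq> replicate (Suc (Suc m)) 0"
      proof
        assume "?\<beta> = replicate (Suc (Suc m)) 0"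
        then have "?\<beta> ! 1 = 0" by simp
        then show False using nth_cone_op[OF \<alpha>O, of 1] by simp
      qed
      \<comment> \<open>\<open>cone_base\<close> fills the place of the cone point in
        \<open>cone_op \<alpha>\<close> with the first vertex of \<open>\<alpha>\<close>, which is
        thereby repeated. Composition with \<open>e\<close> undoes the repetition, as
        \<open>es\<close> shows.\<close>
      define s where "s = mk_op (Suc m) (\<lambda>i. i - 1)"
      have s: "s \<in> Ops (Suc m) m" unfolding s_def by (rule mk_op_Ops) auto
      have \<alpha>s: "op_comp \<alpha> s \<in> S (Suc m)" using S'(2)[OF \<alpha> s] .
      have r: "(LEAST i. 0 < ?\<beta> ! i) = 1"
        by (rule Least_equality) (use nth_cone_op[OF \<alpha>O, of 1] \<beta>0 in \<open>auto simp: Suc_le_eq intro: gr0I\<close>)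
      have cb: "cone_base (Suc m) ?\<beta> = op_comp \<alpha> s"
      proof (rule Ops_eqI[OF cone_base_Ops[OF \<beta> nz], of _ n])
        show "op_comp \<alpha> s \<in> Ops (Suc m) n" using \<alpha>s S' by blast
        fix i assume i: "i \<le> Suc m"
        show "cone_base (Suc m) ?\<beta> ! i = op_comp \<alpha> s ! i"
          unfolding nth_cone_base[OF i] r nth_op_comp[OF s i]
          using nth_cone_op[OF \<alpha>O, of "max i 1"] i by (cases i) (auto simp: s_def max_def)
      qed
      have \<beta>C: "?\<beta> \<in> C (Suc m)" using \<beta> \<beta>0 nz cb \<alpha>s by (simp add: C_def cone_part_def)
      have es: "op_comp (cone_op s) (e (Suc m) ?\<beta>) = op_id (Suc m)"
      proof (rule Ops_eqI[OF op_comp_Ops[OF e_Ops[OF \<beta>] cone_op_Ops[OF s]] op_id_Ops])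
        fix i assume i: "i \<le> Suc m"
        have ei: "e (Suc m) ?\<beta> ! i = (if i = 0 then 0 else Suc i)"
          using i nth_cone_op[OF \<alpha>O i] by (simp add: e_def)
        show "op_comp (cone_op s) (e (Suc m) ?\<beta>) ! i = op_id (Suc m) ! i"
          unfolding nth_op_comp[OF e_Ops[OF \<beta>] i] ei nth_op_id[OF i]
          using i nth_cone_op[OF s] by (cases i) (auto simp: s_def)
      qed
      have "h (Suc m) ?\<beta> = Act X (Suc (Suc m)) (e (Suc m) ?\<beta>) (u (Suc m) (op_comp \<alpha> s))"
        using \<beta>0 nz cb by (simp add: h_def del: replicate_Suc)
      also have "\<dots> = u m \<alpha>"
        unfolding u_nat[OF \<alpha> s] using simplicial_set_comp[OF X e_Ops[OF \<beta>] cone_op_Ops[OF s] u[OF \<alpha>]] es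
          simplicial_set_id[OF X u[OF \<alpha>]] by simp
      finally show ?thesis using k(2)[OF \<beta>C] kz[OF \<beta>] by simp
    qed
  qed
qed

text \<open>Vertex \<open>j\<close> of the base is vertex \<open>Suc j\<close> of the cone, so
  missing a vertex of the base means missing a vertex other than 0. The 0-th face, which is the
  base, is the only one left out.\<close>

lemma cone_part_horn: "cone_part (bdry_ops n) (bdry_ops n) n = Simp (horn (Suc n) 0)"
proof (intro ext set_eqI)
  fix m \<beta>
  show "\<beta> \<in> cone_part (bdry_ops n) (bdry_ops n) n m \<longleftrightarrow> \<beta> \<in> Simp (horn (Suc n) 0) m"
  proof (cases "\<beta> \<in> Ops m (Suc n)")
    case \<beta>: True
    have ex: "(\<exists>j\<le>Suc n. j \<noteq> 0 \<and> j \<notin> set \<beta>) \<longleftrightarrow> (\<exists>j\<le>n. Suc j \<notin> set \<beta>)"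
      by (metis Suc_le_mono nat.distinct(1) not0_implies_Suc)
    show ?thesis
    proof (cases "\<beta> = replicate (Suc m) 0")
      case True
      then show ?thesis using \<beta> ex by (auto simp: cone_part_def horn_def simp del: replicate_Suc)
    next
      case False
      then show ?thesis
        using \<beta> ex set_cone_base[OF \<beta> False] cone_base_Ops[OF \<beta> False]
        by (auto simp: cone_part_def horn_def bdry_ops_def simp del: replicate_Suc)
    qed
  qed (auto simp: cone_part_def horn_def)
qed

text \<open>Adjoining the whole base supplies the face that the horn lacks: a simplex lies in the
  base iff it misses the cone point.\<close>

lemma cone_part_bdry: "cone_part (bdry_ops n) (\<lambda>m. Ops m n) n = bdry_ops (Suc n)"
proof (intro ext set_eqI)
  fix m \<beta>
  show "\<beta> \<in> cone_part (bdry_ops n) (\<lambda>m. Ops m n) n m \<longleftrightarrow> \<beta> \<in> bdry_ops (Suc n) m"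
  proof (cases "\<beta> \<in> Ops m (Suc n)")
    case \<beta>: True
    have ex: "(\<exists>j\<le>Suc n. j \<notin> set \<beta>) \<longleftrightarrow> 0 \<notin> set \<beta> \<or> (\<exists>j\<le>n. Suc j \<notin> set \<beta>)"
      by (metis Suc_le_mono le0 not0_implies_Suc)
    have zero: "0 \<in> set \<beta> \<longleftrightarrow> \<beta> ! 0 = 0"
      using Ops_mono[OF \<beta>, of 0] by (auto simp: Ops_set[OF \<beta>]) (metis le0 le_0_eq)
    show ?thesis
    proof (cases "\<beta> = replicate (Suc m) 0")
      case True
      then show ?thesis using \<beta> ex by (auto simp: cone_part_def bdry_ops_def simp del: replicate_Suc)
    next
      case False
      then show ?thesis
        using \<beta> ex zero set_cone_base[OF \<beta> False] cone_base_Ops[OF \<beta> False]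
        by (auto simp: cone_part_def bdry_ops_def simp del: replicate_Suc)
    qed
  qed (auto simp: cone_part_def bdry_ops_def)
qed

section \<open>Loop spaces as shifted simplicial sets\<close>

lemma zero_face_Act: "simplicial_set X \<Longrightarrow> z \<in> Simp X (Suc n) \<Longrightarrow> \<theta> \<in> Ops m n \<Longrightarrow>
    Act X (Suc m) (map Suc (op_id m)) (Act X (Suc n) (cone_op \<theta>) z) = Act X (Suc n) (map Suc \<theta>) z"
  by (subst simplicial_set_comp[where l = m and m = "Suc m" and n = "Suc n"])
    (auto simp: op_comp_cone_op_map_Suc[OF _ op_id_Ops])

lemma map_Suc_Act: "simplicial_set X \<Longrightarrow> z \<in> Simp X (Suc n) \<Longrightarrow> \<theta> \<in> Ops m n \<Longrightarrow>
    Act X n \<theta> (Act X (Suc n) (map Suc (op_id n)) z) = Act X (Suc n) (map Suc \<theta>) z"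
  by (subst simplicial_set_comp[where l = m and m = n and n = "Suc n"])
    (auto simp: op_comp_map_Suc[OF op_id_Ops])

lemma initial_vertex_Act: "simplicial_set X \<Longrightarrow> z \<in> Simp X (Suc n) \<Longrightarrow> \<theta> \<in> Ops m n \<Longrightarrow>
    Act X (Suc m) [0] (Act X (Suc n) (cone_op \<theta>) z) = Act X (Suc n) [0] z"
  by (subst simplicial_set_comp[where l = 0 and m = "Suc m" and n = "Suc n"])
    (auto simp: op_comp_cone_op_zero)

lemma degen_vertex: "simplicial_set X \<Longrightarrow> x \<in> Simp X 0 \<Longrightarrow> \<theta> \<in> Ops 0 n \<Longrightarrow> Act X n \<theta> (degen X n x) = x"
  using degen_Act[of X x \<theta> 0 n] degen_0[of X x] by simp

text \<open>Decalage: n-simplices are selected from the (n+1)-simplices of \<open>X\<close>, and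
  operators keep the initial vertex. Path spaces, loop spaces and the span between a fibre and a
  loop space have this shape, with varying \<open>S\<close>.\<close>

definition shift_sset :: "'a sset \<Rightarrow> (nat \<Rightarrow> 'a set) \<Rightarrow> 'a sset" where
  "shift_sset X S = \<lparr>Simp = S, Act = (\<lambda>n \<theta>. Act X (Suc n) (cone_op \<theta>))\<rparr>"

lemma shift_sset_simps [simp]:
  "Simp (shift_sset X S) = S" "Act (shift_sset X S) n \<theta> = Act X (Suc n) (cone_op \<theta>)"
  by (simp_all add: shift_sset_def)

lemma simplicial_set_shift:
  assumes X: "simplicial_set X" and S: "\<And>n. S n \<subseteq> Simp X (Suc n)"
    and cl: "\<And>m n \<theta> x. \<theta> \<in> Ops m n \<Longrightarrow> x \<in> S n \<Longrightarrow> Act X (Suc n) (cone_op \<theta>) x \<in> S m"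
  shows "simplicial_set (shift_sset X S)"
  unfolding simplicial_set_def
proof (intro conjI allI ballI)
  fix l m n \<phi> \<theta> x assume \<phi>: "\<phi> \<in> Ops l m" and \<theta>: "\<theta> \<in> Ops m n" and "x \<in> Simp (shift_sset X S) n"
  then have x: "x \<in> Simp X (Suc n)" using S by auto
  show "Act (shift_sset X S) n (op_comp \<theta> \<phi>) x = Act (shift_sset X S) m \<phi> (Act (shift_sset X S) n \<theta> x)"
    using simplicial_set_comp[OF X cone_op_Ops[OF \<phi>] cone_op_Ops[OF \<theta>] x] op_comp_cone_op[OF \<theta> \<phi>] by simp
next
  fix n x assume "x \<in> Simp (shift_sset X S) n"
  then show "Act (shift_sset X S) n (op_id n) x = x"
    using simplicial_set_id[OF X, of x "Suc n"] S by (auto simp: cone_op_id)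
qed (use cl in simp)

lemma bdry_ops_subset: "bdry_ops n m \<subseteq> Ops m n"
  by (auto simp: bdry_ops_def)

definition loops :: "'a sset \<Rightarrow> 'a \<Rightarrow> nat \<Rightarrow> 'a set" where
  "loops X x n = {z \<in> Simp X (Suc n). Act X (Suc n) [0] z = x \<and> Act X (Suc n) (map Suc (op_id n)) z = degen X n x}"

lemma loop_space_eq: "loop_space (X, x) = (shift_sset X (loops X x), degen X 1 x)"
  unfolding loop_space_def path_space_def path_end_def shift_sset_def cone_op_def loops_def face_zero fst_conv snd_conv
  by auto

lemma loops_Act:
  assumes X: "simplicial_set X" and x: "x \<in> Simp X 0" and \<theta>: "\<theta> \<in> Ops m n" and z: "z \<in> loops X x n"
  shows "Act X (Suc n) (cone_op \<theta>) z \<in> loops X x m"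
proof -
  have z': "z \<in> Simp X (Suc n)" "Act X (Suc n) [0] z = x" "Act X (Suc n) (map Suc (op_id n)) z = degen X n x"
    using z by (auto simp: loops_def)
  have "Act X (Suc n) (map Suc \<theta>) z = degen X m x"
    using map_Suc_Act[OF X z'(1) \<theta>] degen_Act[OF X x \<theta>] z'(3) by simp
  then show ?thesis
    using zero_face_Act[OF X z'(1) \<theta>] initial_vertex_Act[OF X z'(1) \<theta>] z'(2) simplicial_set_Act[OF X cone_op_Ops[OF \<theta>] z'(1)]
    by (simp add: loops_def)
qed

lemma simplicial_set_loops: "simplicial_set X \<Longrightarrow> x \<in> Simp X 0 \<Longrightarrow> simplicial_set (shift_sset X (loops X x))"
  by (rule simplicial_set_shift) (auto simp: loops_Act, auto simp: loops_def)

lemma degen_loops: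
  assumes X: "simplicial_set X" and x: "x \<in> Simp X 0"
  shows "degen X 1 x \<in> loops X x 0"
  using degen_Simp[OF X x, of 1] degen_vertex[OF X x, of "[0]" 1] degen_Act[OF X x map_Suc_Ops[OF op_id_Ops], of 0]
  by (simp add: loops_def)

text \<open>By the Yoneda lemma a lift on a simplex is a single (n+1)-simplex \<open>z\<close> of
  \<open>X\<close>, and this is the form in which \<open>cone_lift\<close> solves lifting
  problems.\<close>

lemma triv_fib_shiftI:
  assumes X: "simplicial_set (shift_sset X S)" and Y: "simplicial_set Y" and f: "simplicial_map (shift_sset X S) Y f"
    and lift: "\<And>n u y. simplicial_map (subsset (std_simplex n) (bdry_ops n)) (shift_sset X S) u \<Longrightarrow> y \<in> Simp Y n \<Longrightarrow>
      (\<And>m \<alpha>. \<alpha> \<in> bdry_ops n m \<Longrightarrow> f m (u m \<alpha>) = Act Y n \<alpha> y) \<Longrightarrow>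
      \<exists>z\<in>S n. f n z = y \<and> (\<forall>m. \<forall>\<alpha>\<in>bdry_ops n m. Act X (Suc n) (cone_op \<alpha>) z = u m \<alpha>)"
  shows "triv_fib (shift_sset X S) Y f"
  unfolding triv_fib_def
proof (intro conjI allI X Y f ext_liftI)
  fix n u v
  assume u: "simplicial_map (subsset (std_simplex n) (bdry_ops n)) (shift_sset X S) u"
    and v: "simplicial_map (std_simplex n) Y v"
    and uv: "\<And>m x. x \<in> bdry_ops n m \<Longrightarrow> f m (u m x) = v m x"
  define y where "y = v n (op_id n)"
  have v_eq: "v m \<alpha> = Act Y n \<alpha> y" if "\<alpha> \<in> Ops m n" for m \<alpha>
    unfolding y_def by (rule simplicial_map_yoneda[OF v that])
  have y: "y \<in> Simp Y n" unfolding y_def by (rule simplicial_map_Simp[OF v]) simp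
  have "\<exists>z\<in>S n. f n z = y \<and> (\<forall>m. \<forall>\<alpha>\<in>bdry_ops n m. Act X (Suc n) (cone_op \<alpha>) z = u m \<alpha>)"
    by (rule lift[OF u]) (use y uv v_eq in \<open>auto simp: bdry_ops_def\<close>)
  then obtain z where z: "z \<in> S n" "f n z = y" "\<And>m \<alpha>. \<alpha> \<in> bdry_ops n m \<Longrightarrow> Act X (Suc n) (cone_op \<alpha>) z = u m \<alpha>"
    by blast
  show "\<exists>h. simplicial_map (std_simplex n) (shift_sset X S) h \<and> (\<forall>m. \<forall>x\<in>bdry_ops n m. h m x = u m x) \<and>
      (\<forall>m. \<forall>x\<in>Simp (std_simplex n) m. f m (h m x) = v m x)"
  proof (intro exI conjI)
    show "simplicial_map (std_simplex n) (shift_sset X S) (\<lambda>m \<alpha>. Act (shift_sset X S) n \<alpha> z)"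
      by (rule yoneda_map[OF X]) (use z in simp)
    show "\<forall>m. \<forall>x\<in>Simp (std_simplex n) m. f m (Act (shift_sset X S) n x z) = v m x"
      using simplicial_map_Act[OF f, of _ _ n z] z v_eq by simp
  qed (use z(3) in simp)
qed

text \<open>Both spaces have simplices of the same type, so that \<open>equivclp\<close> can form
  zigzags. The map is hidden; only the base points have to be tracked for the formation of
  loops.\<close>

definition pointed_triv_fib :: "'a sset \<times> 'a \<Rightarrow> 'a sset \<times> 'a \<Rightarrow> bool" where
  "pointed_triv_fib P Q \<longleftrightarrow> (\<exists>f. triv_fib (fst P) (fst Q) f \<and> snd P \<in> Simp (fst P) 0 \<and> f 0 (snd P) = snd Q)"

lemma simplicial_map_zero_face:
  assumes X: "simplicial_set X" and S: "\<And>n. S n \<subseteq> Simp X (Suc n)"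
    and cl: "\<And>m n \<theta> x. \<theta> \<in> Ops m n \<Longrightarrow> x \<in> S n \<Longrightarrow> Act X (Suc n) (cone_op \<theta>) x \<in> S m"
  shows "simplicial_map (shift_sset X S) X (\<lambda>n z. Act X (Suc n) (map Suc (op_id n)) z)"
proof (rule simplicial_mapI)
  fix n z assume "z \<in> Simp (shift_sset X S) n"
  then have z: "z \<in> Simp X (Suc n)" using S by auto
  show "Act X (Suc n) (map Suc (op_id n)) z \<in> Simp X n"
    by (rule simplicial_set_Act[OF X _ z]) auto
  show "Act X (Suc m) (map Suc (op_id m)) (Act (shift_sset X S) n \<theta> z) = Act X n \<theta> (Act X (Suc n) (map Suc (op_id n)) z)"
    if "\<theta> \<in> Ops m n" for m \<theta>
    using zero_face_Act[OF X z that] map_Suc_Act[OF X z that] by simp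
qed

text \<open>A loop simplex with prescribed boundary is a simplex of \<open>K\<close> one dimension
  higher with its whole boundary prescribed, the 0-th face being constant at the base point. So
  lifting in dimension n+1 gives lifting for loops in dimension n.\<close>

lemma pointed_triv_fib_loop_space:
  assumes "pointed_triv_fib P Q"
  shows "pointed_triv_fib (loop_space P) (loop_space Q)"
proof -
  obtain K k L l where P: "P = (K, k)" and Q: "Q = (L, l)" by fastforce
  obtain f where f: "triv_fib K L f" and k: "k \<in> Simp K 0" and l: "f 0 k = l"
    using assms by (auto simp: pointed_triv_fib_def P Q)
  have K: "simplicial_set K" and L: "simplicial_set L" and fm: "simplicial_map K L f"
    using f by (auto simp: triv_fib_def)
  have l0: "l \<in> Simp L 0" using simplicial_map_Simp[OF fm k] l by simp
  let ?f = "\<lambda>n. f (Suc n)"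
  have fl: "f (Suc n) z \<in> loops L l n" if z: "z \<in> loops K k n" for n z
  proof -
    have z': "z \<in> Simp K (Suc n)" "Act K (Suc n) [0] z = k" "Act K (Suc n) (map Suc (op_id n)) z = degen K n k"
      using z by (auto simp: loops_def)
    then show ?thesis
      using simplicial_map_Simp[OF fm z'(1)] simplicial_map_Act[OF fm zero_Ops z'(1)]
        simplicial_map_Act[OF fm map_Suc_Ops[OF op_id_Ops] z'(1)] degen_map[OF fm k] l
      by (simp add: loops_def)
  qed
  have "triv_fib (shift_sset K (loops K k)) (shift_sset L (loops L l)) ?f"
  proof (rule triv_fib_shiftI)
    show "simplicial_set (shift_sset K (loops K k))" "simplicial_set (shift_sset L (loops L l))"
      by (intro simplicial_set_loops K L k l0)+
    show "simplicial_map (shift_sset K (loops K k)) (shift_sset L (loops L l)) ?f"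
      using fl simplicial_map_Act[OF fm] cone_op_Ops by (auto simp: simplicial_map_def loops_def)
    fix n u y
    assume u: "simplicial_map (subsset (std_simplex n) (bdry_ops n)) (shift_sset K (loops K k)) u"
      and y: "y \<in> Simp (shift_sset L (loops L l)) n"
      and uy: "\<And>m \<alpha>. \<alpha> \<in> bdry_ops n m \<Longrightarrow> f (Suc m) (u m \<alpha>) = Act (shift_sset L (loops L l)) n \<alpha> y"
    have uS: "u m \<alpha> \<in> loops K k m" if "\<alpha> \<in> bdry_ops n m" for m \<alpha>
      using simplicial_map_Simp[OF u] that by simp
    have uS': "u m \<alpha> \<in> Simp K (Suc m)" "Act K (Suc m) [0] (u m \<alpha>) = k" "Act K (Suc m) (map Suc (op_id m)) (u m \<alpha>) = degen K m k"
      if "\<alpha> \<in> bdry_ops n m" for m \<alpha>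
      using uS[OF that] by (simp_all add: loops_def)
    have y': "y \<in> Simp L (Suc n)" "Act L (Suc n) [0] y = l" "Act L (Suc n) (map Suc (op_id n)) y = degen L n l"
      using y by (auto simp: loops_def)
    have "\<exists>z. z \<in> Simp K (Suc n) \<and> f (Suc n) z = y \<and>
      (\<forall>m. \<forall>\<alpha>\<in>bdry_ops n m. Act K (Suc n) (cone_op \<alpha>) z = u m \<alpha>) \<and>
      (\<forall>m. \<forall>\<alpha>\<in>Ops m n. Act K (Suc n) (map Suc \<alpha>) z = degen K m k) \<and> Act K (Suc n) [0] z = k"
    proof (rule cone_lift[where X = K and Y = L and p = f and S = "bdry_ops n" and W = "\<lambda>m. Ops m n"
          and n = n and u = u and w = "\<lambda>m _. degen K m k" and ?x0.0 = k and y = y])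
      show "ext_lift (std_simplex (Suc n)) (cone_part (bdry_ops n) (\<lambda>m. Ops m n) n) K L f"
        using f by (simp add: cone_part_bdry triv_fib_def)
      show "subcomplex (std_simplex n) (\<lambda>m. Ops m n)" by (auto simp: subcomplex_def)
      show "u l (op_comp \<alpha> \<theta>) = Act K (Suc m) (cone_op \<theta>) (u m \<alpha>)" if "\<alpha> \<in> bdry_ops n m" "\<theta> \<in> Ops l m" for l m \<alpha> \<theta>
        using simplicial_map_Act[OF u that(2), of \<alpha>] that by simp
      show "simplicial_map (subsset (std_simplex n) (\<lambda>m. Ops m n)) K (\<lambda>m _. degen K m k)"
        using degen_Simp[OF K k] degen_Act[OF K k] by (simp add: simplicial_map_def)
      show "f m (degen K m k) = Act L (Suc n) (map Suc \<alpha>) y" if "\<alpha> \<in> Ops m n" for m \<alpha>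
        using degen_map[OF fm k] map_Suc_Act[OF L y'(1) that] y'(3) degen_Act[OF L l0 that] l by simp
      show "f (Suc m) (u m \<alpha>) = Act L (Suc n) (cone_op \<alpha>) y" if "\<alpha> \<in> bdry_ops n m" for m \<alpha>
        using uy[OF that] by simp
      show "f 0 k = Act L (Suc n) [0] y" using l y'(2) by simp
    qed (assumption | rule K L fm k y'(1) subcomplex_bdry_ops bdry_ops_subset uS')+
    then obtain z where "z \<in> Simp K (Suc n)" "f (Suc n) z = y"
      "\<And>m \<alpha>. \<alpha> \<in> bdry_ops n m \<Longrightarrow> Act K (Suc n) (cone_op \<alpha>) z = u m \<alpha>"
      "\<And>m \<alpha>. \<alpha> \<in> Ops m n \<Longrightarrow> Act K (Suc n) (map Suc \<alpha>) z = degen K m k"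
      "Act K (Suc n) [0] z = k" by blast
    then show "\<exists>z\<in>loops K k n. f (Suc n) z = y \<and> (\<forall>m. \<forall>\<alpha>\<in>bdry_ops n m. Act K (Suc n) (cone_op \<alpha>) z = u m \<alpha>)"
      by (intro bexI[of _ z]) (auto simp: loops_def)
  qed
  moreover have "f (Suc 0) (degen K 1 k) = degen L 1 l"
    using degen_map[OF fm k, of 1] l by simp
  ultimately show ?thesis
    using degen_loops[OF K k] by (auto simp: pointed_triv_fib_def P Q loop_space_eq)
qed

text \<open>The span consists of the paths in \<open>E\<close> that start at \<open>e\<close> and are sent to loops in \<open>B\<close>; it maps to
  the fibre by the end point and to the loop space by \<open>p\<close>.\<close>

lemma fibre_loop_space:
  assumes E: "simplicial_set E" and B: "simplicial_set B" and p: "simplicial_map E B p"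
    and horn: "\<And>n. ext_lift (std_simplex (Suc n)) (Simp (horn (Suc n) 0)) E B p"
    and contr: "triv_fib E (std_simplex 0) (\<lambda>m _. replicate (Suc m) 0)"
    and e: "e \<in> Simp E 0" and b: "p 0 e = b"
  shows "\<exists>G. pointed_triv_fib G (subsset E (\<lambda>n. {x \<in> Simp E n. p n x = degen B n b}), e) \<and>
    pointed_triv_fib G (loop_space (B, b))"
proof -
  let ?d = "\<lambda>n z. Act E (Suc n) (map Suc (op_id n)) z"
  define F where "F n = {x \<in> Simp E n. p n x = degen B n b}" for n
  define S where "S n = {z \<in> Simp E (Suc n). Act E (Suc n) [0] z = e \<and> p n (?d n z) = degen B n b}" for n
  have b0: "b \<in> Simp B 0" using simplicial_map_Simp[OF p e] b by simp
  have SE: "S n \<subseteq> Simp E (Suc n)" for n by (auto simp: S_def)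
  have dE: "?d n z \<in> Simp E n" if "z \<in> Simp E (Suc n)" for n z
    by (rule simplicial_set_Act[OF E _ that]) auto
  have S_Act: "Act E (Suc n) (cone_op \<theta>) z \<in> S m" if "\<theta> \<in> Ops m n" "z \<in> S n" for m n \<theta> z
  proof -
    have z: "z \<in> Simp E (Suc n)" "Act E (Suc n) [0] z = e" "p n (?d n z) = degen B n b"
      using that by (auto simp: S_def)
    have "p m (Act E (Suc n) (map Suc \<theta>) z) = degen B m b"
      using map_Suc_Act[OF E z(1) that(1)] simplicial_map_Act[OF p that(1) dE[OF z(1)]] z(3) degen_Act[OF B b0 that(1)]
      by simp
    then show ?thesis
      using zero_face_Act[OF E z(1) that(1)] initial_vertex_Act[OF E z(1) that(1)] z(2)
        simplicial_set_Act[OF E cone_op_Ops[OF that(1)] z(1)] by (simp add: S_def)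
  qed
  have G: "simplicial_set (shift_sset E S)" by (rule simplicial_set_shift[OF E SE S_Act])
  have F: "subcomplex E F"
    using simplicial_set_Act[OF E] simplicial_map_Act[OF p] degen_Act[OF B b0] by (auto simp: subcomplex_def F_def)
  have e1: "degen E 1 e \<in> S 0"
    using degen_Simp[OF E e, of 1] degen_vertex[OF E e, of "[0]" 1] degen_Act[OF E e map_Suc_Ops[OF op_id_Ops], of 0]
      degen_0[OF E e] b degen_0[OF B b0] by (simp add: S_def)
  have d_e1: "?d 0 (degen E 1 e) = e"
    using degen_Act[OF E e map_Suc_Ops[OF op_id_Ops], of 0] degen_0[OF E e] by simp
  have u_data: "u m \<alpha> \<in> Simp E (Suc m)" "Act E (Suc m) [0] (u m \<alpha>) = e" "p m (?d m (u m \<alpha>)) = degen B m b"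
    "\<And>l \<theta>. \<theta> \<in> Ops l m \<Longrightarrow> u l (op_comp \<alpha> \<theta>) = Act E (Suc m) (cone_op \<theta>) (u m \<alpha>)"
    if u: "simplicial_map (subsset (std_simplex n) (bdry_ops n)) (shift_sset E S) u" and \<alpha>: "\<alpha> \<in> bdry_ops n m"
    for n u m \<alpha>
    using simplicial_map_Simp[OF u, of \<alpha> m] simplicial_map_Act[OF u, of _ _ m \<alpha>] \<alpha> by (auto simp: S_def)
  \<comment> \<open>With the end \<open>y\<close> prescribed, the whole boundary of \<open>z\<close>
    is given, and contractibility of \<open>E\<close> provides the filler.\<close>
  have 1: "triv_fib (shift_sset E S) (subsset E F) ?d"
  proof (rule triv_fib_shiftI[OF G simplicial_set_subsset[OF E F]])
    show "simplicial_map (shift_sset E S) (subsset E F) ?d"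
      using simplicial_map_zero_face[OF E SE S_Act] dE by (auto simp: simplicial_map_def F_def S_def)
    fix n u y
    assume u: "simplicial_map (subsset (std_simplex n) (bdry_ops n)) (shift_sset E S) u"
      and y: "y \<in> Simp (subsset E F) n"
      and uy: "\<And>m \<alpha>. \<alpha> \<in> bdry_ops n m \<Longrightarrow> ?d m (u m \<alpha>) = Act (subsset E F) n \<alpha> y"
    note u' = u_data[OF u]
    have y': "y \<in> Simp E n" "p n y = degen B n b" using y by (auto simp: F_def)
    \<comment> \<open>The trivial equation is the condition \<open>p (Suc n) z = y\<close> of
      \<open>cone_lift\<close> for the map to a point.\<close>
    have "\<exists>z. z \<in> Simp E (Suc n) \<and> replicate (Suc (Suc n)) 0 = replicate (Suc (Suc n)) (0::nat) \<and>
      (\<forall>m. \<forall>\<alpha>\<in>bdry_ops n m. Act E (Suc n) (cone_op \<alpha>) z = u m \<alpha>) \<and>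
      (\<forall>m. \<forall>\<alpha>\<in>Ops m n. Act E (Suc n) (map Suc \<alpha>) z = Act E n \<alpha> y) \<and> Act E (Suc n) [0] z = e"
    proof (rule cone_lift[where X = E and Y = "std_simplex 0" and p = "\<lambda>m _. replicate (Suc m) 0" and S = "bdry_ops n"
          and W = "\<lambda>m. Ops m n" and n = n and u = u and w = "\<lambda>m \<alpha>. Act E n \<alpha> y" and ?x0.0 = e and y = "replicate (Suc (Suc n)) 0"])
      show "ext_lift (std_simplex (Suc n)) (cone_part (bdry_ops n) (\<lambda>m. Ops m n) n) E (std_simplex 0) (\<lambda>m _. replicate (Suc m) 0)"
        using contr by (simp add: cone_part_bdry triv_fib_def)
      show "simplicial_map E (std_simplex 0) (\<lambda>m _. replicate (Suc m) 0)" using contr by (simp add: triv_fib_def)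
      show "subcomplex (std_simplex n) (\<lambda>m. Ops m n)" by (auto simp: subcomplex_def)
      show "simplicial_map (subsset (std_simplex n) (\<lambda>m. Ops m n)) E (\<lambda>m \<alpha>. Act E n \<alpha> y)"
        using yoneda_map[OF E y'(1)] by (simp add: simplicial_map_def)
      show "?d m (u m \<alpha>) = Act E n \<alpha> y" if "\<alpha> \<in> bdry_ops n m" for m \<alpha>
        using uy[OF that] by simp
      show "replicate (Suc (Suc m)) 0 = Act (std_simplex 0) (Suc n) (cone_op \<alpha>) (replicate (Suc (Suc n)) 0)"
        if "\<alpha> \<in> bdry_ops n m" for m \<alpha>
        using op_comp_replicate[OF cone_op_Ops, of \<alpha> m n 0] that by (simp add: bdry_ops_def del: replicate_Suc)
      show "replicate (Suc m) 0 = Act (std_simplex 0) (Suc n) (map Suc \<alpha>) (replicate (Suc (Suc n)) 0)"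
        if "\<alpha> \<in> Ops m n" for m \<alpha>
        using op_comp_replicate[OF map_Suc_Ops[OF that], of 0] by (simp del: replicate_Suc)
      show "replicate (Suc 0) 0 = Act (std_simplex 0) (Suc n) [0] (replicate (Suc (Suc n)) 0)"
        using op_comp_replicate[OF zero_Ops, of "Suc n" 0] by (simp del: replicate_Suc)
      show "replicate (Suc (Suc n)) 0 \<in> Simp (std_simplex 0) (Suc n)" by (simp del: replicate_Suc)
    qed (assumption | rule E e simplicial_set_std_simplex subcomplex_bdry_ops bdry_ops_subset u')+
    then obtain z where z: "z \<in> Simp E (Suc n)" "\<And>m \<alpha>. \<alpha> \<in> bdry_ops n m \<Longrightarrow> Act E (Suc n) (cone_op \<alpha>) z = u m \<alpha>"
      "\<And>m \<alpha>. \<alpha> \<in> Ops m n \<Longrightarrow> Act E (Suc n) (map Suc \<alpha>) z = Act E n \<alpha> y"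
      "Act E (Suc n) [0] z = e" by blast
    have "?d n z = y" using z(3)[OF op_id_Ops] simplicial_set_id[OF E y'(1)] by simp
    then show "\<exists>z\<in>S n. ?d n z = y \<and> (\<forall>m. \<forall>\<alpha>\<in>bdry_ops n m. Act E (Suc n) (cone_op \<alpha>) z = u m \<alpha>)"
      using z y' by (intro bexI[of _ z]) (auto simp: S_def)
  qed
  \<comment> \<open>Here the end of the path is free in \<open>E\<close> and only its boundary is
    known, from \<open>u\<close>. So \<open>z\<close> is prescribed on a horn, and it has to be
    lifted over the given loop \<open>y\<close>.\<close>
  have 2: "triv_fib (shift_sset E S) (shift_sset B (loops B b)) (\<lambda>n. p (Suc n))"
  proof (rule triv_fib_shiftI[OF G simplicial_set_loops[OF B b0]])
    have "p (Suc n) z \<in> loops B b n" if "z \<in> S n" for n z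
    proof -
      have z: "z \<in> Simp E (Suc n)" "Act E (Suc n) [0] z = e" "p n (?d n z) = degen B n b"
        using that by (auto simp: S_def)
      then show ?thesis
        using simplicial_map_Simp[OF p z(1)] simplicial_map_Act[OF p zero_Ops z(1)]
          simplicial_map_Act[OF p map_Suc_Ops[OF op_id_Ops] z(1)] b by (simp add: loops_def)
    qed
    then show "simplicial_map (shift_sset E S) (shift_sset B (loops B b)) (\<lambda>n. p (Suc n))"
      using simplicial_map_Act[OF p cone_op_Ops] subsetD[OF SE] by (simp add: simplicial_map_def)
    fix n u y
    assume u: "simplicial_map (subsset (std_simplex n) (bdry_ops n)) (shift_sset E S) u"
      and y: "y \<in> Simp (shift_sset B (loops B b)) n"
      and uy: "\<And>m \<alpha>. \<alpha> \<in> bdry_ops n m \<Longrightarrow> p (Suc m) (u m \<alpha>) = Act (shift_sset B (loops B b)) n \<alpha> y"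
    note u' = u_data[OF u]
    have y': "y \<in> Simp B (Suc n)" "Act B (Suc n) [0] y = b" "Act B (Suc n) (map Suc (op_id n)) y = degen B n b"
      using y by (auto simp: loops_def)
    have "\<exists>z. z \<in> Simp E (Suc n) \<and> p (Suc n) z = y \<and>
      (\<forall>m. \<forall>\<alpha>\<in>bdry_ops n m. Act E (Suc n) (cone_op \<alpha>) z = u m \<alpha>) \<and>
      (\<forall>m. \<forall>\<alpha>\<in>bdry_ops n m. Act E (Suc n) (map Suc \<alpha>) z = ?d m (u m \<alpha>)) \<and> Act E (Suc n) [0] z = e"
    proof (rule cone_lift[where X = E and Y = B and p = p and S = "bdry_ops n" and W = "bdry_ops n"
          and n = n and u = u and w = "\<lambda>m \<alpha>. ?d m (u m \<alpha>)" and ?x0.0 = e and y = y])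
      show "ext_lift (std_simplex (Suc n)) (cone_part (bdry_ops n) (bdry_ops n) n) E B p"
        using horn by (simp add: cone_part_horn)
      show "simplicial_map (subsset (std_simplex n) (bdry_ops n)) E (\<lambda>m \<alpha>. ?d m (u m \<alpha>))"
        by (rule simplicial_map_comp[OF u simplicial_map_zero_face[OF E SE S_Act]])
      show "p m (?d m (u m \<alpha>)) = Act B (Suc n) (map Suc \<alpha>) y" if "\<alpha> \<in> bdry_ops n m" for m \<alpha>
      proof -
        have "\<alpha> \<in> Ops m n" using that by (simp add: bdry_ops_def)
        then show ?thesis using u'(3)[OF that] map_Suc_Act[OF B y'(1)] y'(3) degen_Act[OF B b0] by metis
      qed
      show "p (Suc m) (u m \<alpha>) = Act B (Suc n) (cone_op \<alpha>) y" if "\<alpha> \<in> bdry_ops n m" for m \<alpha>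
        using uy[OF that] by simp
      show "p 0 e = Act B (Suc n) [0] y" using b y'(2) by simp
    qed (assumption | rule E B p e y'(1) subcomplex_bdry_ops order_refl refl u')+
    then obtain z where z: "z \<in> Simp E (Suc n)" "p (Suc n) z = y"
      "\<And>m \<alpha>. \<alpha> \<in> bdry_ops n m \<Longrightarrow> Act E (Suc n) (cone_op \<alpha>) z = u m \<alpha>"
      "Act E (Suc n) [0] z = e" by blast
    have "p n (?d n z) = degen B n b"
      using simplicial_map_Act[OF p map_Suc_Ops[OF op_id_Ops] z(1)] z(2) y'(3) by simp
    then show "\<exists>z\<in>S n. p (Suc n) z = y \<and> (\<forall>m. \<forall>\<alpha>\<in>bdry_ops n m. Act E (Suc n) (cone_op \<alpha>) z = u m \<alpha>)"
      using z by (intro bexI[of _ z]) (auto simp: S_def)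
  qed
  have "F = (\<lambda>n. {x \<in> Simp E n. p n x = degen B n b})" by (simp add: F_def fun_eq_iff)
  moreover have "p (Suc 0) (degen E 1 e) = degen B 1 b" using degen_map[OF p e, of 1] b by simp
  ultimately show ?thesis
    using 1 2 e1 d_e1 by (intro exI[of _ "(shift_sset E S, degen E 1 e)"]) (auto simp: pointed_triv_fib_def loop_space_eq)
qed

section \<open>Simplicial model categories\<close>

lemma ucat_simps [simp]:
  "Obj (ucat M) = SObj M" "Hom (ucat M) X Y = Simp (SMap M X Y) 0"
  "Cmp (ucat M) X Y Z = SCmp M X Y Z 0" "Ide (ucat M) = SIde M"
  by (simp_all add: ucat_def)

text \<open>Tensors and cotensors are provided for simplicial sets with simplices in the parameter
  type; the injection places copies of all standard simplices there.\<close>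

lemma inj_nat_list_infinite:
  assumes "infinite (UNIV :: 'k set)"
  obtains e :: "nat list \<Rightarrow> 'k" where "inj e"
proof -
  obtain f :: "nat \<Rightarrow> 'k" where "inj f"
    using infinite_countable_subset[OF assms] by blast
  then have "inj (f \<circ> list_encode)" by (rule inj_compose[OF _ inj_list_encode])
  then show ?thesis by (rule that)
qed

text \<open>The Yoneda lemma for vertices of the function complex, evaluating at the top simplex;
  the extra factor \<open>std_simplex 0\<close> has one simplex in each degree. Injectivity relies
  on the normal form given by \<open>cut\<close>.\<close>

lemma fun_complex_yoneda:
  assumes e: "inj e" and L: "simplicial_set L"
  shows "bij_betw (\<lambda>h. h n (e (op_id n), replicate (Suc n) 0)) (Simp (fun_complex (relabel e (std_simplex n)) L) 0) (Simp L n)"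
proof -
  let ?K = "relabel e (std_simplex n)" and ?P = "sset_prod (relabel e (std_simplex n)) (std_simplex 0)"
  have S: "Simp (fun_complex ?K L) 0 = {h. simplicial_map ?P L h \<and> h = cut ?P h}"
    by (simp only: fun_complex_def sset.select_convs)
  have memD: "simplicial_map ?P L h" "h = cut ?P h" if "h \<in> Simp (fun_complex ?K L) 0" for h
    using that unfolding S mem_Collect_eq by (rule conjunct1, rule conjunct2)
  have rep: "\<theta> = replicate (Suc m) 0" if "\<theta> \<in> Ops m 0" for \<theta> m
    using Ops_0_target that .
  have eval: "h m (e \<alpha>, replicate (Suc m) 0) = Act L n \<alpha> (h n (e (op_id n), replicate (Suc n) 0))"
    if h: "simplicial_map ?P L h" and \<alpha>: "\<alpha> \<in> Ops m n" for h m \<alpha>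
  proof -
    have "(e (op_id n), replicate (Suc n) 0) \<in> Simp ?P n"
      unfolding sset_prod_simps relabel_simps std_simplex_simps by (intro SigmaI imageI op_id_Ops) (simp del: replicate_Suc)
    moreover have "Act ?P n \<alpha> (e (op_id n), replicate (Suc n) 0) = (e \<alpha>, replicate (Suc m) 0)"
      unfolding sset_prod_simps relabel_simps std_simplex_simps fst_conv snd_conv inv_f_f[OF e] op_comp_id_left[OF \<alpha>]
        op_comp_replicate[OF \<alpha>] by (rule refl)
    ultimately show ?thesis using simplicial_map_Act[OF h \<alpha>] by metis
  qed
  show ?thesis
    unfolding bij_betw_def
  proof (intro conjI inj_onI equalityI subsetI)
    fix h h' assume hs: "h \<in> Simp (fun_complex ?K L) 0" "h' \<in> Simp (fun_complex ?K L) 0"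
      and eq: "h n (e (op_id n), replicate (Suc n) 0) = h' n (e (op_id n), replicate (Suc n) 0)"
    note sm = memD(1)[OF hs(1)] memD(1)[OF hs(2)] and c = memD(2)[OF hs(1)] memD(2)[OF hs(2)]
    have "cut ?P h m z = cut ?P h' m z" for m z
    proof (cases "z \<in> Simp ?P m")
      case True
      then obtain \<alpha> \<tau> where \<alpha>: "\<alpha> \<in> Ops m n" and \<tau>: "\<tau> \<in> Ops m 0" and z: "z = (e \<alpha>, \<tau>)" by auto
      have "h m z = h' m z"
        unfolding z rep[OF \<tau>] eval[OF sm(1) \<alpha>] eval[OF sm(2) \<alpha>] eq by (rule refl)
      then show ?thesis by (simp add: cut_def)
    qed (auto simp: cut_def)
    then have "cut ?P h = cut ?P h'" by blast
    then show "h = h'" by (rule trans[OF c(1) trans[OF _ c(2)[symmetric]]])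
  next
    fix x assume "x \<in> (\<lambda>h. h n (e (op_id n), replicate (Suc n) 0)) ` Simp (fun_complex ?K L) 0"
    then obtain h where "h \<in> Simp (fun_complex ?K L) 0" "x = h n (e (op_id n), replicate (Suc n) 0)" by blast
    then show "x \<in> Simp L n"
      using memD(1) simplicial_map_Simp[of ?P L h "(e (op_id n), replicate (Suc n) 0)" n] by (simp del: replicate_Suc)
  next
    fix x assume x: "x \<in> Simp L n"
    define h where "h = cut ?P (\<lambda>m z. Act L n (inv e (fst z)) x)"
    have "simplicial_map ?P L h"
    proof (rule simplicial_mapI)
      fix m z assume z: "z \<in> Simp ?P m"
      then obtain \<alpha> \<tau> where \<alpha>: "\<alpha> \<in> Ops m n" "z = (e \<alpha>, \<tau>)" by auto
      then show "h m z \<in> Simp L m" using z e simplicial_set_Act[OF L \<alpha>(1) x] by (simp add: h_def cut_def)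
      fix l \<theta> assume \<theta>: "\<theta> \<in> Ops l m"
      have "Act ?P m \<theta> z \<in> Simp ?P l" using z \<theta> \<alpha> e by auto
      then show "h l (Act ?P m \<theta> z) = Act L m \<theta> (h m z)"
        using z e simplicial_set_comp[OF L \<theta> \<alpha>(1) x] \<alpha> by (simp add: h_def cut_def)
    qed
    moreover have "cut ?P h = h" by (simp add: h_def cut_def fun_eq_iff)
    ultimately have hS: "h \<in> Simp (fun_complex ?K L) 0" unfolding S mem_Collect_eq by (metis (no_types))
    have "h n (e (op_id n), replicate (Suc n) 0) = x"
      using e simplicial_set_id[OF L x] by (simp add: h_def cut_def del: replicate_Suc)
    then show "x \<in> (\<lambda>h. h n (e (op_id n), replicate (Suc n) 0)) ` Simp (fun_complex ?K L) 0"
      by (intro rev_image_eqI[OF hS]) (rule sym)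
  qed
qed

locale scat =
  fixes M :: "('o, 's) smcat"
  assumes scat: "simplicial_category M"
begin

lemma SMap_sset [simp]: "X \<in> SObj M \<Longrightarrow> Y \<in> SObj M \<Longrightarrow> simplicial_set (SMap M X Y)"
  using scat by (simp add: simplicial_category_def)

lemma SIde_hom [simp]: "X \<in> SObj M \<Longrightarrow> SIde M X \<in> Simp (SMap M X X) 0"
  using scat by (simp add: simplicial_category_def)

lemma SCmp_map: "X \<in> SObj M \<Longrightarrow> Y \<in> SObj M \<Longrightarrow> Z \<in> SObj M \<Longrightarrow>
    simplicial_map (sset_prod (SMap M Y Z) (SMap M X Y)) (SMap M X Z) (\<lambda>n z. SCmp M X Y Z n (fst z) (snd z))"
  using scat by (simp add: simplicial_category_def)

lemma SCmp_Simp [simp]: "X \<in> SObj M \<Longrightarrow> Y \<in> SObj M \<Longrightarrow> Z \<in> SObj M \<Longrightarrow>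
    f \<in> Simp (SMap M X Y) n \<Longrightarrow> g \<in> Simp (SMap M Y Z) n \<Longrightarrow> SCmp M X Y Z n g f \<in> Simp (SMap M X Z) n"
  using simplicial_map_Simp[OF SCmp_map, of X Y Z "(g, f)" n] by simp

lemma SCmp_Act: "X \<in> SObj M \<Longrightarrow> Y \<in> SObj M \<Longrightarrow> Z \<in> SObj M \<Longrightarrow>
    f \<in> Simp (SMap M X Y) n \<Longrightarrow> g \<in> Simp (SMap M Y Z) n \<Longrightarrow> \<theta> \<in> Ops m n \<Longrightarrow>
    SCmp M X Y Z m (Act (SMap M Y Z) n \<theta> g) (Act (SMap M X Y) n \<theta> f) = Act (SMap M X Z) n \<theta> (SCmp M X Y Z n g f)"
  using simplicial_map_Act[OF SCmp_map, of X Y Z \<theta> m n "(g, f)"] by simp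

lemma SCmp_degen: "X \<in> SObj M \<Longrightarrow> Y \<in> SObj M \<Longrightarrow> Z \<in> SObj M \<Longrightarrow>
    f \<in> Simp (SMap M X Y) 0 \<Longrightarrow> g \<in> Simp (SMap M Y Z) 0 \<Longrightarrow>
    SCmp M X Y Z n (degen (SMap M Y Z) n g) (degen (SMap M X Y) n f) = degen (SMap M X Z) n (SCmp M X Y Z 0 g f)"
  unfolding degen_def by (rule SCmp_Act) (simp_all del: replicate_Suc)

lemma SCmp_id: "X \<in> SObj M \<Longrightarrow> Y \<in> SObj M \<Longrightarrow> f \<in> Simp (SMap M X Y) n \<Longrightarrow>
    SCmp M X X Y n f (degen (SMap M X X) n (SIde M X)) = f \<and> SCmp M X Y Y n (degen (SMap M Y Y) n (SIde M Y)) f = f"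
  using scat by (simp add: simplicial_category_def)

lemma id_right [simp]: "X \<in> SObj M \<Longrightarrow> Y \<in> SObj M \<Longrightarrow> f \<in> Simp (SMap M X Y) 0 \<Longrightarrow> SCmp M X X Y 0 f (SIde M X) = f"
  using SCmp_id[of X Y f 0] by (simp add: degen_0)

lemma id_left [simp]: "X \<in> SObj M \<Longrightarrow> Y \<in> SObj M \<Longrightarrow> f \<in> Simp (SMap M X Y) 0 \<Longrightarrow> SCmp M X Y Y 0 (SIde M Y) f = f"
  using SCmp_id[of X Y f 0] by (simp add: degen_0)

lemma SCmp_assoc: "W \<in> SObj M \<Longrightarrow> X \<in> SObj M \<Longrightarrow> Y \<in> SObj M \<Longrightarrow> Z \<in> SObj M \<Longrightarrow>
    f \<in> Simp (SMap M W X) n \<Longrightarrow> g \<in> Simp (SMap M X Y) n \<Longrightarrow> h \<in> Simp (SMap M Y Z) n \<Longrightarrow>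
    SCmp M W X Z n (SCmp M X Y Z n h g) f = SCmp M W Y Z n h (SCmp M W X Y n g f)"
  using scat by (simp add: simplicial_category_def)

lemma degen_hom [simp]: "X \<in> SObj M \<Longrightarrow> Y \<in> SObj M \<Longrightarrow> f \<in> Simp (SMap M X Y) 0 \<Longrightarrow>
    degen (SMap M X Y) n f \<in> Simp (SMap M X Y) n"
  by (simp add: degen_Simp)

lemma degen_hom_0 [simp]: "X \<in> SObj M \<Longrightarrow> Y \<in> SObj M \<Longrightarrow> f \<in> Simp (SMap M X Y) 0 \<Longrightarrow>
    degen (SMap M X Y) 0 f = f"
  by (simp add: degen_0)

lemma precomp_map: "A \<in> SObj M \<Longrightarrow> B \<in> SObj M \<Longrightarrow> X \<in> SObj M \<Longrightarrow> i \<in> Simp (SMap M A B) 0 \<Longrightarrow>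
    simplicial_map (SMap M B X) (SMap M A X) (precomp M A B X i)"
  unfolding precomp_def
  by (rule simplicial_mapI) (simp_all add: degen_Act flip: SCmp_Act[where X = A and Y = B])

lemma precomp_Simp [simp]: "A \<in> SObj M \<Longrightarrow> B \<in> SObj M \<Longrightarrow> X \<in> SObj M \<Longrightarrow> i \<in> Simp (SMap M A B) 0 \<Longrightarrow>
    f \<in> Simp (SMap M B X) n \<Longrightarrow> precomp M A B X i n f \<in> Simp (SMap M A X) n"
  by (simp add: precomp_def)

lemma postcomp_map: "A \<in> SObj M \<Longrightarrow> X \<in> SObj M \<Longrightarrow> Y \<in> SObj M \<Longrightarrow> p \<in> Simp (SMap M X Y) 0 \<Longrightarrow>
    simplicial_map (SMap M A X) (SMap M A Y) (postcomp M A X Y p)"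
  unfolding postcomp_def
  by (rule simplicial_mapI) (simp_all add: degen_Act flip: SCmp_Act[where X = A and Y = X])

lemma postcomp_Simp [simp]: "A \<in> SObj M \<Longrightarrow> X \<in> SObj M \<Longrightarrow> Y \<in> SObj M \<Longrightarrow> p \<in> Simp (SMap M X Y) 0 \<Longrightarrow>
    f \<in> Simp (SMap M A X) n \<Longrightarrow> postcomp M A X Y p n f \<in> Simp (SMap M A Y) n"
  by (simp add: postcomp_def)

lemma precomp_degen: "A \<in> SObj M \<Longrightarrow> B \<in> SObj M \<Longrightarrow> X \<in> SObj M \<Longrightarrow> i \<in> Simp (SMap M A B) 0 \<Longrightarrow>
    f \<in> Simp (SMap M B X) 0 \<Longrightarrow>
    precomp M A B X i n (degen (SMap M B X) n f) = degen (SMap M A X) n (SCmp M A B X 0 f i)"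
  by (simp add: precomp_def SCmp_degen)

lemma precomp_0: "A \<in> SObj M \<Longrightarrow> B \<in> SObj M \<Longrightarrow> i \<in> Simp (SMap M A B) 0 \<Longrightarrow>
    precomp M A B X i 0 f = SCmp M A B X 0 f i"
  by (simp add: precomp_def)

lemma postcomp_degen: "A \<in> SObj M \<Longrightarrow> X \<in> SObj M \<Longrightarrow> Y \<in> SObj M \<Longrightarrow> p \<in> Simp (SMap M X Y) 0 \<Longrightarrow>
    f \<in> Simp (SMap M A X) 0 \<Longrightarrow>
    postcomp M A X Y p n (degen (SMap M A X) n f) = degen (SMap M A Y) n (SCmp M A X Y 0 p f)"
  by (simp add: postcomp_def SCmp_degen)

lemma postcomp_0: "X \<in> SObj M \<Longrightarrow> Y \<in> SObj M \<Longrightarrow> p \<in> Simp (SMap M X Y) 0 \<Longrightarrow>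
    postcomp M A X Y p 0 f = SCmp M A X Y 0 p f"
  by (simp add: postcomp_def)

lemma precomp_precomp: "A \<in> SObj M \<Longrightarrow> B \<in> SObj M \<Longrightarrow> C \<in> SObj M \<Longrightarrow> X \<in> SObj M \<Longrightarrow>
    i \<in> Simp (SMap M A B) 0 \<Longrightarrow> j \<in> Simp (SMap M B C) 0 \<Longrightarrow> f \<in> Simp (SMap M C X) n \<Longrightarrow>
    precomp M A B X i n (precomp M B C X j n f) = precomp M A C X (SCmp M A B C 0 j i) n f"
  by (simp add: precomp_def SCmp_assoc SCmp_degen)

lemma postcomp_precomp: "A \<in> SObj M \<Longrightarrow> B \<in> SObj M \<Longrightarrow> X \<in> SObj M \<Longrightarrow> Y \<in> SObj M \<Longrightarrow>
    i \<in> Simp (SMap M A B) 0 \<Longrightarrow> p \<in> Simp (SMap M X Y) 0 \<Longrightarrow> f \<in> Simp (SMap M B X) n \<Longrightarrow>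
    postcomp M A X Y p n (precomp M A B X i n f) = precomp M A B Y i n (postcomp M B X Y p n f)"
  by (simp add: precomp_def postcomp_def SCmp_assoc)

text \<open>Morphisms out of the tensor of \<open>A\<close> with a simplex classify the n-simplices
  of \<open>SMap M A Y\<close>: the bijection evaluates at the universal n-simplex, the image of
  \<open>op_id n\<close> under the unit.\<close>

lemma tensor_simplex:
  fixes K :: "nat list \<Rightarrow> 'k"
  assumes e: "inj e" and A: "A \<in> SObj M" and T: "is_tensor M A (relabel e (std_simplex n)) T \<eta>" and Y: "Y \<in> SObj M"
  shows "bij_betw (\<lambda>f. SCmp M A T Y n (degen (SMap M T Y) n f) (\<eta> n (e (op_id n)))) (Simp (SMap M T Y) 0) (Simp (SMap M A Y) n)"
proof -
  let ?K = "relabel e (std_simplex n)"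
  let ?\<Phi> = "\<lambda>f. cut (sset_prod ?K (std_simplex 0)) (\<lambda>m z. SCmp M A T Y m (Act (SMap M T Y) 0 (snd z) f) (\<eta> m (fst z)))"
  have "bij_betw ?\<Phi> (Simp (SMap M T Y) 0) (Simp (fun_complex ?K (SMap M A Y)) 0)"
    using T Y unfolding is_tensor_def sset_iso_def by blast
  from bij_betw_trans[OF this fun_complex_yoneda[OF e SMap_sset[OF A Y]]]
  show ?thesis
    by (simp add: comp_def cut_def degen_def del: replicate_Suc)
qed

lemma cotensor_simplex:
  assumes e: "inj e" and Y: "Y \<in> SObj M" and P: "is_cotensor M Y (relabel e (std_simplex n)) P \<epsilon>" and X: "X \<in> SObj M"
  shows "bij_betw (\<lambda>f. SCmp M X P Y n (\<epsilon> n (e (op_id n))) (degen (SMap M X P) n f)) (Simp (SMap M X P) 0) (Simp (SMap M X Y) n)"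
proof -
  let ?K = "relabel e (std_simplex n)"
  let ?\<Phi> = "\<lambda>f. cut (sset_prod ?K (std_simplex 0)) (\<lambda>m z. SCmp M X P Y m (\<epsilon> m (fst z)) (Act (SMap M X P) 0 (snd z) f))"
  have "bij_betw ?\<Phi> (Simp (SMap M X P) 0) (Simp (fun_complex ?K (SMap M X Y)) 0)"
    using P X unfolding is_cotensor_def sset_iso_def by blast
  from bij_betw_trans[OF this fun_complex_yoneda[OF e SMap_sset[OF X Y]]]
  show ?thesis
    by (simp add: comp_def cut_def degen_def del: replicate_Suc)
qed

end

locale smodel = scat M for M :: "('o, 's) smcat" +
  fixes small :: "'k itself"
  assumes infinite_small: "infinite (UNIV :: 'k set)"
    and model: "simplicial_model_category small M"
begin

lemma bij_singleton: "bij_betw f A B \<Longrightarrow> \<exists>!x. x \<in> A \<Longrightarrow> \<exists>!y. y \<in> B"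
  by (metis bij_betw_iff_bijections)

text \<open>The n-simplices of \<open>SMap M A T\<close> are morphisms to \<open>T\<close> from a
  tensor of \<open>A\<close>, and of these there is exactly one.\<close>

lemma map_to_terminal:
  assumes A: "A \<in> SObj M" and T: "is_terminal (ucat M) T"
  shows "\<exists>!f. f \<in> Simp (SMap M A T) n"
proof -
  obtain e :: "nat list \<Rightarrow> 'k" where e: "inj e" using inj_nat_list_infinite[OF infinite_small] .
  obtain P \<eta> where P: "is_tensor M A (relabel e (std_simplex n)) P \<eta>"
    using model A simplicial_set_relabel[OF e simplicial_set_std_simplex] unfolding simplicial_model_category_def by blast
  have "T \<in> SObj M" "P \<in> SObj M" using T P by (auto simp: is_terminal_def is_tensor_def)
  then show ?thesis
    using bij_singleton[OF tensor_simplex[OF e A P]] T by (simp add: is_terminal_def)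
qed

text \<open>The cotensor with a simplex, reduced to its universal n-simplex
  \<open>\<epsilon>\<close>, so that the copy of the simplex in \<open>'k\<close> no longer
  appears.\<close>

lemma cotensor_obtain:
  assumes Y: "Y \<in> SObj M"
  obtains P \<epsilon> where "P \<in> SObj M" "\<epsilon> \<in> Simp (SMap M P Y) n"
    "\<And>X. X \<in> SObj M \<Longrightarrow> bij_betw (\<lambda>f. SCmp M X P Y n \<epsilon> (degen (SMap M X P) n f)) (Simp (SMap M X P) 0) (Simp (SMap M X Y) n)"
proof -
  obtain e :: "nat list \<Rightarrow> 'k" where e: "inj e" using inj_nat_list_infinite[OF infinite_small] .
  obtain P \<epsilon> where P: "is_cotensor M Y (relabel e (std_simplex n)) P \<epsilon>"
    using model Y simplicial_set_relabel[OF e simplicial_set_std_simplex] unfolding simplicial_model_category_def by blast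
  have "simplicial_map (relabel e (std_simplex n)) (SMap M P Y) \<epsilon>" "P \<in> SObj M"
    using P by (simp_all add: is_cotensor_def)
  moreover then have "\<epsilon> n (e (op_id n)) \<in> Simp (SMap M P Y) n"
    by (auto intro: simplicial_map_Simp)
  ultimately show ?thesis using that cotensor_simplex[OF e Y P] by blast
qed

lemma map_from_initial:
  assumes Y: "Y \<in> SObj M" and I: "is_initial (ucat M) I"
  shows "\<exists>!f. f \<in> Simp (SMap M I Y) n"
proof -
  obtain P \<epsilon> where P: "P \<in> SObj M"
    "\<And>X. X \<in> SObj M \<Longrightarrow> bij_betw (\<lambda>f. SCmp M X P Y n \<epsilon> (degen (SMap M X P) n f)) (Simp (SMap M X P) 0) (Simp (SMap M X Y) n)"
    using cotensor_obtain[OF Y] by metis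
  then show ?thesis using bij_singleton[OF P(2)] I by (simp add: is_initial_def)
qed

text \<open>The n-simplices of mapping spaces into \<open>X\<close> are morphisms into the cotensor
  \<open>Q\<close>, naturally in the source, so the ordinary universal property for maps into
  \<open>Q\<close> is the one in dimension \<open>n\<close> for maps into \<open>X\<close>.\<close>

lemma enriched_pushout:
  assumes po: "is_pushout (ucat M) A B C P f g j k" and X: "X \<in> SObj M"
    and x: "x \<in> Simp (SMap M B X) n" and y: "y \<in> Simp (SMap M C X) n"
    and xy: "precomp M A B X f n x = precomp M A C X g n y"
  shows "\<exists>!u. u \<in> Simp (SMap M P X) n \<and> precomp M B P X j n u = x \<and> precomp M C P X k n u = y"
proof -
  have obj: "A \<in> SObj M" "B \<in> SObj M" "C \<in> SObj M" "P \<in> SObj M"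
    and hom: "f \<in> Simp (SMap M A B) 0" "g \<in> Simp (SMap M A C) 0" "j \<in> Simp (SMap M B P) 0" "k \<in> Simp (SMap M C P) 0"
    and univ: "\<And>X x y. X \<in> SObj M \<Longrightarrow> x \<in> Simp (SMap M B X) 0 \<Longrightarrow> y \<in> Simp (SMap M C X) 0 \<Longrightarrow>
      SCmp M A B X 0 x f = SCmp M A C X 0 y g \<Longrightarrow>
      \<exists>!u. u \<in> Simp (SMap M P X) 0 \<and> SCmp M B P X 0 u j = x \<and> SCmp M C P X 0 u k = y"
    using po by (auto simp: is_pushout_def)
  obtain Q \<epsilon> where Q: "Q \<in> SObj M" "\<epsilon> \<in> Simp (SMap M Q X) n"
    "\<And>Z. Z \<in> SObj M \<Longrightarrow> bij_betw (\<lambda>f. SCmp M Z Q X n \<epsilon> (degen (SMap M Z Q) n f)) (Simp (SMap M Z Q) 0) (Simp (SMap M Z X) n)"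
    using cotensor_obtain[OF X, of n thesis] by blast
  define ev where "ev Z h = SCmp M Z Q X n \<epsilon> (degen (SMap M Z Q) n h)" for Z h
  have bij: "bij_betw (ev Z) (Simp (SMap M Z Q) 0) (Simp (SMap M Z X) n)" if "Z \<in> SObj M" for Z
    using Q(3)[OF that] by (simp add: ev_def[abs_def])
  have inj: "h = h'" if "ev Z h = ev Z h'" "Z \<in> SObj M" "h \<in> Simp (SMap M Z Q) 0" "h' \<in> Simp (SMap M Z Q) 0" for Z h h'
    using bij[OF that(2)] that by (auto simp: bij_betw_def inj_on_def)
  have surj: "\<exists>h\<in>Simp (SMap M Z Q) 0. ev Z h = z" if "Z \<in> SObj M" "z \<in> Simp (SMap M Z X) n" for Z z
    using bij_betw_imp_surj_on[OF bij[OF that(1)]] that(2) by (metis imageE)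
  have nat: "precomp M Z Z' X i n (ev Z' h) = ev Z (SCmp M Z Z' Q 0 h i)"
    if "Z \<in> SObj M" "Z' \<in> SObj M" "i \<in> Simp (SMap M Z Z') 0" "h \<in> Simp (SMap M Z' Q) 0" for Z Z' i h
    using that Q(1,2) X by (simp add: ev_def precomp_def SCmp_assoc SCmp_degen)
  obtain x' y' where x': "x' \<in> Simp (SMap M B Q) 0" "ev B x' = x" and y': "y' \<in> Simp (SMap M C Q) 0" "ev C y' = y"
    using surj obj x y by meson
  have eq: "SCmp M A B Q 0 x' f = SCmp M A C Q 0 y' g"
    by (rule inj[of A]) (use xy nat x' y' obj hom Q(1) in auto)
  obtain u' where u': "u' \<in> Simp (SMap M P Q) 0" "SCmp M B P Q 0 u' j = x'" "SCmp M C P Q 0 u' k = y'"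
    using univ[OF Q(1) x'(1) y'(1) eq] by blast
  show ?thesis
  proof (rule ex1I[of _ "ev P u'"])
    show "ev P u' \<in> Simp (SMap M P X) n \<and> precomp M B P X j n (ev P u') = x \<and> precomp M C P X k n (ev P u') = y"
      using nat obj hom u' x' y' bij[OF obj(4)] by (auto simp: bij_betw_def)
    fix v assume v: "v \<in> Simp (SMap M P X) n \<and> precomp M B P X j n v = x \<and> precomp M C P X k n v = y"
    then obtain v' where v': "v' \<in> Simp (SMap M P Q) 0" "ev P v' = v" using surj obj by blast
    have "SCmp M B P Q 0 v' j = x'"
      by (rule inj[of B]) (use v v' nat obj hom x' Q(1) in auto)
    moreover have "SCmp M C P Q 0 v' k = y'"
      by (rule inj[of C]) (use v v' nat obj hom y' Q(1) in auto)
    ultimately have "v' = u'" using univ[OF Q(1) x'(1) y'(1) eq] u' v'(1) by blast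
    then show "v = ev P u'" using v' by simp
  qed
qed

end

text \<open>The index categories in \<open>bicomplete\<close> have objects and morphisms of one
  type. Preorders are enough for spans and pairs, and naming an arrow by its target makes
  composition trivial.\<close>

definition preorder_cat :: "'k set \<Rightarrow> ('k \<Rightarrow> 'k \<Rightarrow> bool) \<Rightarrow> ('k, 'k) cat" where
  "preorder_cat S le = \<lparr>Obj = S, Hom = (\<lambda>i j. if le i j then {j} else {}), Cmp = (\<lambda>i j k g f. k), Ide = (\<lambda>i. i)\<rparr>"

lemma preorder_cat_simps [simp]:
  "Obj (preorder_cat S le) = S" "Hom (preorder_cat S le) i j = (if le i j then {j} else {})"
  "Cmp (preorder_cat S le) i j k g f = k" "Ide (preorder_cat S le) i = i"
  by (simp_all add: preorder_cat_def)

lemma is_category_preorder: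
  assumes "\<And>i. le i i" "\<And>i j k. le i j \<Longrightarrow> le j k \<Longrightarrow> le i k"
  shows "is_category (preorder_cat S le)"
proof -
  have "k \<in> (if le i k then {k} else {})" if "x \<in> (if le i j then {j} else {})" "y \<in> (if le j k then {k} else {})" for i j k x y
    using that assms(2)[of i j k] by (simp split: if_splits)
  moreover have "j = x" if "x \<in> (if le i j then {j} else {})" for i j x
    using that by (simp split: if_splits)
  ultimately show ?thesis
    unfolding is_category_def preorder_cat_simps using assms(1) by (intro conjI ballI) auto
qed

section \<open>Consequences of the model category axioms\<close>

context smodel
begin

abbreviation hom :: "'o \<Rightarrow> 'o \<Rightarrow> 's set" where
  "hom X Y \<equiv> Simp (SMap M X Y) 0"

lemma model_cat: "model_category small (ucat M) (Cof M) (Fib M) (Weq M)"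
  using model by (simp add: simplicial_model_category_def)

lemma cof_hom: "A \<in> SObj M \<Longrightarrow> B \<in> SObj M \<Longrightarrow> i \<in> Cof M A B \<Longrightarrow> i \<in> hom A B"
  and fib_hom: "A \<in> SObj M \<Longrightarrow> B \<in> SObj M \<Longrightarrow> i \<in> Fib M A B \<Longrightarrow> i \<in> hom A B"
  and weq_hom: "A \<in> SObj M \<Longrightarrow> B \<in> SObj M \<Longrightarrow> i \<in> Weq M A B \<Longrightarrow> i \<in> hom A B"
  using model_cat unfolding model_category_def ucat_simps by blast+

lemma two_of_three_weq:
  assumes "X \<in> SObj M" "Y \<in> SObj M" "Z \<in> SObj M" "f \<in> hom X Y" "g \<in> hom Y Z"
  shows "f \<in> Weq M X Y \<and> SCmp M X Y Z 0 g f \<in> Weq M X Z \<longrightarrow> g \<in> Weq M Y Z"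
    and "g \<in> Weq M Y Z \<and> SCmp M X Y Z 0 g f \<in> Weq M X Z \<longrightarrow> f \<in> Weq M X Y"
proof -
  have "two_of_three (ucat M) (Weq M)" using model_cat by (simp add: model_category_def)
  note this[unfolded two_of_three_def ucat_simps, rule_format, OF assms]
  then show "f \<in> Weq M X Y \<and> SCmp M X Y Z 0 g f \<in> Weq M X Z \<longrightarrow> g \<in> Weq M Y Z"
    and "g \<in> Weq M Y Z \<and> SCmp M X Y Z 0 g f \<in> Weq M X Z \<longrightarrow> f \<in> Weq M X Y" by blast+
qed

lemma weq_cancel_right: "X \<in> SObj M \<Longrightarrow> Y \<in> SObj M \<Longrightarrow> Z \<in> SObj M \<Longrightarrow> f \<in> Weq M X Y \<Longrightarrow> g \<in> hom Y Z \<Longrightarrow>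
    SCmp M X Y Z 0 g f \<in> Weq M X Z \<Longrightarrow> g \<in> Weq M Y Z"
  using two_of_three_weq(1)[of X Y Z f g] weq_hom by blast

lemma weq_cancel_left: "X \<in> SObj M \<Longrightarrow> Y \<in> SObj M \<Longrightarrow> Z \<in> SObj M \<Longrightarrow> f \<in> hom X Y \<Longrightarrow> g \<in> Weq M Y Z \<Longrightarrow>
    SCmp M X Y Z 0 g f \<in> Weq M X Z \<Longrightarrow> f \<in> Weq M X Y"
  using two_of_three_weq(2)[of X Y Z f g] weq_hom by blast

lemma retract:
  assumes "retract_closed (ucat M) W"
    and "X \<in> SObj M" "Y \<in> SObj M" "A \<in> SObj M" "B \<in> SObj M" "f \<in> hom X Y" "g \<in> W A B"
    and "s \<in> hom X A" "r \<in> hom A X" "s' \<in> hom Y B" "r' \<in> hom B Y"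
    and "SCmp M X A X 0 r s = SIde M X" "SCmp M Y B Y 0 r' s' = SIde M Y"
    and "SCmp M X A B 0 g s = SCmp M X Y B 0 s' f" "SCmp M A X Y 0 f r = SCmp M A B Y 0 r' g"
  shows "f \<in> W X Y"
proof -
  have "is_retract (ucat M) X Y f A B g"
    unfolding is_retract_def ucat_simps using assms(8-) by blast
  then show ?thesis using assms(1-7) unfolding retract_closed_def ucat_simps by blast
qed

lemma lift_cof_tfib:
  assumes "A \<in> SObj M" "B \<in> SObj M" "X \<in> SObj M" "Y \<in> SObj M" "i \<in> Cof M A B" "p \<in> Fib M X Y" "p \<in> Weq M X Y"
    "u \<in> hom A X" "v \<in> hom B Y" "SCmp M A X Y 0 p u = SCmp M A B Y 0 v i"
  obtains h where "h \<in> hom B X" "SCmp M A B X 0 h i = u" "SCmp M B X Y 0 p h = v"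
proof -
  have "all_lift (ucat M) (Cof M) (\<lambda>X Y. Fib M X Y \<inter> Weq M X Y)"
    using model_cat by (simp add: model_category_def)
  then have "lifts (ucat M) A B i X Y p" using assms(1-7) by (simp add: all_lift_def)
  then show ?thesis using that assms(8-) unfolding lifts_def ucat_simps by blast
qed

lemma lift_tcof_fib:
  assumes "A \<in> SObj M" "B \<in> SObj M" "X \<in> SObj M" "Y \<in> SObj M" "i \<in> Cof M A B" "i \<in> Weq M A B" "p \<in> Fib M X Y"
    "u \<in> hom A X" "v \<in> hom B Y" "SCmp M A X Y 0 p u = SCmp M A B Y 0 v i"
  obtains h where "h \<in> hom B X" "SCmp M A B X 0 h i = u" "SCmp M B X Y 0 p h = v"
proof -
  have "all_lift (ucat M) (\<lambda>X Y. Cof M X Y \<inter> Weq M X Y) (Fib M)"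
    using model_cat by (simp add: model_category_def)
  then have "lifts (ucat M) A B i X Y p" using assms(1-7) by (simp add: all_lift_def)
  then show ?thesis using that assms(8-) unfolding lifts_def ucat_simps by blast
qed

lemma factor_cof_tfib:
  assumes "X \<in> SObj M" "Y \<in> SObj M" "f \<in> hom X Y"
  obtains Z i p where "Z \<in> SObj M" "i \<in> Cof M X Z" "p \<in> Fib M Z Y" "p \<in> Weq M Z Y" "f = SCmp M X Z Y 0 p i"
proof -
  have "all_factor (ucat M) (Cof M) (\<lambda>X Y. Fib M X Y \<inter> Weq M X Y)"
    using model_cat by (simp add: model_category_def)
  then show ?thesis using that assms unfolding all_factor_def ucat_simps by blast
qed

lemma factor_tcof_fib:
  assumes "X \<in> SObj M" "Y \<in> SObj M" "f \<in> hom X Y"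
  obtains Z i p where "Z \<in> SObj M" "i \<in> Cof M X Z" "i \<in> Weq M X Z" "p \<in> Fib M Z Y" "f = SCmp M X Z Y 0 p i"
proof -
  have "all_factor (ucat M) (\<lambda>X Y. Cof M X Y \<inter> Weq M X Y) (Fib M)"
    using model_cat by (simp add: model_category_def)
  then show ?thesis using that assms unfolding all_factor_def ucat_simps by blast
qed

text \<open>The retract argument: factor \<open>i\<close> as a cofibration \<open>j\<close> followed
  by a trivial fibration \<open>p\<close>; a lift of the identity against \<open>p\<close> makes
  \<open>i\<close> a retract of \<open>j\<close>.\<close>

lemma cofI:
  assumes AB: "A \<in> SObj M" "B \<in> SObj M" "i \<in> hom A B"
    and lift: "\<And>X Y p u v. X \<in> SObj M \<Longrightarrow> Y \<in> SObj M \<Longrightarrow> p \<in> Fib M X Y \<Longrightarrow> p \<in> Weq M X Y \<Longrightarrow> p \<in> hom X Y \<Longrightarrow>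
      u \<in> hom A X \<Longrightarrow> v \<in> hom B Y \<Longrightarrow> SCmp M A X Y 0 p u = SCmp M A B Y 0 v i \<Longrightarrow>
      \<exists>h\<in>hom B X. SCmp M A B X 0 h i = u \<and> SCmp M B X Y 0 p h = v"
  shows "i \<in> Cof M A B"
proof -
  obtain Z j p where Z: "Z \<in> SObj M" "j \<in> Cof M A Z" "p \<in> Fib M Z B" "p \<in> Weq M Z B" "i = SCmp M A Z B 0 p j"
    using factor_cof_tfib[OF AB] .
  have p: "p \<in> hom Z B" and j: "j \<in> hom A Z" using Z AB fib_hom cof_hom by auto
  obtain h where h: "h \<in> hom B Z" "SCmp M A B Z 0 h i = j" "SCmp M B Z B 0 p h = SIde M B"
    using lift[OF Z(1) AB(2) Z(3,4) p j, of "SIde M B"] AB Z(5) by auto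
  have "retract_closed (ucat M) (Cof M)" using model_cat by (simp add: model_category_def)
  then show ?thesis
    by (rule retract[where A = A and B = Z and g = j and s = "SIde M A" and r = "SIde M A" and s' = h and r' = p])
      (use AB Z p j h in auto)
qed

lemma fibI:
  assumes XY: "X \<in> SObj M" "Y \<in> SObj M" "p \<in> hom X Y"
    and lift: "\<And>A B i u v. A \<in> SObj M \<Longrightarrow> B \<in> SObj M \<Longrightarrow> i \<in> Cof M A B \<Longrightarrow> i \<in> Weq M A B \<Longrightarrow> i \<in> hom A B \<Longrightarrow>
      u \<in> hom A X \<Longrightarrow> v \<in> hom B Y \<Longrightarrow> SCmp M A X Y 0 p u = SCmp M A B Y 0 v i \<Longrightarrow>
      \<exists>h\<in>hom B X. SCmp M A B X 0 h i = u \<and> SCmp M B X Y 0 p h = v"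
  shows "p \<in> Fib M X Y"
proof -
  obtain Z i q where Z: "Z \<in> SObj M" "i \<in> Cof M X Z" "i \<in> Weq M X Z" "q \<in> Fib M Z Y" "p = SCmp M X Z Y 0 q i"
    using factor_tcof_fib[OF XY] .
  have q: "q \<in> hom Z Y" and i: "i \<in> hom X Z" using Z XY fib_hom cof_hom by auto
  obtain h where h: "h \<in> hom Z X" "SCmp M X Z X 0 h i = SIde M X" "SCmp M Z X Y 0 p h = q"
    using lift[OF XY(1) Z(1,2,3) i, of "SIde M X" q] XY Z(5) q by auto
  have "retract_closed (ucat M) (Fib M)" using model_cat by (simp add: model_category_def)
  then show ?thesis
    by (rule retract[where A = Z and B = Y and g = q and s = i and r = h and s' = "SIde M Y" and r' = "SIde M Y"])
      (use XY Z q i h in auto)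
qed

text \<open>Factor the identity through a trivial fibration \<open>p\<close>; then the identity is a
  retract of \<open>p\<close>.\<close>

lemma weq_id: "X \<in> SObj M \<Longrightarrow> SIde M X \<in> Weq M X X"
proof -
  assume X: "X \<in> SObj M"
  obtain Z i p where Z: "Z \<in> SObj M" "i \<in> Cof M X Z" "p \<in> Fib M Z X" "p \<in> Weq M Z X" "SIde M X = SCmp M X Z X 0 p i"
    using factor_cof_tfib[OF X X SIde_hom[OF X]] .
  have p: "p \<in> hom Z X" and i: "i \<in> hom X Z" using Z X fib_hom cof_hom by auto
  have "retract_closed (ucat M) (Weq M)" using model_cat by (simp add: model_category_def)
  then show ?thesis
    by (rule retract[where A = Z and B = X and g = p and s = i and r = p and s' = "SIde M X" and r' = "SIde M X"])
      (use X Z p i in \<open>auto simp flip: Z(5)\<close>)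
qed

lemma cof_comp:
  assumes obj: "A \<in> SObj M" "B \<in> SObj M" "C \<in> SObj M" and i: "i \<in> Cof M A B" and j: "j \<in> Cof M B C"
  shows "SCmp M A B C 0 j i \<in> Cof M A C"
proof (rule cofI)
  have ih: "i \<in> hom A B" and jh: "j \<in> hom B C" using cof_hom obj i j by auto
  then show "SCmp M A B C 0 j i \<in> hom A C" using obj by simp
  fix X Y p u v assume X: "X \<in> SObj M" "Y \<in> SObj M" "p \<in> Fib M X Y" "p \<in> Weq M X Y" "p \<in> hom X Y"
    and uv: "u \<in> hom A X" "v \<in> hom C Y" "SCmp M A X Y 0 p u = SCmp M A C Y 0 v (SCmp M A B C 0 j i)"
  obtain h where h: "h \<in> hom B X" "SCmp M A B X 0 h i = u" "SCmp M B X Y 0 p h = SCmp M B C Y 0 v j"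
    by (rule lift_cof_tfib[OF obj(1,2) X(1,2) i X(3,4) uv(1), of "SCmp M B C Y 0 v j"])
      (use uv obj X ih jh in \<open>auto simp: SCmp_assoc\<close>)
  obtain k where k: "k \<in> hom C X" "SCmp M B C X 0 k j = h" "SCmp M C X Y 0 p k = v"
    using lift_cof_tfib[OF obj(2,3) X(1,2) j X(3,4) h(1) uv(2) h(3)] .
  have "SCmp M A C X 0 k (SCmp M A B C 0 j i) = u"
    using SCmp_assoc[OF obj X(1) ih jh k(1)] h(2) k(2) by simp
  then show "\<exists>h\<in>hom C X. SCmp M A C X 0 h (SCmp M A B C 0 j i) = u \<and> SCmp M C X Y 0 p h = v"
    using k by blast
qed (use obj in auto)

lemma fib_comp:
  assumes obj: "X \<in> SObj M" "Y \<in> SObj M" "Z \<in> SObj M" and p: "p \<in> Fib M X Y" and q: "q \<in> Fib M Y Z"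
  shows "SCmp M X Y Z 0 q p \<in> Fib M X Z"
proof (rule fibI)
  have ph: "p \<in> hom X Y" and qh: "q \<in> hom Y Z" using fib_hom obj p q by auto
  then show "SCmp M X Y Z 0 q p \<in> hom X Z" using obj by simp
  fix A B i u v assume A: "A \<in> SObj M" "B \<in> SObj M" "i \<in> Cof M A B" "i \<in> Weq M A B" "i \<in> hom A B"
    and uv: "u \<in> hom A X" "v \<in> hom B Z" "SCmp M A X Z 0 (SCmp M X Y Z 0 q p) u = SCmp M A B Z 0 v i"
  obtain h where h: "h \<in> hom B Y" "SCmp M A B Y 0 h i = SCmp M A X Y 0 p u" "SCmp M B Y Z 0 q h = v"
    by (rule lift_tcof_fib[OF A(1,2) obj(2,3) A(3,4) q _ uv(2), of "SCmp M A X Y 0 p u"])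
      (use uv obj A ph qh in \<open>auto simp: SCmp_assoc\<close>)
  obtain k where k: "k \<in> hom B X" "SCmp M A B X 0 k i = u" "SCmp M B X Y 0 p k = h"
    using lift_tcof_fib[OF A(1,2) obj(1,2) A(3,4) p uv(1) h(1) h(2)[symmetric]] .
  have "SCmp M B X Z 0 (SCmp M X Y Z 0 q p) k = v"
    using SCmp_assoc[OF A(2) obj k(1) ph qh] h(3) k(3) by simp
  then show "\<exists>h\<in>hom B X. SCmp M A B X 0 h i = u \<and> SCmp M B X Z 0 (SCmp M X Y Z 0 q p) h = v"
    using k by blast
qed (use obj in auto)

lemma iso_cof:
  assumes obj: "A \<in> SObj M" "B \<in> SObj M" and f: "f \<in> hom A B" and g: "g \<in> hom B A"
    and gf: "SCmp M A B A 0 g f = SIde M A" and fg: "SCmp M B A B 0 f g = SIde M B"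
  shows "f \<in> Cof M A B"
proof (rule cofI[OF obj f])
  fix X Y p u v assume X: "X \<in> SObj M" "Y \<in> SObj M" "p \<in> hom X Y"
    and uv: "u \<in> hom A X" "v \<in> hom B Y" "SCmp M A X Y 0 p u = SCmp M A B Y 0 v f"
  have "SCmp M B X Y 0 p (SCmp M B A X 0 u g) = v"
    using SCmp_assoc[OF obj(2,1) X(1,2) g uv(1) X(3)] SCmp_assoc[OF obj(2,1,2) X(2) g f uv(2)] uv fg obj X by simp
  then show "\<exists>h\<in>hom B X. SCmp M A B X 0 h f = u \<and> SCmp M B X Y 0 p h = v"
    using SCmp_assoc[OF obj obj(1) X(1) f g uv(1)] gf obj X uv f g
    by (intro bexI[of _ "SCmp M B A X 0 u g"]) simp_all
qed

lemma iso_fib: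
  assumes obj: "A \<in> SObj M" "B \<in> SObj M" and f: "f \<in> hom A B" and g: "g \<in> hom B A"
    and gf: "SCmp M A B A 0 g f = SIde M A" and fg: "SCmp M B A B 0 f g = SIde M B"
  shows "f \<in> Fib M A B"
proof (rule fibI[OF obj f])
  fix C D i u v assume X: "C \<in> SObj M" "D \<in> SObj M" "i \<in> hom C D"
    and uv: "u \<in> hom C A" "v \<in> hom D B" "SCmp M C A B 0 f u = SCmp M C D B 0 v i"
  have "SCmp M C D A 0 (SCmp M D B A 0 g v) i = u"
    using SCmp_assoc[OF X(1,2) obj(2,1) X(3) uv(2) g] SCmp_assoc[OF X(1) obj obj(1) uv(1) f g] uv gf obj X by simp
  then show "\<exists>h\<in>hom D A. SCmp M C D A 0 h i = u \<and> SCmp M D A B 0 f h = v"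
    using SCmp_assoc[OF X(2) obj(2,1,2) uv(2) g f] fg obj X uv f g
    by (intro bexI[of _ "SCmp M D B A 0 g v"]) simp_all
qed

text \<open>A lifting problem for \<open>k\<close> restricts to one for \<open>f\<close>; its
  solution is glued with \<open>u\<close>. That the glued map lies over \<open>v\<close> follows
  from the uniqueness part of the pushout property.\<close>

lemma pushout_cof:
  assumes po: "is_pushout (ucat M) A B C P f g j k" and f: "f \<in> Cof M A B"
  shows "k \<in> Cof M C P"
proof -
  have obj: "A \<in> SObj M" "B \<in> SObj M" "C \<in> SObj M" "P \<in> SObj M"
    and homs: "f \<in> hom A B" "g \<in> hom A C" "j \<in> hom B P" "k \<in> hom C P"
    and sq: "SCmp M A B P 0 j f = SCmp M A C P 0 k g"
    and univ: "\<And>X x y. X \<in> SObj M \<Longrightarrow> x \<in> hom B X \<Longrightarrow> y \<in> hom C X \<Longrightarrow> SCmp M A B X 0 x f = SCmp M A C X 0 y g \<Longrightarrow>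
      \<exists>!u. u \<in> hom P X \<and> SCmp M B P X 0 u j = x \<and> SCmp M C P X 0 u k = y"
    using po by (auto simp: is_pushout_def)
  show ?thesis
  proof (rule cofI[OF obj(3,4) homs(4)])
    fix X Y p u v assume X: "X \<in> SObj M" "Y \<in> SObj M" "p \<in> Fib M X Y" "p \<in> Weq M X Y" "p \<in> hom X Y"
      and uv: "u \<in> hom C X" "v \<in> hom P Y" "SCmp M C X Y 0 p u = SCmp M C P Y 0 v k"
    have "SCmp M A X Y 0 p (SCmp M A C X 0 u g) = SCmp M A B Y 0 (SCmp M B P Y 0 v j) f"
      using SCmp_assoc[OF obj(1,3) X(1,2) homs(2) uv(1) X(5)] SCmp_assoc[OF obj(1,3,4) X(2) homs(2,4) uv(2)]
        SCmp_assoc[OF obj(1,2,4) X(2) homs(1,3) uv(2)] uv(3) sq by simp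
    then obtain h where h: "h \<in> hom B X" "SCmp M A B X 0 h f = SCmp M A C X 0 u g" "SCmp M B X Y 0 p h = SCmp M B P Y 0 v j"
      by (rule lift_cof_tfib[OF obj(1,2) X(1,2) f X(3,4), rotated 2]) (use obj X uv homs in auto)
    obtain w where w: "w \<in> hom P X" "SCmp M B P X 0 w j = h" "SCmp M C P X 0 w k = u"
      using univ[OF X(1) h(1) uv(1) h(2)] by blast
    have "SCmp M P X Y 0 p w = v"
    proof -
      have "\<exists>!t. t \<in> hom P Y \<and> SCmp M B P Y 0 t j = SCmp M B P Y 0 v j \<and> SCmp M C P Y 0 t k = SCmp M C P Y 0 v k"
        by (rule univ) (use X(2) uv homs obj sq SCmp_assoc[OF obj(1,2,4) X(2) homs(1,3) uv(2)] SCmp_assoc[OF obj(1,3,4) X(2) homs(2,4) uv(2)] in auto)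
      moreover have "SCmp M B P Y 0 (SCmp M P X Y 0 p w) j = SCmp M B P Y 0 v j"
        using SCmp_assoc[OF obj(2,4) X(1,2) homs(3) w(1) X(5)] w h by simp
      moreover have "SCmp M C P Y 0 (SCmp M P X Y 0 p w) k = SCmp M C P Y 0 v k"
        using SCmp_assoc[OF obj(3,4) X(1,2) homs(4) w(1) X(5)] w uv by simp
      moreover have "SCmp M P X Y 0 p w \<in> hom P Y" using obj X w by simp
      ultimately show ?thesis using uv(2) by blast
    qed
    then show "\<exists>h\<in>hom P X. SCmp M C P X 0 h k = u \<and> SCmp M P X Y 0 p h = v" using w by blast
  qed
qed

lemma pushout_sym: "is_pushout (ucat M) A B C P f g j k \<Longrightarrow> is_pushout (ucat M) A C B P g f k j"
  unfolding is_pushout_def by (auto simp: conj_commute)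

lemma three_elements: obtains a b c :: 'k where "a \<noteq> b" "a \<noteq> c" "b \<noteq> c"
proof -
  obtain f :: "nat \<Rightarrow> 'k" where "inj f" using infinite_countable_subset[OF infinite_small] by blast
  then show ?thesis using that[of "f 0" "f 1" "f 2"] by (simp add: inj_eq)
qed

lemma pushout_exists:
  assumes obj: "A \<in> SObj M" "B \<in> SObj M" "C \<in> SObj M" and f: "f \<in> hom A B" and g: "g \<in> hom A C"
  obtains P j k where "is_pushout (ucat M) A B C P f g j k"
proof -
  obtain a b c :: 'k where ne: "a \<noteq> b" "a \<noteq> c" "b \<noteq> c" using three_elements .
  \<comment> \<open>The span with apex \<open>a\<close> below \<open>b\<close> and
    \<open>c\<close>.\<close>
  define J where "J = preorder_cat {a, b, c} (\<lambda>i j. i = j \<or> i = a)"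
  define F0 where "F0 i = (if i = a then A else if i = b then B else C)" for i
  define F1 where "F1 i j (x :: 'k) = (if i = j then SIde M (F0 i) else if j = b then f else g)" for i j x
  have J: "is_category J" unfolding J_def by (rule is_category_preorder) auto
  have F: "is_functor J (ucat M) F0 F1"
    using ne obj f g by (auto simp: is_functor_def J_def F0_def F1_def)
  have "bicomplete small (ucat M)" using model_cat by (simp add: model_category_def)
  then obtain P q where P: "is_colimit J (ucat M) F0 F1 P q"
    using J F unfolding bicomplete_def by blast
  have cocone: "is_cocone J (ucat M) F0 F1 X x \<longleftrightarrow> X \<in> SObj M \<and> x a \<in> hom A X \<and> x b \<in> hom B X \<and> x c \<in> hom C X \<and>
      SCmp M A B X 0 (x b) f = x a \<and> SCmp M A C X 0 (x c) g = x a" for X x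
    using ne obj f g by (auto simp: is_cocone_def J_def F0_def F1_def)
  have Pc: "P \<in> SObj M" "q a \<in> hom A P" "q b \<in> hom B P" "q c \<in> hom C P"
      "SCmp M A B P 0 (q b) f = q a" "SCmp M A C P 0 (q c) g = q a"
    using P unfolding is_colimit_def cocone by auto
  have "is_pushout (ucat M) A B C P f g (q b) (q c)"
    unfolding is_pushout_def ucat_simps
  proof (intro conjI ballI impI)
    fix X x y assume X: "X \<in> SObj M" and x: "x \<in> hom B X" and y: "y \<in> hom C X" and xy: "SCmp M A B X 0 x f = SCmp M A C X 0 y g"
    define z where "z i = (if i = a then SCmp M A B X 0 x f else if i = b then x else y)" for i
    have "is_cocone J (ucat M) F0 F1 X z" unfolding cocone using ne X x y xy obj f g by (simp add: z_def)
    then have "\<exists>!u. u \<in> hom P X \<and> (\<forall>i\<in>{a, b, c}. SCmp M (F0 i) P X 0 u (q i) = z i)"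
      using P unfolding is_colimit_def by (simp add: J_def)
    moreover have "u \<in> hom P X \<and> (\<forall>i\<in>{a, b, c}. SCmp M (F0 i) P X 0 u (q i) = z i) \<longleftrightarrow>
        u \<in> hom P X \<and> SCmp M B P X 0 u (q b) = x \<and> SCmp M C P X 0 u (q c) = y" for u
      using ne SCmp_assoc[OF obj(1,2) Pc(1) X f Pc(3)] Pc(5) by (auto simp: z_def F0_def)
    ultimately show "\<exists>!u. u \<in> hom P X \<and> SCmp M B P X 0 u (q b) = x \<and> SCmp M C P X 0 u (q c) = y" by simp
  qed (use obj f g Pc in auto)
  then show ?thesis by (rule that)
qed

lemma product_exists:
  assumes obj: "X \<in> SObj M" "Y \<in> SObj M"
  obtains P \<pi> \<rho> where "P \<in> SObj M" "\<pi> \<in> hom P X" "\<rho> \<in> hom P Y"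
    "\<And>Z f g. Z \<in> SObj M \<Longrightarrow> f \<in> hom Z X \<Longrightarrow> g \<in> hom Z Y \<Longrightarrow>
      \<exists>!u. u \<in> hom Z P \<and> SCmp M Z P X 0 \<pi> u = f \<and> SCmp M Z P Y 0 \<rho> u = g"
proof -
  obtain a b c :: 'k where ne: "a \<noteq> b" "a \<noteq> c" "b \<noteq> c" using three_elements .
  define J where "J = preorder_cat {a, b} (\<lambda>i j. i = j)"
  define F0 where "F0 i = (if i = a then X else Y)" for i
  define F1 where "F1 i j (x :: 'k) = SIde M (F0 i)" for i j :: 'k and x
  have J: "is_category J" unfolding J_def by (rule is_category_preorder) auto
  have F: "is_functor J (ucat M) F0 F1"
    using ne obj by (auto simp: is_functor_def J_def F0_def F1_def)
  have "bicomplete small (ucat M)" using model_cat by (simp add: model_category_def)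
  then obtain P q where P: "is_limit J (ucat M) F0 F1 P q"
    using J F unfolding bicomplete_def by blast
  have cone: "is_cone J (ucat M) F0 F1 Z x \<longleftrightarrow> Z \<in> SObj M \<and> x a \<in> hom Z X \<and> x b \<in> hom Z Y" for Z x
    using ne obj by (auto simp: is_cone_def J_def F0_def F1_def)
  have Pc: "P \<in> SObj M" "q a \<in> hom P X" "q b \<in> hom P Y"
    using P unfolding is_limit_def cone by auto
  show ?thesis
  proof (rule that[OF Pc])
    fix Z f g assume Z: "Z \<in> SObj M" "f \<in> hom Z X" "g \<in> hom Z Y"
    define z where "z i = (if i = a then f else g)" for i
    have "is_cone J (ucat M) F0 F1 Z z" unfolding cone using ne Z by (simp add: z_def)
    then have "\<exists>!u. u \<in> hom Z P \<and> (\<forall>i\<in>{a, b}. SCmp M Z P (F0 i) 0 (q i) u = z i)"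
      using P unfolding is_limit_def by (simp add: J_def)
    then show "\<exists>!u. u \<in> hom Z P \<and> SCmp M Z P X 0 (q a) u = f \<and> SCmp M Z P Y 0 (q b) u = g"
      using ne by (simp add: z_def F0_def)
  qed
qed

end

text \<open>The pullback of \<open>p\<close> along \<open>g\<close> is realized inside
  \<open>X\<close> as \<open>S\<close>, with projection \<open>q\<close>. This is possible because,
  by \<open>pb\<close>, a simplex of \<open>Y'\<close> is determined by its partner in
  \<open>X\<close>; unlike a set of pairs, it keeps the type of simplices of
  \<open>X\<close>.\<close>

lemma ext_lift_pullback:
  assumes lift: "ext_lift K L X Y p" and K: "\<And>m. L m \<subseteq> Simp K m"
    and g: "simplicial_map Y' Y g"
    and S: "\<And>m x. x \<in> S m \<Longrightarrow> x \<in> Simp X m" and gq: "\<And>m x. x \<in> S m \<Longrightarrow> g m (q m x) = p m x"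
    and pb: "\<And>m x y. x \<in> Simp X m \<Longrightarrow> y \<in> Simp Y' m \<Longrightarrow> p m x = g m y \<Longrightarrow> x \<in> S m \<and> q m x = y"
  shows "ext_lift K L (subsset X S) Y' q"
proof (rule ext_liftI)
  fix u v
  assume u: "simplicial_map (subsset K L) (subsset X S) u" and v: "simplicial_map K Y' v"
    and uv: "\<And>m x. x \<in> L m \<Longrightarrow> q m (u m x) = v m x"
  have uS: "u m x \<in> S m" if "x \<in> L m" for m x using simplicial_map_Simp[OF u, of x m] that by simp
  have 1: "simplicial_map (subsset K L) X u" using u S by (simp add: simplicial_map_def)
  obtain h where h: "simplicial_map K X h" "\<And>m x. x \<in> L m \<Longrightarrow> h m x = u m x"
    "\<And>m x. x \<in> Simp K m \<Longrightarrow> p m (h m x) = g m (v m x)"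
    by (rule ext_liftE[OF lift 1 simplicial_map_comp[OF v g]]) (simp_all add: uS uv flip: gq)
  have *: "h m x \<in> S m \<and> q m (h m x) = v m x" if "x \<in> Simp K m" for m x
    using pb[OF simplicial_map_Simp[OF h(1) that] simplicial_map_Simp[OF v that] h(3)[OF that]] .
  show "\<exists>h. simplicial_map K (subsset X S) h \<and> (\<forall>m. \<forall>x\<in>L m. h m x = u m x) \<and> (\<forall>m. \<forall>x\<in>Simp K m. q m (h m x) = v m x)"
    using h * by (intro exI[of _ h]) (simp add: simplicial_map_def)
qed

lemma triv_fib_pullback:
  assumes p: "triv_fib X Y p" and X': "simplicial_set (subsset X S)" and Y': "simplicial_set Y'"
    and q: "simplicial_map (subsset X S) Y' q" and g: "simplicial_map Y' Y g"
    and S: "\<And>m x. x \<in> S m \<Longrightarrow> x \<in> Simp X m" and gq: "\<And>m x. x \<in> S m \<Longrightarrow> g m (q m x) = p m x"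
    and pb: "\<And>m x y. x \<in> Simp X m \<Longrightarrow> y \<in> Simp Y' m \<Longrightarrow> p m x = g m y \<Longrightarrow> x \<in> S m \<and> q m x = y"
  shows "triv_fib (subsset X S) Y' q"
  unfolding triv_fib_def
proof (intro conjI allI X' Y' q)
  fix n
  show "ext_lift (std_simplex n) (bdry_ops n) (subsset X S) Y' q"
    by (rule ext_lift_pullback[OF _ _ g S gq pb]) (use p bdry_ops_subset in \<open>auto simp: triv_fib_def\<close>)
qed

lemma triv_fib_to_point:
  assumes p: "triv_fib X Y p" and Y: "\<And>n. Simp Y n = {d n}"
  shows "triv_fib X (std_simplex 0) (\<lambda>m _. replicate (Suc m) 0)"
proof -
  have Y': "simplicial_set Y" and X: "simplicial_set X" and pm: "simplicial_map X Y p" using p by (auto simp: triv_fib_def)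
  have "Act Y n \<theta> (d n) = d m" if "\<theta> \<in> Ops m n" for m n \<theta>
    using simplicial_set_Act[OF Y' that, of "d n"] Y by simp
  then have g: "simplicial_map (std_simplex 0) Y (\<lambda>m _. d m)"
    by (simp add: simplicial_map_def Y)
  have "triv_fib (subsset X (Simp X)) (std_simplex 0) (\<lambda>m _. replicate (Suc m) 0)"
  proof (rule triv_fib_pullback[OF p _ simplicial_set_std_simplex _ g])
    show "simplicial_map (subsset X (Simp X)) (std_simplex 0) (\<lambda>m _. replicate (Suc m) 0)"
      by (auto simp: simplicial_map_def op_comp_replicate simp del: replicate_Suc)
    show "d m = p m x" if "x \<in> Simp X m" for m x
      using simplicial_map_Simp[OF pm that] Y by simp
    show "x \<in> Simp X m \<and> replicate (Suc m) 0 = y" if "x \<in> Simp X m" "y \<in> Simp (std_simplex 0) m" for m x and y :: "nat list"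
      using that Ops_0_target[of y m] by simp
  qed (use X in simp_all)
  then show ?thesis by simp
qed

lemma triv_fib_relabel:
  assumes p: "triv_fib X Y f" and e: "inj e" and e': "inj e'"
  shows "triv_fib (relabel e X) (relabel e' Y) (\<lambda>n x. e' (f n (inv e x)))"
proof -
  have fm: "simplicial_map X Y f" using p by (simp add: triv_fib_def)
  have "ext_lift (std_simplex n) (bdry_ops n) (relabel e X) (relabel e' Y) (\<lambda>n x. e' (f n (inv e x)))" for n
  proof (rule ext_liftI)
    fix u v
    assume u: "simplicial_map (subsset (std_simplex n) (bdry_ops n)) (relabel e X) u"
      and v: "simplicial_map (std_simplex n) (relabel e' Y) v"
      and uv: "\<And>m x. x \<in> bdry_ops n m \<Longrightarrow> e' (f m (inv e (u m x))) = v m x"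
    have lift: "ext_lift (std_simplex n) (bdry_ops n) X Y f" using p by (simp add: triv_fib_def)
    have 1: "f m (inv e (u m x)) = inv e' (v m x)" if "x \<in> bdry_ops n m" for m x
      using inv_f_f[OF e'] by (simp flip: uv[OF that])
    obtain h where h: "simplicial_map (std_simplex n) X h" "\<And>m x. x \<in> bdry_ops n m \<Longrightarrow> h m x = inv e (u m x)"
      "\<And>m x. x \<in> Simp (std_simplex n) m \<Longrightarrow> f m (h m x) = inv e' (v m x)"
      by (rule ext_liftE[OF lift simplicial_map_comp[OF u simplicial_map_relabel_inv[OF e]]
          simplicial_map_comp[OF v simplicial_map_relabel_inv[OF e']] 1]) blast+
    have 2: "e (inv e (u m x)) = u m x" if "x \<in> bdry_ops n m" for m x
      using simplicial_map_Simp[OF u, of x m] that e by auto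
    have 3: "e' (inv e' (v m x)) = v m x" if "x \<in> Ops m n" for m x
      using simplicial_map_Simp[OF v, of x m] that e' by auto
    show "\<exists>h. simplicial_map (std_simplex n) (relabel e X) h \<and> (\<forall>m. \<forall>x\<in>bdry_ops n m. h m x = u m x) \<and>
        (\<forall>m. \<forall>x\<in>Simp (std_simplex n) m. e' (f m (inv e (h m x))) = v m x)"
      using simplicial_map_comp[OF h(1) simplicial_map_relabel[OF e]] h(2,3) 2 3 inv_f_f[OF e]
      by (intro exI[of _ "\<lambda>m x. e (h m x)"]) simp
  qed
  then show ?thesis
    using p simplicial_map_comp[OF simplicial_map_comp[OF simplicial_map_relabel_inv[OF e] fm] simplicial_map_relabel[OF e']]
    by (simp add: triv_fib_def simplicial_set_relabel e e')
qed

lemma triv_fib_ident: "simplicial_set X \<Longrightarrow> triv_fib X X (\<lambda>n x. x)"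
  unfolding triv_fib_def
  by (auto intro!: ext_liftI simplicial_map_ident)

text \<open>\<open>weakly_equivalent\<close> tags its arguments differently. The whole zigzag is
  moved along the tag \<open>Inl\<close>, and the identity of the last space, read from
  \<open>Inl\<close> to \<open>Inr\<close>, adds the final step.\<close>

lemma pointed_equivalence_weakly_equivalent:
  fixes P Q :: "'a sset \<times> 'a"
  assumes PQ: "equivclp pointed_triv_fib P Q" and Q: "simplicial_set (fst Q)"
  shows "weakly_equivalent (fst P) (fst Q)"
proof -
  let ?e = "\<lambda>x :: 'a. [Inl x :: 'a + 'a]" and ?e' = "\<lambda>x :: 'a. [Inr x :: 'a + 'a]"
  let ?W = "\<lambda>K L :: ('a + 'a) list sset. \<exists>f. weak_equivalence K L f"
  have e: "inj ?e" "inj ?e'" by (auto simp: inj_on_def)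
  have W: "?W (relabel ?e K) (relabel ?e L)" if "triv_fib K L f" for K L :: "'a sset" and f
    using triv_fib_weak_equivalence[OF triv_fib_relabel[OF that e(1) e(1)]] by blast
  have "equivclp ?W (relabel ?e (fst P)) (relabel ?e (fst Q))"
    using PQ
  proof (induction rule: equivclp_induct)
    case (step Q Q')
    have "?W (relabel ?e (fst Q)) (relabel ?e (fst Q')) \<or> ?W (relabel ?e (fst Q')) (relabel ?e (fst Q))"
      using step(2) W unfolding pointed_triv_fib_def by blast
    then show ?case by (rule equivclp_into_equivclp[OF step.IH])
  qed simp
  moreover have "?W (relabel ?e (fst Q)) (relabel ?e' (fst Q))"
    using triv_fib_weak_equivalence[OF triv_fib_relabel[OF triv_fib_ident[OF Q] e]] by blast
  ultimately show ?thesis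
    unfolding weakly_equivalent_def by (rule equivclp_into_equivclp[OF _ disjI1])
qed

lemma equivclp_loop_space:
  "equivclp pointed_triv_fib P Q \<Longrightarrow> equivclp pointed_triv_fib (loop_space P) (loop_space Q)"
proof (induction rule: equivclp_induct)
  case (step Q Q')
  have "pointed_triv_fib (loop_space Q) (loop_space Q') \<or> pointed_triv_fib (loop_space Q') (loop_space Q)"
    using step(2) pointed_triv_fib_loop_space by blast
  then show ?case by (rule equivclp_into_equivclp[OF step.IH])
qed simp

lemma equivclp_loop_space_funpow:
  "equivclp pointed_triv_fib P Q \<Longrightarrow> equivclp pointed_triv_fib ((loop_space ^^ n) P) ((loop_space ^^ n) Q)"
  by (induction n) (simp_all add: equivclp_loop_space)

lemma span_equivclp:
  "\<exists>G. pointed_triv_fib G P \<and> pointed_triv_fib G Q \<Longrightarrow> equivclp pointed_triv_fib P Q"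
  by (meson converse_r_into_equivclp equivclp_trans r_into_equivclp)

section \<open>Mapping spaces and corner maps\<close>

context smodel
begin

lemma map_terminal_unique: "A \<in> SObj M \<Longrightarrow> is_terminal (ucat M) T \<Longrightarrow>
    f \<in> Simp (SMap M A T) n \<Longrightarrow> g \<in> Simp (SMap M A T) n \<Longrightarrow> f = g"
  using map_to_terminal by blast

lemma map_initial_unique: "A \<in> SObj M \<Longrightarrow> is_initial (ucat M) I \<Longrightarrow>
    f \<in> Simp (SMap M I A) n \<Longrightarrow> g \<in> Simp (SMap M I A) n \<Longrightarrow> f = g"
  using map_from_initial by blast

lemma corner_target_simps [simp]:
  "Simp (corner_target M A B i X Y p) n =
    {z \<in> Simp (SMap M A X) n \<times> Simp (SMap M B Y) n. postcomp M A X Y p n (fst z) = precomp M A B Y i n (snd z)}"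
  "Act (corner_target M A B i X Y p) n \<theta> z = (Act (SMap M A X) n \<theta> (fst z), Act (SMap M B Y) n \<theta> (snd z))"
  by (simp_all add: corner_target_def sset_pullback_def)

lemma corner_kan_fibration:
  assumes "A \<in> SObj M" "B \<in> SObj M" "X \<in> SObj M" "Y \<in> SObj M" "i \<in> Cof M A B" "p \<in> Fib M X Y"
  shows "kan_fibration (SMap M B X) (corner_target M A B i X Y p) (corner_map M A B i X Y p)"
  using model assms unfolding simplicial_model_category_def by blast

lemma corner_weak_equivalence:
  assumes "A \<in> SObj M" "B \<in> SObj M" "X \<in> SObj M" "Y \<in> SObj M" "i \<in> Cof M A B" "p \<in> Fib M X Y"
    and "i \<in> Weq M A B \<or> p \<in> Weq M X Y"
  shows "weak_equivalence (SMap M B X) (corner_target M A B i X Y p) (corner_map M A B i X Y p)"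
  using model assms unfolding simplicial_model_category_def by blast

text \<open>Mapping spaces into a terminal object have one simplex in each degree, so over it the
  corner target is a copy of \<open>SMap M A X\<close>. Pulling back along this map turns statements
  on corner maps into statements on precomposition.\<close>

lemma corner_section_terminal:
  assumes obj: "A \<in> SObj M" "B \<in> SObj M" "X \<in> SObj M" and T: "is_terminal (ucat M) T"
    and i: "i \<in> hom A B" and p: "p \<in> hom X T"
  shows "simplicial_map (SMap M A X) (corner_target M A B i X T p) (\<lambda>m y. (y, THE t. t \<in> Simp (SMap M B T) m))"
proof -
  have To: "T \<in> SObj M" using T by (simp add: is_terminal_def)
  have t: "(THE t. t \<in> Simp (SMap M B T) m) \<in> Simp (SMap M B T) m" for m
    by (rule theI'[OF map_to_terminal[OF obj(2) T]])
  show ?thesis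
  proof (rule simplicial_mapI)
    fix m y assume y: "y \<in> Simp (SMap M A X) m"
    have "postcomp M A X T p m y = precomp M A B T i m (THE t. t \<in> Simp (SMap M B T) m)"
      by (rule map_terminal_unique[OF obj(1) T, where n = m]) (use y t obj To i p in simp_all)
    then show "(y, THE t. t \<in> Simp (SMap M B T) m) \<in> Simp (corner_target M A B i X T p) m"
      using y t by simp
    fix l \<theta> assume \<theta>: "\<theta> \<in> Ops l m"
    have "Act (SMap M B T) m \<theta> (THE t. t \<in> Simp (SMap M B T) m) = (THE t. t \<in> Simp (SMap M B T) l)"
      by (rule map_terminal_unique[OF obj(2) T simplicial_set_Act[OF SMap_sset[OF obj(2) To] \<theta> t] t])
    then show "(Act (SMap M A X) m \<theta> y, THE t. t \<in> Simp (SMap M B T) l) =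
        Act (corner_target M A B i X T p) m \<theta> (y, THE t. t \<in> Simp (SMap M B T) m)" by simp
  qed
qed

lemma precomp_ext_lift:
  assumes obj: "A \<in> SObj M" "B \<in> SObj M" "X \<in> SObj M" and T: "is_terminal (ucat M) T"
    and i: "i \<in> hom A B" and p: "p \<in> hom X T" and L: "\<And>m. L m \<subseteq> Simp K m"
    and lift: "ext_lift K L (SMap M B X) (corner_target M A B i X T p) (corner_map M A B i X T p)"
  shows "ext_lift K L (SMap M B X) (SMap M A X) (precomp M A B X i)"
proof -
  have To: "T \<in> SObj M" using T by (simp add: is_terminal_def)
  have "ext_lift K L (subsset (SMap M B X) (Simp (SMap M B X))) (SMap M A X) (precomp M A B X i)"
  proof (rule ext_lift_pullback[OF lift L corner_section_terminal[OF obj T i p]])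
    show "(precomp M A B X i m x, THE t. t \<in> Simp (SMap M B T) m) = corner_map M A B i X T p m x"
      if x: "x \<in> Simp (SMap M B X) m" for m x
      using the1_equality[OF map_to_terminal[OF obj(2) T] postcomp_Simp[OF obj(2,3) To p x]]
      by (simp add: corner_map_def)
  qed (simp_all add: corner_map_def)
  then show ?thesis by simp
qed

lemma kan_fibration_precomp:
  assumes obj: "A \<in> SObj M" "B \<in> SObj M" "X \<in> SObj M" and X: "fibrant M X" and i: "i \<in> Cof M A B"
  shows "kan_fibration (SMap M B X) (SMap M A X) (precomp M A B X i)"
proof -
  obtain T p where T: "is_terminal (ucat M) T" and p: "p \<in> Fib M X T" using X by (auto simp: fibrant_def)
  have To: "T \<in> SObj M" using T by (simp add: is_terminal_def)
  note ih = cof_hom[OF obj(1,2) i] and ph = fib_hom[OF obj(3) To p]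
  have "ext_lift (std_simplex n) (Simp (horn n k)) (SMap M B X) (SMap M A X) (precomp M A B X i)" if "n \<ge> 1" "k \<le> n" for n k
    by (rule precomp_ext_lift[OF obj T ih ph])
      (use corner_kan_fibration[OF obj To i p] that in \<open>auto simp: kan_fibration_horn horn_def\<close>)
  then show ?thesis
    using precomp_map[OF obj ih] SMap_sset[OF obj(1,3)] SMap_sset[OF obj(2,3)] unfolding kan_fibration_horn by blast
qed

text \<open>The corner map of \<open>p\<close> with the cofibration from an initial object: mapping
  spaces out of that object are points, so the corner target is a copy of
  \<open>SMap M A Y\<close>.\<close>

lemma kan_fibration_postcomp:
  assumes obj: "A \<in> SObj M" "X \<in> SObj M" "Y \<in> SObj M" and A: "cofibrant M A" and p: "p \<in> Fib M X Y"
  shows "kan_fibration (SMap M A X) (SMap M A Y) (postcomp M A X Y p)"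
proof -
  obtain I i where I: "is_initial (ucat M) I" and i: "i \<in> Cof M I A" using A by (auto simp: cofibrant_def)
  have Io: "I \<in> SObj M" using I by (simp add: is_initial_def)
  note ih = cof_hom[OF Io obj(1) i] and ph = fib_hom[OF obj(2,3) p]
  let ?t = "\<lambda>m. THE t. t \<in> Simp (SMap M I X) m"
  have t: "?t m \<in> Simp (SMap M I X) m" for m
    by (rule theI'[OF map_from_initial[OF obj(2) I]])
  have g: "simplicial_map (SMap M A Y) (corner_target M I A i X Y p) (\<lambda>m y. (?t m, y))"
  proof (rule simplicial_mapI)
    fix m y assume y: "y \<in> Simp (SMap M A Y) m"
    have "postcomp M I X Y p m (?t m) = precomp M I A Y i m y"
      by (rule map_initial_unique[OF obj(3) I, where n = m]) (use y t obj Io ih ph in simp_all)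
    then show "(?t m, y) \<in> Simp (corner_target M I A i X Y p) m" using y t by simp
    fix l \<theta> assume \<theta>: "\<theta> \<in> Ops l m"
    have "Act (SMap M I X) m \<theta> (?t m) = ?t l"
      by (rule map_initial_unique[OF obj(2) I simplicial_set_Act[OF SMap_sset[OF Io obj(2)] \<theta> t] t])
    then show "(?t l, Act (SMap M A Y) m \<theta> y) = Act (corner_target M I A i X Y p) m \<theta> (?t m, y)" by simp
  qed
  have "ext_lift (std_simplex n) (Simp (horn n k)) (subsset (SMap M A X) (Simp (SMap M A X))) (SMap M A Y) (postcomp M A X Y p)"
    if "n \<ge> 1" "k \<le> n" for n k
  proof (rule ext_lift_pullback[OF _ _ g])
    show "ext_lift (std_simplex n) (Simp (horn n k)) (SMap M A X) (corner_target M I A i X Y p) (corner_map M I A i X Y p)"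
      using corner_kan_fibration[OF Io obj i p] that by (simp add: kan_fibration_horn)
    show "(?t m, postcomp M A X Y p m x) = corner_map M I A i X Y p m x"
      if x: "x \<in> Simp (SMap M A X) m" for m x
      using the1_equality[OF map_from_initial[OF obj(2) I] precomp_Simp[OF Io obj(1,2) ih x]]
      by (simp add: corner_map_def)
  qed (auto simp: corner_map_def horn_def)
  then show ?thesis
    using postcomp_map[OF obj ph] SMap_sset[OF obj(1,2)] SMap_sset[OF obj(1,3)] unfolding kan_fibration_horn by simp
qed

text \<open>Postcomposition with the map from \<open>X\<close> to a terminal object is a Kan
  fibration over a point.\<close>

lemma kan_complex_map:
  assumes obj: "A \<in> SObj M" "X \<in> SObj M" and A: "cofibrant M A" and X: "fibrant M X"
  shows "kan_complex (SMap M A X)"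
proof -
  obtain T p where T: "is_terminal (ucat M) T" and p: "p \<in> Fib M X T" using X by (auto simp: fibrant_def)
  have To: "T \<in> SObj M" using T by (simp add: is_terminal_def)
  note kan = kan_fibration_postcomp[OF obj To A p]
  have pm: "simplicial_map (SMap M A X) (SMap M A T) (postcomp M A X T p)" using kan by (simp add: kan_fibration_def)
  let ?t = "\<lambda>m (_ :: nat list). THE t. t \<in> Simp (SMap M A T) m"
  have t: "?t m a \<in> Simp (SMap M A T) m" for m a
    by (rule theI'[OF map_to_terminal[OF obj(1) T]])
  show ?thesis
    unfolding kan_complex_def
  proof (intro conjI allI impI)
    show "simplicial_set (SMap M A X)" using obj by simp
    fix n k u assume nk: "1 \<le> n" "k \<le> n" and u: "simplicial_map (horn n k) (SMap M A X) u"
    have "simplicial_map (std_simplex n) (SMap M A T) ?t"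
      by (rule simplicial_mapI[OF t])
        (rule map_terminal_unique[OF obj(1) T t simplicial_set_Act[OF SMap_sset[OF obj(1) To] _ t]])
    moreover have "postcomp M A X T p m (u m \<alpha>) = ?t m \<alpha>" if "\<alpha> \<in> Simp (horn n k) m" for m \<alpha>
      by (rule map_terminal_unique[OF obj(1) T simplicial_map_Simp[OF pm simplicial_map_Simp[OF u that]] t])
    ultimately show "\<exists>h. simplicial_map (std_simplex n) (SMap M A X) h \<and> (\<forall>m. \<forall>\<alpha>\<in>Simp (horn n k) m. h m \<alpha> = u m \<alpha>)"
      using kan nk u unfolding kan_fibration_def by blast
  qed
qed

text \<open>A horn in the pullback is filled in two steps: first its component in the Kan complex
  \<open>SMap M B Y\<close>, then the one in \<open>SMap M A X\<close>, along the Kan fibration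
  induced by \<open>p\<close>.\<close>

lemma kan_complex_corner_target:
  assumes obj: "A \<in> SObj M" "B \<in> SObj M" "X \<in> SObj M" "Y \<in> SObj M" and A: "cofibrant M A" and B: "cofibrant M B"
    and Y: "fibrant M Y" and i: "i \<in> Cof M A B" and p: "p \<in> Fib M X Y"
  shows "kan_complex (corner_target M A B i X Y p)"
proof -
  let ?C = "corner_target M A B i X Y p"
  note ih = cof_hom[OF obj(1,2) i] and ph = fib_hom[OF obj(3,4) p]
  have C: "simplicial_set ?C" using corner_kan_fibration[OF obj i p] by (simp add: kan_fibration_def)
  have kanB: "kan_complex (SMap M B Y)" by (rule kan_complex_map[OF obj(2,4) B Y])
  have kanA: "kan_fibration (SMap M A X) (SMap M A Y) (postcomp M A X Y p)"
    by (rule kan_fibration_postcomp[OF obj(1,3,4) A p])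
  show ?thesis
    unfolding kan_complex_def
  proof (intro conjI allI impI C)
    fix n k u assume nk: "1 \<le> n" "k \<le> n" and u: "simplicial_map (horn n k) ?C u"
    have C1: "simplicial_map ?C (SMap M A X) (\<lambda>m. fst)" and C2: "simplicial_map ?C (SMap M B Y) (\<lambda>m. snd)"
      by (auto simp: simplicial_map_def)
    note u1 = simplicial_map_comp[OF u C1] and u2 = simplicial_map_comp[OF u C2]
    obtain h2 where h2: "simplicial_map (std_simplex n) (SMap M B Y) h2" "\<And>m \<alpha>. \<alpha> \<in> Simp (horn n k) m \<Longrightarrow> h2 m \<alpha> = snd (u m \<alpha>)"
      using kanB nk u2 unfolding kan_complex_def by blast
    have "postcomp M A X Y p m (fst (u m \<alpha>)) = precomp M A B Y i m (h2 m \<alpha>)" if "\<alpha> \<in> Simp (horn n k) m" for m \<alpha>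
      using simplicial_map_Simp[OF u that] h2(2)[OF that] by auto
    then obtain h1 where h1: "simplicial_map (std_simplex n) (SMap M A X) h1" "\<And>m \<alpha>. \<alpha> \<in> Simp (horn n k) m \<Longrightarrow> h1 m \<alpha> = fst (u m \<alpha>)"
      "\<And>m \<alpha>. \<alpha> \<in> Simp (std_simplex n) m \<Longrightarrow> postcomp M A X Y p m (h1 m \<alpha>) = precomp M A B Y i m (h2 m \<alpha>)"
      using kanA[unfolded kan_fibration_def, THEN conjunct2, THEN conjunct2, THEN conjunct2, rule_format,
          OF nk u1 simplicial_map_comp[OF h2(1) precomp_map[OF obj(1,2,4) ih]]] by blast
    have "simplicial_map (std_simplex n) ?C (\<lambda>m \<alpha>. (h1 m \<alpha>, h2 m \<alpha>))"
      using h1(1,3) h2(1) by (simp add: simplicial_map_def)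
    then show "\<exists>h. simplicial_map (std_simplex n) ?C h \<and> (\<forall>m. \<forall>\<alpha>\<in>Simp (horn n k) m. h m \<alpha> = u m \<alpha>)"
      using h1(2) h2(2) by (intro exI[of _ "\<lambda>m \<alpha>. (h1 m \<alpha>, h2 m \<alpha>)"]) simp
  qed
qed

lemma fibrant_source:
  assumes obj: "X \<in> SObj M" "Y \<in> SObj M" and Y: "fibrant M Y" and p: "p \<in> Fib M X Y"
  shows "fibrant M X"
proof -
  obtain T q where "is_terminal (ucat M) T" "q \<in> Fib M Y T" using Y by (auto simp: fibrant_def)
  moreover then have "SCmp M X Y T 0 q p \<in> Fib M X T" using fib_comp obj p by (simp add: is_terminal_def)
  ultimately show ?thesis by (auto simp: fibrant_def)
qed

lemma cofibrant_target:
  assumes obj: "A \<in> SObj M" "B \<in> SObj M" and A: "cofibrant M A" and i: "i \<in> Cof M A B"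
  shows "cofibrant M B"
proof -
  obtain I j where "is_initial (ucat M) I" "j \<in> Cof M I A" using A by (auto simp: cofibrant_def)
  moreover then have "SCmp M I A B 0 i j \<in> Cof M I B" using cof_comp obj i by (simp add: is_initial_def)
  ultimately show ?thesis by (auto simp: cofibrant_def)
qed

text \<open>Cofibrancy of \<open>A\<close> and fibrancy of \<open>Y\<close> make both ends of the
  corner map Kan complexes, as \<open>kan_fibration_weak_equivalence_triv_fib\<close>
  requires.\<close>

lemma triv_fib_corner:
  assumes obj: "A \<in> SObj M" "B \<in> SObj M" "X \<in> SObj M" "Y \<in> SObj M" and A: "cofibrant M A"
    and Y: "fibrant M Y" and i: "i \<in> Cof M A B" and p: "p \<in> Fib M X Y"
    and w: "i \<in> Weq M A B \<or> p \<in> Weq M X Y"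
  shows "triv_fib (SMap M B X) (corner_target M A B i X Y p) (corner_map M A B i X Y p)"
proof (rule kan_fibration_weak_equivalence_triv_fib)
  have B: "cofibrant M B" by (rule cofibrant_target[OF obj(1,2) A i])
  show "kan_complex (SMap M B X)" by (rule kan_complex_map[OF obj(2,3) B fibrant_source[OF obj(3,4) Y p]])
  show "kan_complex (corner_target M A B i X Y p)" by (rule kan_complex_corner_target[OF obj A B Y i p])
qed (use corner_kan_fibration corner_weak_equivalence obj i p w in auto)

lemma fibrant_terminal:
  assumes T: "is_terminal (ucat M) T" shows "fibrant M T"
proof -
  have "T \<in> SObj M" using T by (simp add: is_terminal_def)
  then have "SIde M T \<in> Fib M T T" using iso_fib[of T T "SIde M T" "SIde M T"] by simp
  then show ?thesis using T by (auto simp: fibrant_def)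
qed

lemma triv_fib_precomp:
  assumes obj: "A \<in> SObj M" "B \<in> SObj M" "X \<in> SObj M" and A: "cofibrant M A" and X: "fibrant M X"
    and i: "i \<in> Cof M A B" and w: "i \<in> Weq M A B"
  shows "triv_fib (SMap M B X) (SMap M A X) (precomp M A B X i)"
proof -
  obtain T p where T: "is_terminal (ucat M) T" and p: "p \<in> Fib M X T" using X by (auto simp: fibrant_def)
  have To: "T \<in> SObj M" using T by (simp add: is_terminal_def)
  note ih = cof_hom[OF obj(1,2) i] and ph = fib_hom[OF obj(3) To p]
  have "triv_fib (SMap M B X) (corner_target M A B i X T p) (corner_map M A B i X T p)"
    by (rule triv_fib_corner[OF obj To A fibrant_terminal[OF T] i p]) (use w in simp)
  then have "ext_lift (std_simplex n) (bdry_ops n) (SMap M B X) (SMap M A X) (precomp M A B X i)" for n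
    by (intro precomp_ext_lift[OF obj T ih ph]) (simp_all add: triv_fib_def bdry_ops_subset)
  then show ?thesis
    using precomp_map[OF obj ih] SMap_sset[OF obj(1,3)] SMap_sset[OF obj(2,3)] unfolding triv_fib_def by blast
qed

end

section \<open>Mapping spaces in comma categories\<close>

text \<open>The mapping space of \<open>under M e\<close> with the pairs taken apart, given as sets
  of simplices, so that it becomes a \<open>subsset\<close> of \<open>SMap M A B\<close>.\<close>

definition under_maps :: "('o, 's) smcat \<Rightarrow> 'o \<Rightarrow> 'o \<Rightarrow> 's \<Rightarrow> 'o \<Rightarrow> 's \<Rightarrow> nat \<Rightarrow> 's set" where
  "under_maps M e A a B b n =
     {f \<in> Simp (SMap M A B) n. precomp M e A B a n f = degen (SMap M e B) n b}"

lemma under_simps [simp]: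
  "SObj (under M e) = {X. fst X \<in> SObj M \<and> snd X \<in> Simp (SMap M e (fst X)) 0}"
  "SMap (under M e) X Y = subsset (SMap M (fst X) (fst Y)) (under_maps M e (fst X) (snd X) (fst Y) (snd Y))"
  "SCmp (under M e) X Y Z = SCmp M (fst X) (fst Y) (fst Z)"
  "SIde (under M e) X = SIde M (fst X)"
  "Cof (under M e) X Y = under_maps M e (fst X) (snd X) (fst Y) (snd Y) 0 \<inter> Cof M (fst X) (fst Y)"
  "Fib (under M e) X Y = under_maps M e (fst X) (snd X) (fst Y) (snd Y) 0 \<inter> Fib M (fst X) (fst Y)"
  "Weq (under M e) X Y = under_maps M e (fst X) (snd X) (fst Y) (snd Y) 0 \<inter> Weq M (fst X) (fst Y)"
  by (simp_all add: under_def subsset_def under_maps_def[abs_def])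

lemma degen_subsset [simp]: "degen (subsset B S) = degen B"
  by (simp add: degen_def fun_eq_iff)

context smodel
begin

lemma under_maps_0:
  assumes "e \<in> SObj M" "A \<in> SObj M" "B \<in> SObj M" "a \<in> hom e A" "b \<in> hom e B"
  shows "f \<in> under_maps M e A a B b 0 \<longleftrightarrow> f \<in> hom A B \<and> SCmp M e A B 0 f a = b"
  using assms by (auto simp: under_maps_def precomp_0)

lemma subcomplex_under_maps:
  assumes obj: "e \<in> SObj M" "A \<in> SObj M" "B \<in> SObj M" and a: "a \<in> hom e A" and b: "b \<in> hom e B"
  shows "subcomplex (SMap M A B) (under_maps M e A a B b)"
  using simplicial_set_Act[OF SMap_sset[OF obj(2,3)]] simplicial_map_Act[OF precomp_map[OF obj a]]
    degen_Act[OF SMap_sset[OF obj(1,3)] b]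
  by (auto simp: subcomplex_def under_maps_def)

lemma simplicial_set_under_maps:
  assumes obj: "e \<in> SObj M" "A \<in> SObj M" "B \<in> SObj M" and a: "a \<in> hom e A" and b: "b \<in> hom e B"
  shows "simplicial_set (subsset (SMap M A B) (under_maps M e A a B b))"
  by (rule simplicial_set_subsset[OF SMap_sset[OF obj(2,3)] subcomplex_under_maps[OF assms]])

text \<open>\<open>cofibrant\<close> supplies a cofibration from some initial object, and that
  object is isomorphic to \<open>I\<close>.\<close>

lemma initial_cof:
  assumes I: "is_initial (ucat M) I" and A: "cofibrant M A" "A \<in> SObj M" and a: "a \<in> hom I A"
  shows "a \<in> Cof M I A"
proof -
  obtain J i where J: "is_initial (ucat M) J" and i: "i \<in> Cof M J A" using A by (auto simp: cofibrant_def)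
  have obj: "I \<in> SObj M" "J \<in> SObj M" using I J by (auto simp: is_initial_def)
  obtain t s where t: "t \<in> hom I J" and s: "s \<in> hom J I" using map_from_initial[OF obj(2) I] map_from_initial[OF obj(1) J] by blast
  have "SCmp M I J I 0 s t = SIde M I"
    by (rule map_initial_unique[OF obj(1) I, where n = 0]) (use obj s t in simp_all)
  moreover have "SCmp M J I J 0 t s = SIde M J"
    by (rule map_initial_unique[OF obj(2) J, where n = 0]) (use obj s t in simp_all)
  ultimately have "t \<in> Cof M I J" by (rule iso_cof[OF obj t s])
  then have "SCmp M I J A 0 i t \<in> Cof M I A" using cof_comp[OF obj A(2)] i by blast
  moreover have "SCmp M I J A 0 i t = a"
    by (rule map_initial_unique[OF A(2) I _ a]) (use obj A t cof_hom[OF obj(2) A(2) i] in simp)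
  ultimately show ?thesis by simp
qed

lemma initial_cofibrant:
  assumes I: "is_initial (ucat M) I" shows "cofibrant M I"
proof -
  have "I \<in> SObj M" using I by (simp add: is_initial_def)
  then have "SIde M I \<in> Cof M I I" using iso_cof[of I I "SIde M I" "SIde M I"] by simp
  then show ?thesis using I by (auto simp: cofibrant_def)
qed

text \<open>The structure map of an initial object of the comma category is an isomorphism, with the
  map to \<open>(e, SIde M e)\<close> as inverse. Composed with a cofibration to \<open>Q\<close> it
  gives the structure map of \<open>Q\<close>.\<close>

lemma under_cofibrant:
  assumes e: "e \<in> SObj M" and Q: "Q \<in> SObj (under M e)" and cof: "cofibrant (under M e) Q"
  shows "snd Q \<in> Cof M e (fst Q)"
proof -
  obtain I f where I: "is_initial (ucat (under M e)) I" and f: "f \<in> Cof (under M e) I Q"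
    using cof by (auto simp: cofibrant_def)
  have Io: "fst I \<in> SObj M" "snd I \<in> hom e (fst I)" using I by (auto simp: is_initial_def)
  have Qo: "fst Q \<in> SObj M" "snd Q \<in> hom e (fst Q)" using Q by auto
  have "(e, SIde M e) \<in> SObj (under M e)" using e by simp
  then obtain t where t: "t \<in> Simp (SMap (under M e) I (e, SIde M e)) 0"
    using I unfolding is_initial_def ucat_simps by blast
  have t': "t \<in> hom (fst I) e" "SCmp M e (fst I) e 0 t (snd I) = SIde M e"
    using t by (auto simp: under_maps_0[OF e Io(1) e Io(2) SIde_hom[OF e]])
  have uniq: "g = h" if "g \<in> under_maps M e (fst I) (snd I) (fst I) (snd I) 0" "h \<in> under_maps M e (fst I) (snd I) (fst I) (snd I) 0" for g h
    using I that unfolding is_initial_def by auto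
  note um = under_maps_0[OF e Io(1) Io(1) Io(2) Io(2)]
  have "SCmp M (fst I) e (fst I) 0 (snd I) t = SIde M (fst I)"
    by (rule uniq) (use e Io t' in \<open>simp_all add: um SCmp_assoc\<close>)
  then have "snd I \<in> Cof M e (fst I)" using iso_cof[OF e Io(1) Io(2) t'(1) t'(2)] by simp
  moreover have "f \<in> Cof M (fst I) (fst Q)" "SCmp M e (fst I) (fst Q) 0 f (snd I) = snd Q"
    using f by (auto simp: under_maps_0[OF e Io(1) Qo(1) Io(2) Qo(2)])
  ultimately show ?thesis using cof_comp[OF e Io(1) Qo(1)] by metis
qed

text \<open>The underlying object of a terminal object of the comma category is isomorphic to
  \<open>T\<close>, so a fibration to the former composes to one to the latter.\<close>

lemma under_fibrant:
  assumes e: "e \<in> SObj M" and T: "is_terminal (ucat M) T" and R: "R \<in> SObj (under M e)" and fib: "fibrant (under M e) R"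
  shows "fibrant M (fst R)"
proof -
  obtain T' f where T': "is_terminal (ucat (under M e)) T'" and f: "f \<in> Fib (under M e) R T'"
    using fib by (auto simp: fibrant_def)
  have To: "T \<in> SObj M" using T by (simp add: is_terminal_def)
  have To': "fst T' \<in> SObj M" "snd T' \<in> hom e (fst T')" using T' by (auto simp: is_terminal_def)
  have Ro: "fst R \<in> SObj M" "snd R \<in> hom e (fst R)" using R by auto
  obtain b where b: "b \<in> hom e T" using map_to_terminal[OF e T] by blast
  obtain t where t: "t \<in> hom (fst T') T" using map_to_terminal[OF To'(1) T] by blast
  have "(T, b) \<in> SObj (under M e)" using To b by simp
  then obtain s where s: "s \<in> Simp (SMap (under M e) (T, b) T') 0"
    using T' unfolding is_terminal_def ucat_simps by blast
  have s': "s \<in> hom T (fst T')" "SCmp M e T (fst T') 0 s b = snd T'"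
    using s by (auto simp: under_maps_0[OF e To To'(1) b To'(2)])
  have uniq: "g = h" if "g \<in> under_maps M e (fst T') (snd T') (fst T') (snd T') 0" "h \<in> under_maps M e (fst T') (snd T') (fst T') (snd T') 0" for g h
    using T' that unfolding is_terminal_def by auto
  note um = under_maps_0[OF e To'(1) To'(1) To'(2) To'(2)]
  have tb: "SCmp M e (fst T') T 0 t (snd T') = b"
    by (rule map_terminal_unique[OF e T _ b]) (use e To To' t in simp)
  have st: "SCmp M (fst T') T (fst T') 0 s t = SIde M (fst T')"
    by (rule uniq) (use e To To' t s' tb in \<open>simp_all add: um SCmp_assoc\<close>)
  have ts: "SCmp M T (fst T') T 0 t s = SIde M T"
    by (rule map_terminal_unique[OF To T, where n = 0]) (use To To' t s' in simp_all)
  have "t \<in> Fib M (fst T') T" by (rule iso_fib[OF To'(1) To t s'(1) st ts])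
  moreover have "f \<in> Fib M (fst R) (fst T')" using f by simp
  ultimately have "SCmp M (fst R) (fst T') T 0 t f \<in> Fib M (fst R) T" using fib_comp[OF Ro(1) To'(1) To] by blast
  then show ?thesis using T by (auto simp: fibrant_def)
qed

text \<open>As \<open>c\<close> is \<open>k\<close> after \<open>a\<close>, a map out of
  \<open>C\<close> lies under \<open>e\<close> iff its restriction along \<open>k\<close> does. So
  this is a pullback of the trivial fibration induced by \<open>k\<close>.\<close>

lemma pointed_triv_fib_under_precomp:
  assumes obj: "e \<in> SObj M" "A \<in> SObj M" "C \<in> SObj M" "R \<in> SObj M" and A: "cofibrant M A" and R: "fibrant M R"
    and a: "a \<in> hom e A" and k: "k \<in> Cof M A C" "k \<in> Weq M A C" and y: "y \<in> hom C R"
    and c: "c = SCmp M e A C 0 k a" and s: "s = SCmp M e C R 0 y c" and w: "w = SCmp M A C R 0 y k"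
  shows "pointed_triv_fib (SMap (under M e) (C, c) (R, s), y) (SMap (under M e) (A, a) (R, s), w)"
proof -
  have kh: "k \<in> hom A C" using cof_hom[OF obj(2,3) k(1)] .
  have ch: "c \<in> hom e C" using obj a kh by (simp add: c)
  have sh: "s \<in> hom e R" using obj ch y by (simp add: s)
  have fp: "triv_fib (SMap M C R) (SMap M A R) (precomp M A C R k)"
    by (rule triv_fib_precomp[OF obj(2,3,4) A R k])
  have pc: "precomp M e C R c n f = precomp M e A R a n (precomp M A C R k n f)" if "f \<in> Simp (SMap M C R) n" for n f
    unfolding c using precomp_precomp[OF obj a kh that] by simp
  have "triv_fib (subsset (SMap M C R) (under_maps M e C c R s)) (subsset (SMap M A R) (under_maps M e A a R s)) (precomp M A C R k)"
  proof (rule triv_fib_pullback[OF fp simplicial_set_under_maps[OF obj(1,3,4) ch sh] simplicial_set_under_maps[OF obj(1,2,4) a sh],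
        where g = "\<lambda>n x. x"])
    show "simplicial_map (subsset (SMap M C R) (under_maps M e C c R s)) (subsset (SMap M A R) (under_maps M e A a R s)) (precomp M A C R k)"
      using precomp_map[OF obj(2,3,4) kh] pc obj kh by (auto simp: simplicial_map_def under_maps_def)
    show "simplicial_map (subsset (SMap M A R) (under_maps M e A a R s)) (SMap M A R) (\<lambda>n x. x)"
      by (simp add: simplicial_map_def under_maps_def)
    show "x \<in> Simp (SMap M C R) m" if "x \<in> under_maps M e C c R s m" for m x
      using that by (simp add: under_maps_def)
    show "x \<in> under_maps M e C c R s m \<and> precomp M A C R k m x = y"
      if "x \<in> Simp (SMap M C R) m" "y \<in> Simp (subsset (SMap M A R) (under_maps M e A a R s)) m" "precomp M A C R k m x = y" for m x y
      using that pc[OF that(1)] by (auto simp: under_maps_def)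
  qed (simp add: under_maps_def)
  moreover have "y \<in> under_maps M e C c R s 0" using obj ch sh y by (simp add: under_maps_0 s)
  moreover have "precomp M A C R k 0 y = w" using obj kh by (simp add: precomp_0 w)
  ultimately show ?thesis by (auto simp: pointed_triv_fib_def)
qed

text \<open>Factoring \<open>A \<squnion>\<^sub>e B \<rightarrow> Z\<close> yields an object \<open>C\<close> under \<open>e\<close> with trivial cofibrations from \<open>A\<close> and
  \<open>B\<close>; dually, replacements \<open>R\<close> and \<open>R'\<close> are compared below through a factorization of \<open>X \<rightarrow> R \<times> R'\<close>.\<close>

lemma change_source:
  assumes obj: "e \<in> SObj M" "A \<in> SObj M" "B \<in> SObj M" "Z \<in> SObj M" "R \<in> SObj M"
    and e: "cofibrant M e" and R: "fibrant M R" and a: "a \<in> Cof M e A" and b: "b \<in> Cof M e B"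
    and v: "v \<in> Weq M A Z" and w: "w \<in> Weq M B Z" and vw: "SCmp M e A Z 0 v a = SCmp M e B Z 0 w b"
    and z: "z \<in> hom Z R" and s: "s = SCmp M e Z R 0 z (SCmp M e A Z 0 v a)"
  shows "equivclp pointed_triv_fib (SMap (under M e) (A, a) (R, s), SCmp M A Z R 0 z v) (SMap (under M e) (B, b) (R, s), SCmp M B Z R 0 z w)"
proof -
  note ah = cof_hom[OF obj(1,2) a] and bh = cof_hom[OF obj(1,3) b] and vh = weq_hom[OF obj(2,4) v] and wh = weq_hom[OF obj(3,4) w]
  obtain W j k where po: "is_pushout (ucat M) e A B W a b j k" using pushout_exists[OF obj(1,2,3) ah bh] .
  have W: "W \<in> SObj M" "j \<in> hom A W" "k \<in> hom B W" "SCmp M e A W 0 j a = SCmp M e B W 0 k b"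
    using po by (auto simp: is_pushout_def)
  have jc: "j \<in> Cof M A W" by (rule pushout_cof[OF pushout_sym[OF po] b])
  have kc: "k \<in> Cof M B W" by (rule pushout_cof[OF po a])
  obtain m where m: "m \<in> hom W Z" "SCmp M A W Z 0 m j = v" "SCmp M B W Z 0 m k = w"
    using po vh wh vw obj(4) unfolding is_pushout_def ucat_simps by blast
  \<comment> \<open>Since \<open>t\<close> is a weak equivalence, two-out-of-three against
    \<open>v\<close> and \<open>w\<close> makes the cofibrations from \<open>A\<close> and
    \<open>B\<close> into \<open>C\<close> trivial.\<close>
  obtain C i t where C: "C \<in> SObj M" "i \<in> Cof M W C" "t \<in> Fib M C Z" "t \<in> Weq M C Z" "m = SCmp M W C Z 0 t i"
    using factor_cof_tfib[OF W(1) obj(4) m(1)] .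
  note ih = cof_hom[OF W(1) C(1,2)] and th = fib_hom[OF C(1) obj(4) C(3)]
  let ?j = "SCmp M A W C 0 i j" and ?k = "SCmp M B W C 0 i k"
  have tj: "SCmp M A C Z 0 t ?j = v" using m C(5) SCmp_assoc[OF obj(2) W(1) C(1) obj(4) W(2) ih th] by simp
  have tk: "SCmp M B C Z 0 t ?k = w" using m C(5) SCmp_assoc[OF obj(3) W(1) C(1) obj(4) W(3) ih th] by simp
  have jh: "?j \<in> hom A C" and kh: "?k \<in> hom B C" using obj W C ih by simp_all
  have j': "?j \<in> Cof M A C" "?j \<in> Weq M A C"
    using cof_comp[OF obj(2) W(1) C(1) jc C(2)] weq_cancel_left[OF obj(2) C(1) obj(4) jh C(4)] tj v by auto
  have k': "?k \<in> Cof M B C" "?k \<in> Weq M B C"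
    using cof_comp[OF obj(3) W(1) C(1) kc C(2)] weq_cancel_left[OF obj(3) C(1) obj(4) kh C(4)] tk w by auto
  let ?c = "SCmp M e A C 0 ?j a" and ?y = "SCmp M C Z R 0 z t"
  have c: "?c = SCmp M e B C 0 ?k b"
    using SCmp_assoc[OF obj(1,2) W(1) C(1) ah W(2) ih] SCmp_assoc[OF obj(1,3) W(1) C(1) bh W(3) ih] W(4) by simp
  have yh: "?y \<in> hom C R" using obj C z th by simp
  have ch: "?c \<in> hom e C" using obj C ah jh by simp
  have s': "s = SCmp M e C R 0 ?y ?c"
    unfolding s using SCmp_assoc[OF obj(1) C(1) obj(4,5) ch th z] SCmp_assoc[OF obj(1,2) C(1) obj(4) ah jh th] tj by simp
  have 1: "pointed_triv_fib (SMap (under M e) (C, ?c) (R, s), ?y) (SMap (under M e) (A, a) (R, s), SCmp M A Z R 0 z v)"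
    by (rule pointed_triv_fib_under_precomp[OF obj(1,2) C(1) obj(5) cofibrant_target[OF obj(1,2) e a] R ah j' yh refl s'])
      (use SCmp_assoc[OF obj(2) C(1) obj(4,5) jh th z] tj in simp)
  have 2: "pointed_triv_fib (SMap (under M e) (C, ?c) (R, s), ?y) (SMap (under M e) (B, b) (R, s), SCmp M B Z R 0 z w)"
    by (rule pointed_triv_fib_under_precomp[OF obj(1,3) C(1) obj(5) cofibrant_target[OF obj(1,3) e b] R bh k' yh c s'])
      (use SCmp_assoc[OF obj(3) C(1) obj(4,5) kh th z] tk in simp)
  show ?thesis using 1 2 by (intro span_equivclp) blast
qed

text \<open>The map is the pullback of the corner map of \<open>a\<close> and \<open>p\<close> along
  the map that pairs a simplex with the degenerate simplex on \<open>s\<close>.\<close>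

lemma pointed_triv_fib_under_postcomp:
  assumes obj: "e \<in> SObj M" "A \<in> SObj M" "Y \<in> SObj M" "R \<in> SObj M" and e: "cofibrant M e" and R: "fibrant M R"
    and a: "a \<in> Cof M e A" and p: "p \<in> Fib M Y R" "p \<in> Weq M Y R" and y: "y \<in> hom A Y"
    and s: "s = SCmp M e A Y 0 y a" and s': "s' = SCmp M e Y R 0 p s" and y': "y' = SCmp M A Y R 0 p y"
  shows "pointed_triv_fib (SMap (under M e) (A, a) (Y, s), y) (SMap (under M e) (A, a) (R, s'), y')"
proof -
  note ah = cof_hom[OF obj(1,2) a] and ph = fib_hom[OF obj(3,4) p(1)]
  have sh: "s \<in> hom e Y" using obj ah y by (simp add: s)
  have sh': "s' \<in> hom e R" using obj sh ph by (simp add: s')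
  have fp: "triv_fib (SMap M A Y) (corner_target M e A a Y R p) (corner_map M e A a Y R p)"
    by (rule triv_fib_corner[OF obj(1,2,3,4) e R a p(1)]) (use p in simp)
  let ?g = "\<lambda>n x. (degen (SMap M e Y) n s, x)"
  have "triv_fib (subsset (SMap M A Y) (under_maps M e A a Y s)) (subsset (SMap M A R) (under_maps M e A a R s')) (postcomp M A Y R p)"
  proof (rule triv_fib_pullback[OF fp simplicial_set_under_maps[OF obj(1,2,3) ah sh] simplicial_set_under_maps[OF obj(1,2,4) ah sh'],
        where g = ?g])
    have "postcomp M A Y R p n f \<in> under_maps M e A a R s' n" if f: "f \<in> under_maps M e A a Y s n" for n f
      using f postcomp_precomp[OF obj(1,2,3,4) ah ph, of f n, symmetric] postcomp_degen[OF obj(1,3,4) ph sh] obj ph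
      by (auto simp: under_maps_def s')
    then show "simplicial_map (subsset (SMap M A Y) (under_maps M e A a Y s)) (subsset (SMap M A R) (under_maps M e A a R s')) (postcomp M A Y R p)"
      using postcomp_map[OF obj(2,3,4) ph] by (auto simp: simplicial_map_def under_maps_def)
    show "simplicial_map (subsset (SMap M A R) (under_maps M e A a R s')) (corner_target M e A a Y R p) ?g"
      using postcomp_degen[OF obj(1,3,4) ph sh] degen_Act[OF SMap_sset[OF obj(1,3)] sh] obj sh
      by (auto simp: simplicial_map_def under_maps_def s')
    show "x \<in> Simp (SMap M A Y) m" if "x \<in> under_maps M e A a Y s m" for m x
      using that by (simp add: under_maps_def)
    show "?g m (postcomp M A Y R p m x) = corner_map M e A a Y R p m x" if "x \<in> under_maps M e A a Y s m" for m x
      using that by (simp add: under_maps_def corner_map_def)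
    show "x \<in> under_maps M e A a Y s m \<and> postcomp M A Y R p m x = y"
      if "x \<in> Simp (SMap M A Y) m" "corner_map M e A a Y R p m x = ?g m y" for m x y
      using that by (simp add: under_maps_def corner_map_def)
  qed
  moreover have "y \<in> under_maps M e A a Y s 0" using obj ah sh y by (simp add: under_maps_0 s)
  moreover have "postcomp M A Y R p 0 y = y'" using obj ph by (simp add: postcomp_0 y')
  ultimately show ?thesis by (auto simp: pointed_triv_fib_def)
qed

text \<open>The projection is a base change of the fibration from \<open>Y\<close> to a terminal
  object: in a lift to \<open>P\<close> one component is given, and the other comes from fibrancy of
  \<open>Y\<close>.\<close>

lemma product_projection_fib:
  assumes obj: "X \<in> SObj M" "Y \<in> SObj M" "P \<in> SObj M" and \<pi>: "\<pi> \<in> hom P X" and \<rho>: "\<rho> \<in> hom P Y"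
    and univ: "\<And>Z f g. Z \<in> SObj M \<Longrightarrow> f \<in> hom Z X \<Longrightarrow> g \<in> hom Z Y \<Longrightarrow>
      \<exists>!u. u \<in> hom Z P \<and> SCmp M Z P X 0 \<pi> u = f \<and> SCmp M Z P Y 0 \<rho> u = g"
    and Y: "fibrant M Y"
  shows "\<pi> \<in> Fib M P X"
proof (rule fibI[OF obj(3,1) \<pi>])
  obtain T q where T: "is_terminal (ucat M) T" and q: "q \<in> Fib M Y T" using Y by (auto simp: fibrant_def)
  have To: "T \<in> SObj M" using T by (simp add: is_terminal_def)
  note qh = fib_hom[OF obj(2) To q]
  fix A B i u v assume A: "A \<in> SObj M" "B \<in> SObj M" "i \<in> Cof M A B" "i \<in> Weq M A B" "i \<in> hom A B"
    and uv: "u \<in> hom A P" "v \<in> hom B X" "SCmp M A P X 0 \<pi> u = SCmp M A B X 0 v i"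
  obtain t where t: "t \<in> hom B T" using map_to_terminal[OF A(2) T] by blast
  have \<rho>u: "SCmp M A P Y 0 \<rho> u \<in> hom A Y" using A obj uv \<rho> by simp
  have "SCmp M A Y T 0 q (SCmp M A P Y 0 \<rho> u) = SCmp M A B T 0 t i"
    by (rule map_terminal_unique[OF A(1) T, where n = 0]) (use A obj To qh \<rho>u t in simp_all)
  then obtain h where h: "h \<in> hom B Y" "SCmp M A B Y 0 h i = SCmp M A P Y 0 \<rho> u"
    using lift_tcof_fib[OF A(1,2) obj(2) To A(3,4) q \<rho>u t] by blast
  obtain w where w: "w \<in> hom B P" "SCmp M B P X 0 \<pi> w = v" "SCmp M B P Y 0 \<rho> w = h"
    using univ[OF A(2) uv(2) h(1)] by blast
  have "\<exists>!x. x \<in> hom A P \<and> SCmp M A P X 0 \<pi> x = SCmp M A P X 0 \<pi> u \<and> SCmp M A P Y 0 \<rho> x = SCmp M A P Y 0 \<rho> u"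
    by (rule univ) (use A obj \<pi> \<rho> uv(1) in simp_all)
  moreover have "SCmp M A P X 0 \<pi> (SCmp M A B P 0 w i) = SCmp M A P X 0 \<pi> u"
    using SCmp_assoc[OF A(1,2) obj(3,1) A(5) w(1) \<pi>] w(2) uv(3) by simp
  moreover have "SCmp M A P Y 0 \<rho> (SCmp M A B P 0 w i) = SCmp M A P Y 0 \<rho> u"
    using SCmp_assoc[OF A(1,2) obj(3,2) A(5) w(1) \<rho>] w(3) h(2) by simp
  moreover have "SCmp M A B P 0 w i \<in> hom A P" using A obj w by simp
  ultimately have "SCmp M A B P 0 w i = u" using uv(1) by blast
  then show "\<exists>h\<in>hom B P. SCmp M A B P 0 h i = u \<and> SCmp M B P X 0 \<pi> h = v" using w by blast
qed

lemma change_target: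
  assumes obj: "e \<in> SObj M" "A \<in> SObj M" "X \<in> SObj M" "R \<in> SObj M" "R' \<in> SObj M"
    and e: "cofibrant M e" and R: "fibrant M R" and R': "fibrant M R'" and a: "a \<in> Cof M e A"
    and r: "r \<in> Weq M X R" and r': "r' \<in> Weq M X R'" and z: "z \<in> hom A X"
    and s: "s = SCmp M e X R 0 r (SCmp M e A X 0 z a)" and s': "s' = SCmp M e X R' 0 r' (SCmp M e A X 0 z a)"
  shows "equivclp pointed_triv_fib (SMap (under M e) (A, a) (R, s), SCmp M A X R 0 r z) (SMap (under M e) (A, a) (R', s'), SCmp M A X R' 0 r' z)"
proof -
  note ah = cof_hom[OF obj(1,2) a] and rh = weq_hom[OF obj(3,4) r] and rh' = weq_hom[OF obj(3,5) r']
  obtain P \<pi> \<rho> where P: "P \<in> SObj M" "\<pi> \<in> hom P R" "\<rho> \<in> hom P R'"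
    and univ: "\<And>Z f g. Z \<in> SObj M \<Longrightarrow> f \<in> hom Z R \<Longrightarrow> g \<in> hom Z R' \<Longrightarrow>
      \<exists>!u. u \<in> hom Z P \<and> SCmp M Z P R 0 \<pi> u = f \<and> SCmp M Z P R' 0 \<rho> u = g"
    using product_exists[OF obj(4,5)] by metis
  have \<pi>: "\<pi> \<in> Fib M P R" by (rule product_projection_fib[OF obj(4,5) P univ R'])
  have \<rho>: "\<rho> \<in> Fib M P R'"
    by (rule product_projection_fib[OF obj(5,4) P(1,3,2) _ R]) (use univ in \<open>simp add: conj_commute\<close>)
  obtain m where m: "m \<in> hom X P" "SCmp M X P R 0 \<pi> m = r" "SCmp M X P R' 0 \<rho> m = r'"
    using univ[OF obj(3) rh rh'] by blast
  obtain Y i t where Y: "Y \<in> SObj M" "i \<in> Cof M X Y" "i \<in> Weq M X Y" "t \<in> Fib M Y P" "m = SCmp M X Y P 0 t i"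
    using factor_tcof_fib[OF obj(3) P(1) m(1)] .
  note ih = cof_hom[OF obj(3) Y(1,2)] and th = fib_hom[OF Y(1) P(1) Y(4)]
  \<comment> \<open>Composed with the trivial cofibration \<open>i\<close> these give
    \<open>r\<close> and \<open>r'\<close>, so both are trivial fibrations out of the same object
    \<open>Y\<close>.\<close>
  let ?p = "SCmp M Y P R 0 \<pi> t" and ?q = "SCmp M Y P R' 0 \<rho> t"
  have pi: "SCmp M X Y R 0 ?p i = r" using SCmp_assoc[OF obj(3) Y(1) P(1) obj(4) ih th P(2)] Y(5) m by simp
  have qi: "SCmp M X Y R' 0 ?q i = r'" using SCmp_assoc[OF obj(3) Y(1) P(1) obj(5) ih th P(3)] Y(5) m by simp
  have ph: "?p \<in> hom Y R" and qh: "?q \<in> hom Y R'" using obj Y P th by simp_all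
  have p': "?p \<in> Fib M Y R" "?p \<in> Weq M Y R"
    using fib_comp[OF Y(1) P(1) obj(4) Y(4) \<pi>] weq_cancel_right[OF obj(3) Y(1) obj(4) Y(3) ph] pi r by auto
  have q': "?q \<in> Fib M Y R'" "?q \<in> Weq M Y R'"
    using fib_comp[OF Y(1) P(1) obj(5) Y(4) \<rho>] weq_cancel_right[OF obj(3) Y(1) obj(5) Y(3) qh] qi r' by auto
  let ?y = "SCmp M A X Y 0 i z" and ?za = "SCmp M e A X 0 z a"
  have zah: "?za \<in> hom e X" using obj z ah by simp
  have yh: "?y \<in> hom A Y" using obj Y z ih by simp
  have ya: "SCmp M e A Y 0 ?y a = SCmp M e X Y 0 i ?za" by (rule SCmp_assoc[OF obj(1,2,3) Y(1) ah z ih])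
  have 1: "pointed_triv_fib (SMap (under M e) (A, a) (Y, SCmp M e A Y 0 ?y a), ?y) (SMap (under M e) (A, a) (R, s), SCmp M A X R 0 r z)"
    by (rule pointed_triv_fib_under_postcomp[OF obj(1,2) Y(1) obj(4) e R a p' yh refl])
      (use SCmp_assoc[OF obj(1,3) Y(1) obj(4) zah ih ph] SCmp_assoc[OF obj(2,3) Y(1) obj(4) z ih ph] pi in \<open>simp_all add: s ya\<close>)
  have 2: "pointed_triv_fib (SMap (under M e) (A, a) (Y, SCmp M e A Y 0 ?y a), ?y) (SMap (under M e) (A, a) (R', s'), SCmp M A X R' 0 r' z)"
    by (rule pointed_triv_fib_under_postcomp[OF obj(1,2) Y(1) obj(5) e R' a q' yh refl])
      (use SCmp_assoc[OF obj(1,3) Y(1) obj(5) zah ih qh] SCmp_assoc[OF obj(2,3) Y(1) obj(5) z ih qh] qi in \<open>simp_all add: s' ya\<close>)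
  show ?thesis using 1 2 by (intro span_equivclp) blast
qed

text \<open>\<open>Map\<^bsub>P/M\<^esub>(D', R)\<close> is the fibre of a fibration from the contractible space
  \<open>Map\<^bsub>D/M\<^esub>(D', R)\<close> to \<open>Map\<^bsub>S/M\<^esub>(D, R)\<close>; \<open>P\<close> is the sphere glued from two copies of
  the disk \<open>D\<close> along \<open>S\<close>, and \<open>D'\<close> the next disk.\<close>

lemma disk_loop_space:
  assumes obj: "S \<in> SObj M" "D \<in> SObj M" "D' \<in> SObj M" "R \<in> SObj M"
    and S: "cofibrant M S" and R: "fibrant M R" and i: "i \<in> Cof M S D"
    and po: "is_pushout (ucat M) S D D P i i u v" and j: "j \<in> Cof M P D'" and c: "c \<in> Weq M D' D"
    and u: "SCmp M D P D 0 (SCmp M P D' D 0 c j) u = SIde M D" and v: "SCmp M D P D 0 (SCmp M P D' D 0 c j) v = SIde M D"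
    and x: "x \<in> hom D R"
  shows "equivclp pointed_triv_fib
    (loop_space (SMap (under M S) (D, i) (R, SCmp M S D R 0 x i), x))
    (SMap (under M P) (D', j) (R, SCmp M P D' R 0 (SCmp M D' D R 0 x c) j), SCmp M D' D R 0 x c)"
proof -
  have P: "P \<in> SObj M" "u \<in> hom D P" "v \<in> hom D P" "SCmp M S D P 0 u i = SCmp M S D P 0 v i"
    using po by (auto simp: is_pushout_def)
  note ih = cof_hom[OF obj(1,2) i] and jh = cof_hom[OF P(1) obj(3) j] and chh = weq_hom[OF obj(3,2) c]
  let ?ju = "SCmp M D P D' 0 j u" and ?jv = "SCmp M D P D' 0 j v" and ?xc = "SCmp M D' D R 0 x c"
  have D: "cofibrant M D" by (rule cofibrant_target[OF obj(1,2) S i])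
  have juh: "?ju \<in> hom D D'" and jvh: "?jv \<in> hom D D'" and xch: "?xc \<in> hom D' R" and xih: "SCmp M S D R 0 x i \<in> hom S R"
    using obj P jh x chh ih by simp_all
  have cju: "SCmp M D D' D 0 c ?ju = SIde M D" using SCmp_assoc[OF obj(2) P(1) obj(3,2) P(2) jh chh] u by simp
  have cjv: "SCmp M D D' D 0 c ?jv = SIde M D" using SCmp_assoc[OF obj(2) P(1) obj(3,2) P(3) jh chh] v by simp
  \<comment> \<open>The weak equivalence \<open>c\<close> retracts \<open>D'\<close> onto this copy
    of \<open>D\<close>, so the inclusion of the copy is a weak equivalence.\<close>
  have ju: "?ju \<in> Cof M D D'" "?ju \<in> Weq M D D'"
    using cof_comp[OF obj(2) P(1) obj(3) pushout_cof[OF pushout_sym[OF po] i] j]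
      weq_cancel_left[OF obj(2,3,2) juh c] cju weq_id[OF obj(2)] by auto
  have xcju: "SCmp M D D' R 0 ?xc ?ju = x" using SCmp_assoc[OF obj(2,3,2,4) juh chh x] cju obj x by simp
  have xcjv: "SCmp M D D' R 0 ?xc ?jv = x" using SCmp_assoc[OF obj(2,3,2,4) jvh chh x] cjv obj x by simp
  \<comment> \<open>In \<open>?E\<close> the restriction to the copy \<open>u\<close> is fixed as
    \<open>x\<close>; \<open>?p\<close> restricts to the copy \<open>v\<close>. Its values lie in
    \<open>?B\<close>, because the two copies share their restriction to \<open>S\<close>.\<close>
  let ?E = "subsset (SMap M D' R) (under_maps M D D' ?ju R x)"
  let ?B = "subsset (SMap M D R) (under_maps M S D i R (SCmp M S D R 0 x i))"
  let ?p = "precomp M D D' R ?jv"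
  have pu: "precomp M D P R u m (precomp M P D' R j m f) = precomp M D D' R ?ju m f"
    and pv: "precomp M D P R v m (precomp M P D' R j m f) = ?p m f" if "f \<in> Simp (SMap M D' R) m" for m f
    using precomp_precomp[OF obj(2) P(1) obj(3,4) P(2) jh that] precomp_precomp[OF obj(2) P(1) obj(3,4) P(3) jh that] by simp_all
  have xi: "precomp M S D R i m (degen (SMap M D R) m x) = degen (SMap M S R) m (SCmp M S D R 0 x i)" for m
    by (rule precomp_degen[OF obj(1,2,4) ih x])
  have E: "simplicial_set ?E" by (rule simplicial_set_under_maps[OF obj(2,3,4) juh x])
  have B: "simplicial_set ?B" by (rule simplicial_set_under_maps[OF obj(1,2,4) ih xih])
  have agree: "precomp M S D R i m (precomp M D P R u m w) = precomp M S D R i m (precomp M D P R v m w)"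
    if "w \<in> Simp (SMap M P R) m" for m w
    using precomp_precomp[OF obj(1,2) P(1) obj(4) ih P(2) that] precomp_precomp[OF obj(1,2) P(1) obj(4) ih P(3) that] P(4) by simp
  have pB: "?p m f \<in> under_maps M S D i R (SCmp M S D R 0 x i) m" if "f \<in> under_maps M D D' ?ju R x m" for m f
  proof -
    have f: "f \<in> Simp (SMap M D' R) m" "precomp M D D' R ?ju m f = degen (SMap M D R) m x"
      using that by (auto simp: under_maps_def)
    then show ?thesis
      using agree[of "precomp M P D' R j m f" m] pu[OF f(1)] pv[OF f(1)] xi obj P jh jvh by (simp add: under_maps_def)
  qed
  have pm: "simplicial_map ?E ?B ?p"
    using precomp_map[OF obj(2,3,4) jvh] pB by (auto simp: simplicial_map_def under_maps_def[of M D])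
  \<comment> \<open>Gluing the degenerate simplex on \<open>x\<close>, on the copy \<open>u\<close>,
    with \<open>y\<close> on the copy \<open>v\<close> maps \<open>?B\<close> into
    \<open>SMap M P R\<close>; this uses the pushout property in every simplicial dimension.\<close>
  define g where "g m y = (THE w. w \<in> Simp (SMap M P R) m \<and> precomp M D P R u m w = degen (SMap M D R) m x \<and> precomp M D P R v m w = y)" for m y
  have ex1: "\<exists>!w. w \<in> Simp (SMap M P R) m \<and> precomp M D P R u m w = degen (SMap M D R) m x \<and> precomp M D P R v m w = y"
    if "y \<in> under_maps M S D i R (SCmp M S D R 0 x i) m" for m y
    by (rule enriched_pushout[OF po obj(4)]) (use that obj x xi in \<open>auto simp: under_maps_def\<close>)
  have g: "g m y \<in> Simp (SMap M P R) m" "precomp M D P R u m (g m y) = degen (SMap M D R) m x" "precomp M D P R v m (g m y) = y"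
    if "y \<in> under_maps M S D i R (SCmp M S D R 0 x i) m" for m y
    using theI'[OF ex1[OF that]] unfolding g_def by blast+
  have g_eq: "g m y = w" if "y \<in> under_maps M S D i R (SCmp M S D R 0 x i) m" "w \<in> Simp (SMap M P R) m"
      "precomp M D P R u m w = degen (SMap M D R) m x" "precomp M D P R v m w = y" for m y w
    unfolding g_def by (rule the1_equality[OF ex1[OF that(1)]]) (use that in simp)
  have gm: "simplicial_map ?B (SMap M P R) g"
  proof (rule simplicial_mapI)
    fix m y assume "y \<in> Simp ?B m"
    then have y: "y \<in> under_maps M S D i R (SCmp M S D R 0 x i) m" by simp
    show "g m y \<in> Simp (SMap M P R) m" by (rule g(1)[OF y])
    fix l \<theta> assume \<theta>: "\<theta> \<in> Ops l m"
    show "g l (Act ?B m \<theta> y) = Act (SMap M P R) m \<theta> (g m y)"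
    proof (rule g_eq)
      show "Act ?B m \<theta> y \<in> under_maps M S D i R (SCmp M S D R 0 x i) l"
        using simplicial_set_Act[OF B \<theta>, of y] y by simp
      show "Act (SMap M P R) m \<theta> (g m y) \<in> Simp (SMap M P R) l"
        by (rule simplicial_set_Act[OF SMap_sset[OF P(1) obj(4)] \<theta> g(1)[OF y]])
      show "precomp M D P R u l (Act (SMap M P R) m \<theta> (g m y)) = degen (SMap M D R) l x"
        using simplicial_map_Act[OF precomp_map[OF obj(2) P(1) obj(4) P(2)] \<theta> g(1)[OF y]] g(2)[OF y]
          degen_Act[OF SMap_sset[OF obj(2,4)] x \<theta>] by simp
      show "precomp M D P R v l (Act (SMap M P R) m \<theta> (g m y)) = Act ?B m \<theta> y"
        using simplicial_map_Act[OF precomp_map[OF obj(2) P(1) obj(4) P(3)] \<theta> g(1)[OF y]] g(3)[OF y] by simp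
    qed
  qed
  \<comment> \<open>Along \<open>g\<close>, the map \<open>?p\<close> is the pullback of restriction
    from \<open>D'\<close> to \<open>P\<close>, a Kan fibration because \<open>j\<close> is a
    cofibration.\<close>
  have horn: "ext_lift (std_simplex (Suc n)) (Simp (horn (Suc n) 0)) ?E ?B ?p" for n
  proof (rule ext_lift_pullback[OF _ _ gm])
    show "ext_lift (std_simplex (Suc n)) (Simp (horn (Suc n) 0)) (SMap M D' R) (SMap M P R) (precomp M P D' R j)"
      using kan_fibration_precomp[OF P(1) obj(3,4) R j] by (simp add: kan_fibration_horn)
    show "Simp (horn (Suc n) 0) m \<subseteq> Simp (std_simplex (Suc n)) m" for m by (auto simp: horn_def)
    show "f \<in> Simp (SMap M D' R) m" if "f \<in> under_maps M D D' ?ju R x m" for m f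
      using that by (simp add: under_maps_def)
    show "g m (?p m f) = precomp M P D' R j m f" if f: "f \<in> under_maps M D D' ?ju R x m" for m f
      by (rule g_eq[OF pB[OF f]]) (use f pu pv obj P jh in \<open>auto simp: under_maps_def\<close>)
    show "f \<in> under_maps M D D' ?ju R x m \<and> ?p m f = y"
      if "f \<in> Simp (SMap M D' R) m" "y \<in> Simp ?B m" "precomp M P D' R j m f = g m y" for m f y
    proof -
      have y: "y \<in> under_maps M S D i R (SCmp M S D R 0 x i) m" using that(2) by simp
      have "precomp M D D' R ?ju m f = degen (SMap M D R) m x"
        unfolding pu[OF that(1), symmetric] that(3) by (rule g(2)[OF y])
      moreover have "?p m f = y"
        unfolding pv[OF that(1), symmetric] that(3) by (rule g(3)[OF y])
      ultimately show ?thesis using that(1) by (simp add: under_maps_def)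
    qed
  qed
  \<comment> \<open>\<open>?E\<close> is the fibre over \<open>x\<close> of the trivial fibration
    induced by the copy \<open>u\<close>.\<close>
  have contr: "triv_fib ?E (std_simplex 0) (\<lambda>m _. replicate (Suc m) 0)"
  proof -
    let ?d = "\<lambda>n. degen (SMap M D R) n x"
    have pt: "simplicial_set (subsset (SMap M D R) (\<lambda>n. {?d n}))"
      by (rule simplicial_set_subsset[OF SMap_sset[OF obj(2,4)]])
        (use obj x degen_Act[OF SMap_sset[OF obj(2,4)] x] in \<open>auto simp: subcomplex_def\<close>)
    have "triv_fib ?E (subsset (SMap M D R) (\<lambda>n. {?d n})) (precomp M D D' R ?ju)"
    proof (rule triv_fib_pullback[OF triv_fib_precomp[OF obj(2,3,4) D R ju] E pt, where g = "\<lambda>n y. y"])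
      show "simplicial_map ?E (subsset (SMap M D R) (\<lambda>n. {?d n})) (precomp M D D' R ?ju)"
        using precomp_map[OF obj(2,3,4) juh] by (auto simp: simplicial_map_def under_maps_def[of M D])
      show "simplicial_map (subsset (SMap M D R) (\<lambda>n. {?d n})) (SMap M D R) (\<lambda>n y. y)"
        using obj x by (simp add: simplicial_map_def)
    qed (auto simp: under_maps_def)
    then show ?thesis by (rule triv_fib_to_point) simp
  qed
  have xcE: "?xc \<in> Simp ?E 0" using xcju obj juh x xch by (simp add: under_maps_0)
  have pxc: "?p 0 ?xc = x" using xcjv obj jvh by (simp add: precomp_0)
  note fib = fibre_loop_space[OF E B pm horn contr xcE pxc]
  \<comment> \<open>In the fibre over \<open>x\<close> both copies of \<open>D\<close> are sent to
    \<open>x\<close>. By uniqueness of gluing this fixes the restriction to \<open>P\<close>, so the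
    fibre consists of the maps under \<open>P\<close>.\<close>
  have "subsset ?E (\<lambda>n. {f \<in> Simp ?E n. ?p n f = degen ?B n x}) =
      subsset (SMap M D' R) (under_maps M P D' j R (SCmp M P D' R 0 ?xc j))"
  proof -
    have xcj: "degen (SMap M P R) n (SCmp M P D' R 0 ?xc j) = precomp M P D' R j n (degen (SMap M D' R) n ?xc)" for n
      using precomp_degen[OF P(1) obj(3,4) jh xch] by simp
    have xcu: "precomp M D P R u n (degen (SMap M P R) n (SCmp M P D' R 0 ?xc j)) = degen (SMap M D R) n x"
      and xcv: "precomp M D P R v n (degen (SMap M P R) n (SCmp M P D' R 0 ?xc j)) = degen (SMap M D R) n x" for n
      using obj xch juh jvh by (simp_all add: xcj pu pv precomp_degen xcju xcjv)
    have xB: "degen (SMap M D R) n x \<in> under_maps M S D i R (SCmp M S D R 0 x i) n" for n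
      using obj x xi by (simp add: under_maps_def)
    have gx: "g n (degen (SMap M D R) n x) = degen (SMap M P R) n (SCmp M P D' R 0 ?xc j)" for n
      by (rule g_eq[OF xB _ xcu xcv]) (use obj P jh xch in simp)
    have "f \<in> under_maps M D D' ?ju R x n \<and> ?p n f = degen (SMap M D R) n x \<longleftrightarrow>
        f \<in> under_maps M P D' j R (SCmp M P D' R 0 ?xc j) n" for n f
    proof (cases "f \<in> Simp (SMap M D' R) n")
      case True
      have "precomp M D D' R ?ju n f = degen (SMap M D R) n x \<and> ?p n f = degen (SMap M D R) n x \<longleftrightarrow>
          precomp M P D' R j n f = degen (SMap M P R) n (SCmp M P D' R 0 ?xc j)"
      proof
        assume *: "precomp M D D' R ?ju n f = degen (SMap M D R) n x \<and> ?p n f = degen (SMap M D R) n x"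
        have "g n (degen (SMap M D R) n x) = precomp M P D' R j n f"
          by (rule g_eq[OF xB]) (use * True pu pv obj P jh in simp_all)
        then show "precomp M P D' R j n f = degen (SMap M P R) n (SCmp M P D' R 0 ?xc j)" using gx by simp
      next
        assume "precomp M P D' R j n f = degen (SMap M P R) n (SCmp M P D' R 0 ?xc j)"
        then show "precomp M D D' R ?ju n f = degen (SMap M D R) n x \<and> ?p n f = degen (SMap M D R) n x"
          unfolding pu[OF True, symmetric] pv[OF True, symmetric] using xcu xcv by simp
      qed
      then show ?thesis using True by (simp add: under_maps_def)
    qed (simp add: under_maps_def)
    then show ?thesis by (simp add: set_eq_iff fun_eq_iff)
  qed
  with fib show ?thesis by (intro equivclp_sym[OF span_equivclp]) simp
qed

end

section \<open>Iteration over the spheres, and comparison with the given replacements\<close>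

theorem theorem4p5:
  fixes M :: "('o, 's) smcat" and D :: "('o, 's) sphere_data" and X :: "'o \<times> 's" and n :: nat
  assumes small: "infinite (UNIV :: 'k set)"
    and M: "left_proper_simplicial_model_category TYPE('k) M"
    and D: "spheres_and_disks M D"
    and X: "X \<in> SObj (under M (Dsk D 1))"
    and Q: "cofibrant_replacement M (Dsk D 1) Q q"
    and R: "fibrant_replacement M (fst (g_pull M D 0 X)) R r"
    and Q': "cofibrant_replacement (under M (Sph D n)) (Dsk D (Suc n), incl D n) Q' q'"
    and R': "fibrant_replacement (under M (Sph D n)) (g_pull M D n X) R' r'"
  shows "weakly_equivalent
           (fst ((loop_space ^^ n) (SMap M Q R, map_base M (Dsk D 1) X Q q R r)))
           (SMap (under M (Sph D n)) Q' R')"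
proof -
  have model: "simplicial_model_category TYPE('k) M"
    using M by (simp add: left_proper_simplicial_model_category_def)
  interpret smodel M "TYPE('k)"
    by unfold_locales (use small model in \<open>auto simp: simplicial_model_category_def\<close>)
  \<comment> \<open>With the shifted indices, \<open>?S k\<close> is the sphere of dimension
    \<open>k - 1\<close> and \<open>?D k\<close> the disk of dimension \<open>k\<close>.\<close>
  let ?S = "Sph D" and ?D = "\<lambda>k. Dsk D (Suc k)" and ?i = "incl D" and ?c = "collapse M D"
  have I: "is_initial (ucat M) (?S 0)" and T: "is_terminal (ucat M) (Dsk D 0)"
    and So: "\<And>k. ?S k \<in> SObj M" and Do: "\<And>k. Dsk D k \<in> SObj M"
    and i: "\<And>k. ?i k \<in> Cof M (?S k) (?D k)" and c: "\<And>k. coll D k \<in> Weq M (?D k) (Dsk D k)"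
    and b: "\<And>k. bdry D k = SCmp M (?S k) (?D k) (Dsk D k) 0 (coll D k) (?i k)"
    and po: "\<And>k. \<exists>u v. is_pushout (ucat M) (?S k) (?D k) (?D k) (?S (Suc k)) (?i k) (?i k) u v \<and>
      SCmp M (?D k) (?S (Suc k)) (?D k) 0 (bdry D (Suc k)) u = SIde M (?D k) \<and>
      SCmp M (?D k) (?S (Suc k)) (?D k) 0 (bdry D (Suc k)) v = SIde M (?D k)"
    using D unfolding spheres_and_disks_def ucat_simps by blast+
  have ih: "?i k \<in> hom (?S k) (?D k)" for k by (rule cof_hom[OF So Do i])
  have cofS: "cofibrant M (?S k)" for k
  proof (induction k)
    case 0
    show ?case by (rule initial_cofibrant[OF I])
  next
    case (Suc k)
    obtain u v where "is_pushout (ucat M) (?S k) (?D k) (?D k) (?S (Suc k)) (?i k) (?i k) u v" using po by blast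
    then have "v \<in> Cof M (?D k) (?S (Suc k))" using pushout_cof i by blast
    then show ?case
      using cofibrant_target[OF Do So] cofibrant_target[OF So Do Suc i] by blast
  qed
  have colh: "coll D k \<in> hom (?D k) (Dsk D k)" for k by (rule weq_hom[OF Do Do c])
  have ch: "?c k \<in> hom (?D k) (?D 0)" for k
    by (induction k) (use Do colh in simp_all)
  obtain X0 \<xi> where Xe: "X = (X0, \<xi>)" by fastforce
  have X0: "X0 \<in> SObj M" and \<xi>: "\<xi> \<in> hom (?D 0) X0" using X by (auto simp: Xe)
  have Qo: "Q \<in> SObj M" and Qc: "cofibrant M Q" and q: "q \<in> Weq M Q (?D 0)"
    using Q by (auto simp: cofibrant_replacement_def)
  have Ro: "R \<in> SObj M" and Rf: "fibrant M R" and r: "r \<in> Weq M X0 R"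
    using R by (auto simp: fibrant_replacement_def g_pull_def under_pull_def Xe)
  have rh: "r \<in> hom X0 R" by (rule weq_hom[OF X0 Ro r])
  define y where "y = SCmp M (?D 0) X0 R 0 r \<xi>"
  have yh: "y \<in> hom (?D 0) R" using Do X0 Ro \<xi> rh by (simp add: y_def)
  \<comment> \<open>The base points: the disk is collapsed to \<open>?D 0\<close>, which is mapped
    to \<open>X0\<close> by the structure map \<open>\<xi>\<close> and on to
    \<open>R\<close>.\<close>
  define x where "x k = SCmp M (?D k) (?D 0) R 0 y (?c k)" for k
  have xh: "x k \<in> hom (?D k) R" for k using Do Ro ch yh by (simp add: x_def)
  \<comment> \<open>The disk is used as its own cofibrant replacement, since \<open>?i k\<close> is
    a cofibration, and the replacement \<open>R\<close> chosen in \<open>M\<close> is the target for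
    all \<open>k\<close>. The inductive step needs such a common target.\<close>
  define F where "F k = (SMap (under M (?S k)) (?D k, ?i k) (R, SCmp M (?S k) (?D k) R 0 (x k) (?i k)), x k)" for k
  have xS: "x (Suc k) = SCmp M (?D (Suc k)) (?D k) R 0 (x k) (coll D (Suc k))" for k
    using SCmp_assoc[OF Do Do Do Ro colh[of "Suc k"] ch[of k] yh] by (simp add: x_def)
  have loops: "equivclp pointed_triv_fib ((loop_space ^^ k) (F 0)) (F k)" for k
  proof (induction k)
    case (Suc k)
    obtain u v where uv: "is_pushout (ucat M) (?S k) (?D k) (?D k) (?S (Suc k)) (?i k) (?i k) u v"
      "SCmp M (?D k) (?S (Suc k)) (?D k) 0 (bdry D (Suc k)) u = SIde M (?D k)"
      "SCmp M (?D k) (?S (Suc k)) (?D k) 0 (bdry D (Suc k)) v = SIde M (?D k)" using po by blast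
    have "equivclp pointed_triv_fib (loop_space (F k)) (F (Suc k))"
      unfolding F_def xS
      by (rule disk_loop_space[OF So Do Do Ro cofS Rf i uv(1) i c uv(2)[unfolded b] uv(3)[unfolded b] xh])
    then show ?case using equivclp_trans[OF equivclp_loop_space[OF Suc]] by simp
  qed simp
  have "equivclp pointed_triv_fib (SMap M Q R, map_base M (Dsk D 1) X Q q R r) (F 0)"
  proof -
    obtain a where a: "a \<in> hom (?S 0) Q" using map_from_initial[OF Qo I] by blast
    have ac: "a \<in> Cof M (?S 0) Q" by (rule initial_cof[OF I Qc Qo a])
    have qh: "q \<in> hom Q (?D 0)" by (rule weq_hom[OF Qo Do q])
    let ?s = "SCmp M (?S 0) (?D 0) R 0 y (SCmp M (?S 0) Q (?D 0) 0 q a)"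
    have sh: "?s \<in> hom (?S 0) R" using So Do Qo Ro a qh yh by simp
    have "equivclp pointed_triv_fib (SMap (under M (?S 0)) (Q, a) (R, ?s), SCmp M Q (?D 0) R 0 y q)
        (SMap (under M (?S 0)) (?D 0, ?i 0) (R, ?s), SCmp M (?D 0) (?D 0) R 0 y (SIde M (?D 0)))"
    proof (rule change_source[OF So Qo Do Do Ro cofS Rf ac i q weq_id[OF Do] _ yh refl])
      show "SCmp M (?S 0) Q (?D 0) 0 q a = SCmp M (?S 0) (?D 0) (?D 0) 0 (SIde M (?D 0)) (?i 0)"
        by (rule map_initial_unique[OF Do I, where n = 0]) (use So Qo Do a qh ih[of 0] in simp_all)
    qed
    \<comment> \<open>Under an initial object the structure condition is void, so the mapping space
      is that of \<open>M\<close>.\<close>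
    moreover have "under_maps M (?S 0) Q a R ?s = Simp (SMap M Q R)"
    proof -
      have "precomp M (?S 0) Q R a m f = degen (SMap M (?S 0) R) m ?s" if "f \<in> Simp (SMap M Q R) m" for m f
        by (rule map_initial_unique[OF Ro I, where n = m]) (use So Qo Ro a sh that in simp_all)
      then show ?thesis by (auto simp: under_maps_def)
    qed
    moreover have "SCmp M Q (?D 0) R 0 y q = map_base M (Dsk D 1) X Q q R r"
      by (simp add: map_base_def y_def Xe)
    moreover have "x 0 = SCmp M (?D 0) (?D 0) R 0 y (SIde M (?D 0))" by (simp add: x_def)
    moreover have "SCmp M (?S 0) (?D 0) R 0 (x 0) (?i 0) = ?s"
      by (rule map_initial_unique[OF Ro I _ sh]) (use So Do Ro xh[of 0] ih[of 0] in simp)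
    ultimately show ?thesis by (simp add: F_def)
  qed
  then have 1: "equivclp pointed_triv_fib ((loop_space ^^ n) (SMap M Q R, map_base M (Dsk D 1) X Q q R r)) (F n)"
    using equivclp_trans[OF equivclp_loop_space_funpow loops] by blast
  let ?e = "?S n"
  have gX: "g_pull M D n X = (X0, SCmp M ?e (?D 0) X0 0 \<xi> (SCmp M ?e (?D n) (?D 0) 0 (?c n) (?i n)))"
    by (simp add: g_pull_def under_pull_def sphere_to_point_def Xe)
  obtain R0 \<rho> where Re: "R' = (R0, \<rho>)" by fastforce
  obtain Q0 \<sigma> where Qe: "Q' = (Q0, \<sigma>)" by fastforce
  have R0: "R0 \<in> SObj M" "\<rho> \<in> hom ?e R0" and R'u: "R' \<in> SObj (under M ?e)" and R'f: "fibrant (under M ?e) R'"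
    using R' by (auto simp: fibrant_replacement_def Re)
  have R0f: "fibrant M R0" using under_fibrant[OF So T R'u R'f] by (simp add: Re)
  have Q0: "Q0 \<in> SObj M" "\<sigma> \<in> hom ?e Q0" and Q'u: "Q' \<in> SObj (under M ?e)" and Q'c: "cofibrant (under M ?e) Q'"
    using Q' by (auto simp: cofibrant_replacement_def Qe)
  have \<sigma>: "\<sigma> \<in> Cof M ?e Q0" using under_cofibrant[OF So Q'u Q'c] by (simp add: Qe)
  define z where "z = SCmp M (?D n) (?D 0) X0 0 \<xi> (?c n)"
  have zh: "z \<in> hom (?D n) X0" using Do X0 \<xi> ch by (simp add: z_def)
  have zi: "SCmp M ?e (?D n) X0 0 z (?i n) = SCmp M ?e (?D 0) X0 0 \<xi> (SCmp M ?e (?D n) (?D 0) 0 (?c n) (?i n))"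
    unfolding z_def by (rule SCmp_assoc[OF So Do Do X0 ih ch \<xi>])
  have zih: "SCmp M ?e (?D n) X0 0 z (?i n) \<in> hom ?e X0" using So Do X0 zh ih by simp
  have r': "r' \<in> Weq M X0 R0" "SCmp M ?e X0 R0 0 r' (SCmp M ?e (?D n) X0 0 z (?i n)) = \<rho>"
    using R' under_maps_0[OF So X0 R0(1) zih R0(2)]
    by (auto simp: fibrant_replacement_def Re gX simp flip: zi)
  have q': "q' \<in> Weq M Q0 (?D n)" "SCmp M ?e Q0 (?D n) 0 q' \<sigma> = ?i n"
    using Q' under_maps_0[OF So Q0(1) Do Q0(2) ih] by (auto simp: cofibrant_replacement_def Qe)
  have r'h: "r' \<in> hom X0 R0" by (rule weq_hom[OF X0 R0(1) r'(1)])
  have xn: "x n = SCmp M (?D n) X0 R 0 r z"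
    unfolding x_def y_def z_def by (rule SCmp_assoc[OF Do Do X0 Ro ch \<xi> rh])
  \<comment> \<open>\<open>R\<close> and \<open>R0\<close> are both fibrant and receive weak
    equivalences from \<open>X0\<close>; the base point comes from \<open>z\<close>, a map to
    \<open>X0\<close> itself.\<close>
  have 2: "equivclp pointed_triv_fib (F n) (SMap (under M ?e) (?D n, ?i n) (R0, \<rho>), SCmp M (?D n) X0 R0 0 r' z)"
    unfolding F_def xn
    by (rule change_target[OF So Do X0 Ro R0(1) cofS Rf R0f i r r'(1) zh SCmp_assoc[OF So Do X0 Ro ih zh rh] r'(2)[symmetric]])
  let ?z = "SCmp M (?D n) X0 R0 0 r' z"
  have zh': "?z \<in> hom (?D n) R0" using Do X0 R0 r'h zh by simp
  \<comment> \<open>\<open>Q0\<close> and the disk are compared over the disk, by \<open>q'\<close>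
    and the identity.\<close>
  have 3: "equivclp pointed_triv_fib (SMap (under M ?e) (Q0, \<sigma>) (R0, \<rho>), SCmp M Q0 (?D n) R0 0 ?z q')
      (SMap (under M ?e) (?D n, ?i n) (R0, \<rho>), SCmp M (?D n) (?D n) R0 0 ?z (SIde M (?D n)))"
  proof (rule change_source[OF So Q0(1) Do Do R0(1) cofS R0f \<sigma> i q'(1) weq_id[OF Do] _ zh'])
    show "SCmp M ?e Q0 (?D n) 0 q' \<sigma> = SCmp M ?e (?D n) (?D n) 0 (SIde M (?D n)) (?i n)"
      using q'(2) So Do ih by simp
    show "\<rho> = SCmp M ?e (?D n) R0 0 ?z (SCmp M ?e Q0 (?D n) 0 q' \<sigma>)"
      unfolding q'(2) using SCmp_assoc[OF So Do X0 R0(1) ih zh r'h] r'(2) by simp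
  qed
  then have 3: "equivclp pointed_triv_fib (SMap (under M ?e) (?D n, ?i n) (R0, \<rho>), ?z)
      (SMap (under M ?e) Q' R', SCmp M Q0 (?D n) R0 0 ?z q')"
    using Do R0 zh' by (simp add: Qe Re equivclp_sym)
  have "simplicial_set (SMap (under M ?e) Q' R')"
    using simplicial_set_under_maps[OF So Q0(1) R0(1) Q0(2) R0(2)] by (simp add: Qe Re)
  then show ?thesis
    using pointed_equivalence_weakly_equivalent[OF equivclp_trans[OF 1 equivclp_trans[OF 2 3]]] by simp
qed

end
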